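(* In the setting described in the context (in particular under assumptions (A1)–(A7) and with exact data $y=G(\theta^\dagger)$), consider either the bi-level algorithm or the sequential bi-level algorithm, run with noise-free data $y$ and initial guess $\widetilde\theta^0\in B_R^X(\theta^\dagger)$, $\|\widetilde\theta^0-\theta^\dagger\|_X\le R_0<R$. Let $0\le\sigma<\mu_R$ and let $\eta>0$ satisfy $(1+\eta)\widetilde M_R^2<M_R^2+\mu_R/2$. Assume that for each $j$ the lower-level iteration is terminated at a stopping index $\kappa(j)$, where the stopping indices are chosen so that the resulting state errors $\epsilon_j=\|u^j_{\kappa(j)}-S(\widetilde\theta^j)\|_{\mathcal U}$ satisfy $$C_{\mathrm{pri}}\sum_{j=0}^\infty \epsilon_j^2\le R^2-R_0^2,\qquad C_{\mathrm{pri}}:=\|L\|^2\left(\frac{2\,(K_R+C_{\nabla f,A}R)^2}{\mu_R-\sigma}+\Big(1+\frac1\eta\Big)\widetilde M_R^2+2C_{\nabla f,A}R\right).$$ Then: (i) the approximate parameter sequence $\{\widetilde\theta^j\}_{j}$ remains in the ball $B_R^X(\theta^\dagger)$; (ii) there exists a subsequence $\{\widetilde\theta^{j_n}\}_n$ converging weakly in $X$ to some $\bar\theta$ with $G(\bar\theta)=y$, and the full image sequence converges strongly: $G(\widetilde\theta^j)\to y$ in $\mathcal Y$ as $j\to\infty$.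
   Context: Spaces and operators. $U\hookrightarrow H\hookrightarrow U^*$ is a Gelfand triple with $U$ a Hilbert space, $T>0$, $\mathcal U=L^2(0,T;U)$, $\mathcal U^*=L^2(0,T;U^* )$, $\mathcal V=\{u\in\mathcal U:\dot u\in\mathcal U^*\}$ (so $\mathcal V\hookrightarrow C(0,T;H)$). $X$ (parameter space) and $\mathcal Y$ (observation space) are Hilbert spaces, $A:X\to H$ and $L:\mathcal U\to\mathcal Y$ are bounded linear. $f:(0,T)\times X\times U\to U^*$ is a nonlinear Carathéodory map inducing $f:X\times\mathcal V\to\mathcal U^*$, $[f(\theta,u)](t)=f(t,\theta,u(t))$, with partial derivatives $f'_\theta,f'_u$. $S:X\to\mathcal V$ is the parameter-to-state map: $u=S(\theta)$ solves $\dot u+f(\theta,u)=0$ on $(0,T)$, $u(0)=A\theta$ (assumed solvable); $S$ is Fréchet differentiable. $G=L\circ S$. Set $F(\theta,u)={}_\theta\mathbf F(u)=(\dot u+f(\theta,u),\,u|_{t=0}-A\theta)\in\mathcal U^*\times H$, so that $u=S(\theta)$ solves $F(\theta,u)=\varphi$ (with $\varphi=0$). $D_U:U\to U^*$ and $I_X:X^*\to X$ are (Riesz) isomorphisms; $^\star$ is the Banach space adjoint, $^*$ on operators between Hilbert spaces is the Hilbert space adjoint. $\theta^\dagger$ is the exact parameter, $u^\dagger=S(\theta^\dagger)$, $y=G(\theta^\dagger)$; $B_R^X(\theta^\dagger)$, $B_r^{\mathcal V}(u^\dagger)$ are closed balls. Algorithms (noise-free data $y$). Upper level: $\widetilde\theta^{j+1}=\widetilde\theta^j-\widetilde{S'}(\widetilde\theta^j)^*L^*\big(L\widetilde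 S_{\kappa(j)}(\widetilde\theta^j)-y\big)$, $j=0,1,\dots$. Lower level: for each $j$, starting from $u^j_0$, $u^j_{k+1}=u^j_k-F'_u(\widetilde\theta^j,u^j_k)^*\big(F(\widetilde\theta^j,u^j_k)-\varphi\big)$ until $k=\kappa(j)$, and $\widetilde S_{\kappa(j)}(\widetilde\theta^j):=u^j_{\kappa(j)}$. In the bi-level algorithm $u^j_0$ is arbitrary in $B^{\mathcal V}_{r/2}(u^j_* )$, where $u^j_*:=S(\widetilde\theta^j)$; in the sequential bi-level algorithm $u^j_0:=u^{j-1}_{\kappa(j-1)}$ for $j\ge1$, and it is assumed that $u^j_0\in B^{\mathcal V}_{r/2}(u^j_* )$ for all $j$. The states $u^j_*$ and the lower-level iterates $u^j_k$ lie in $B_r^{\mathcal V}(u^\dagger)$ as long as $\widetilde\theta^j\in B_R^X(\theta^\dagger)$. The approximate adjoint is, for $v\in\mathcal U$, $$\widetilde{S'}(\widetilde\theta^j)^*v=-\int_0^T I_Xf'_\theta(\widetilde\theta^j,u^j_{\kappa(j)})(t)^\star\tilde z(t)\,dt+I_XA^\star\tilde z(0),$$ where $-\dot{\tilde z}+f'_u(\widetilde\theta^j,u^j_{\kappa(j)})^\star\tilde z=D_Uv$ on $(0,T)$, $\tilde z(T)=0$ (the exact adjoint $S'(\theta)^*v$ has the same form with $S(\theta)$ in place of $u^j_{\kappa(j)}$). Assumptions: for all $\theta,\hat\theta\in B_R^X(\theta^\dagger)$, $u,\hat u\in B_r^{\mathcal V}(u^\dagger)$, with positive constants $\overline M_S,M_S,C_{f_u},L_{\nabla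 f},C_{coe},M_r,\mu_r,M_R,\mu_R,K_R$, where $M_r^2+\mu_r<2$, $M_R^2+\mu_R<2$: (A1) $\|S'(\theta)\|_{X\to\mathcal V}\le\overline M_S$, $\|S'(\theta)\|_{X\to\mathcal U}\le M_S$, $\|G'(\theta)\|_{X\to\mathcal Y}\le M_R$. (A2) The adjoint equation $-\dot z+f'_u(\theta,u)^\star z=h$, $z(T)=0$ has a solution with $\|z\|_{\mathcal U}+\|z(0)\|_H\le C_{f_u}\|h\|_{\mathcal U^*}$. (A3) $\|f'_\theta(\theta,u)-f'_\theta(\hat\theta,\hat u)\|_{X\to\mathcal U^*}+\|f'_u(\theta,u)-f'_u(\hat\theta,\hat u)\|_{\mathcal U\to\mathcal U^*}\le L_{\nabla f}(\|\theta-\hat\theta\|_X+\|u-\hat u\|_{\mathcal U})$. (A4) $\|{}_\theta\mathbf F'(u)\|_{\mathcal V\to\mathcal U^*\times H}\le M_r$. (A5) $2\big({}_\theta\mathbf F(u)-{}_\theta\mathbf F(\hat u),{}_\theta\mathbf F'(u)(u-\hat u)\big)_{\mathcal U^*\times H}\ge(M_r^2+\mu_r)\|{}_\theta\mathbf F(u)-{}_\theta\mathbf F(\hat u)\|^2_{\mathcal U^*\times H}$. (A6) For some $\alpha\ge1$: $C_{coe}\|{}_\theta\mathbf F(u)-{}_\theta\mathbf F(u_* )\|_{\mathcal U^*\times H}\ge\|u-u_*\|_{\mathcal V}^\alpha$, $u_*=S(\theta)$. (A7) $2\big(G(\theta)-G(\hat\theta),G'(\theta)(\theta-\hat\theta)\big)_{\mathcal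 Y}\ge(M_R^2+\mu_R)\|G(\theta)-G(\hat\theta)\|^2_{\mathcal Y}$ and $\|G'(\theta)(\theta-\hat\theta)\|_{\mathcal Y}\le K_R\|G(\theta)-G(\hat\theta)\|_{\mathcal Y}$. Constants. $L_{R,r}:=L_{\nabla f}(R+rC_{\mathcal V\to\mathcal U})+\|f'_\theta(\theta^\dagger,u^\dagger)\|_{X\to\mathcal U^*}+\|f'_u(\theta^\dagger,u^\dagger)\|_{\mathcal U\to\mathcal U^*}$ with $C_{\mathcal V\to\mathcal U}$ the embedding norm; $C_{\nabla f,A}:=L_{\nabla f}C_{f_u}\|I_X\|\|D_U\|\,[L_{R,r}C_{f_u}+1+\|A\|C_{f_u}]$; $\bar\epsilon$ is an upper bound of all $\epsilon_j$; $\widetilde M_R:=(M_S+C_{\nabla f,A}\bar\epsilon)\|L\|$. *)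

theory Defs
  imports "HOL-Analysis.Analysis"
begin

text \<open>
  Real Hilbert spaces are types of sort \<open>{real_inner, banach}\<close>, and the dual of a space \<open>'e\<close> is
  the type \<open>'e \<Rightarrow>\<^sub>L real\<close>. For a Hilbert space the Riesz isomorphism onto the dual is
  \<^const>\<open>blinfun_inner_right\<close>; hence \<open>D_U = blinfun_inner_right\<close> and
  \<open>I_X = inv blinfun_inner_right\<close>.
\<close>

abbreviation time_measure :: "real \<Rightarrow> real measure" where
  "time_measure T \<equiv> lebesgue_on {0<..<T}"

subsection \<open>Lebesgue--Bochner spaces\<close>

text \<open>
  No separability is imposed on the values, so strong measurability is spelled out instead of
  using \<^const>\<open>borel_measurable\<close>.
\<close>

definition strongly_measurable :: "'a measure \<Rightarrow> ('a \<Rightarrow> 'e::real_normed_vector) \<Rightarrow> bool" where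
  "strongly_measurable M g \<longleftrightarrow>
    (\<exists>s. (\<forall>n. simple_function M (s n)) \<and> (AE t in M. (\<lambda>n. s n t) \<longlonglongrightarrow> g t))"

definition square_integrable :: "real \<Rightarrow> (real \<Rightarrow> 'e::real_normed_vector) \<Rightarrow> bool" where
  "square_integrable T g \<longleftrightarrow>
    strongly_measurable (time_measure T) g \<and> integrable (time_measure T) (\<lambda>t. (norm (g t))\<^sup>2)"

text \<open>
  \<open>L2_space T ev\<close>: the Hilbert space \<open>'s\<close> is \<open>L\<^sup>2(0,T;'e)\<close>, where \<open>ev w\<close> is a representative of
  the class \<open>w\<close>. The length \<open>T\<close> is a term, so \<open>L\<^sup>2(0,T;'e)\<close> cannot be a type constructor; the
  predicate determines \<open>'s\<close> and \<open>ev\<close> up to isometric isomorphism and null sets.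
\<close>

definition L2_space ::
    "real \<Rightarrow> ('s::{real_inner,banach} \<Rightarrow> real \<Rightarrow> 'e::real_normed_vector) \<Rightarrow> bool" where
  "L2_space T ev \<longleftrightarrow>
    (\<forall>w. square_integrable T (ev w)) \<and>
    (\<forall>v w. AE t in time_measure T. ev (v + w) t = ev v t + ev w t) \<and>
    (\<forall>c w. AE t in time_measure T. ev (c *\<^sub>R w) t = c *\<^sub>R ev w t) \<and>
    (\<forall>w. (norm w)\<^sup>2 = (\<integral>t. (norm (ev w t))\<^sup>2 \<partial>time_measure T)) \<and>
    (\<forall>g. square_integrable T g \<longrightarrow> (\<exists>w. AE t in time_measure T. ev w t = g t))"

text \<open>The duality pairing of \<open>L\<^sup>2(0,T;U\<^sup>*)\<close> with \<open>L\<^sup>2(0,T;U)\<close>.\<close>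

definition L2_pairing ::
    "real \<Rightarrow> ('us \<Rightarrow> real \<Rightarrow> ('u::real_normed_vector \<Rightarrow>\<^sub>L real)) \<Rightarrow> ('uu \<Rightarrow> real \<Rightarrow> 'u) \<Rightarrow>
      'us \<Rightarrow> 'uu \<Rightarrow> real" where
  "L2_pairing T evUs evU g w = (\<integral>t. blinfun_apply (evUs g t) (evU w t) \<partial>time_measure T)"

text \<open>
  The Banach space adjoint of an operator from \<open>L\<^sup>2(0,T;U)\<close> to its dual \<open>L\<^sup>2(0,T;U\<^sup>*)\<close>, with
  \<open>L\<^sup>2(0,T;U)\<close> identified with its bidual.
\<close>

definition L2_adjoint ::
    "real \<Rightarrow> ('us::real_normed_vector \<Rightarrow> real \<Rightarrow> ('u::real_normed_vector \<Rightarrow>\<^sub>L real)) \<Rightarrow>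
      ('uu::real_normed_vector \<Rightarrow> real \<Rightarrow> 'u) \<Rightarrow> ('uu \<Rightarrow>\<^sub>L 'us) \<Rightarrow> 'uu \<Rightarrow> 'us" where
  "L2_adjoint T evUs evU B z =
    (THE g. \<forall>w. L2_pairing T evUs evU g w = L2_pairing T evUs evU (blinfun_apply B w) z)"

definition L2_riesz ::
    "real \<Rightarrow> ('us \<Rightarrow> real \<Rightarrow> ('u::real_inner \<Rightarrow>\<^sub>L real)) \<Rightarrow> ('uu \<Rightarrow> real \<Rightarrow> 'u) \<Rightarrow> 'uu \<Rightarrow> 'us" where
  "L2_riesz T evUs evU v =
    (THE g. AE t in time_measure T. evUs g t = blinfun_inner_right (evU v t))"

subsection \<open>Gelfand triple and the solution space\<close>

text \<open>The embedding of \<open>H\<close> into the dual of \<open>U\<close> is \<open>h \<mapsto> (x \<mapsto> (h, \<iota> x)\<^sub>H)\<close>.\<close>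

definition gelfand_triple :: "('u::real_inner \<Rightarrow>\<^sub>L 'h::real_inner) \<Rightarrow> bool" where
  "gelfand_triple \<iota> \<longleftrightarrow> inj (blinfun_apply \<iota>) \<and> closure (range (blinfun_apply \<iota>)) = UNIV"

definition test_function :: "real \<Rightarrow> (real \<Rightarrow> real) \<Rightarrow> (real \<Rightarrow> real) \<Rightarrow> bool" where
  "test_function T \<phi> \<phi>' \<longleftrightarrow>
    (\<forall>t. (\<phi> has_real_derivative \<phi>' t) (at t)) \<and> continuous_on UNIV \<phi>' \<and>
    (\<exists>a b. 0 < a \<and> b < T \<and> (\<forall>t. t \<notin> {a..b} \<longrightarrow> \<phi> t = 0))"

text \<open>
  \<open>g\<close> is the derivative of \<open>u\<close> in the sense of distributions on \<open>(0,T)\<close> with values in the dual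
  of \<open>U\<close>; the identity of functionals is tested with all \<open>x\<close> in \<open>U\<close>.
\<close>

definition weak_derivative ::
    "real \<Rightarrow> ('u::real_inner \<Rightarrow>\<^sub>L 'h::real_inner) \<Rightarrow> (real \<Rightarrow> 'u) \<Rightarrow> (real \<Rightarrow> ('u \<Rightarrow>\<^sub>L real)) \<Rightarrow> bool" where
  "weak_derivative T \<iota> u g \<longleftrightarrow>
    (\<forall>\<phi> \<phi>'. test_function T \<phi> \<phi>' \<longrightarrow>
      (\<forall>x. (\<integral>t. (blinfun_apply \<iota> (u t) \<bullet> blinfun_apply \<iota> x) * \<phi>' t \<partial>time_measure T)
          = - (\<integral>t. blinfun_apply (g t) x * \<phi> t \<partial>time_measure T)))"

text \<open>
  \<open>solution_space T \<iota> evUs evU emb dt tr\<close>: the Hilbert space \<open>'v\<close> is the space of all \<open>u\<close> in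
  \<open>L\<^sup>2(0,T;U)\<close> with weak derivative in \<open>L\<^sup>2(0,T;U\<^sup>*)\<close>, under the graph inner product. The maps
  \<open>emb\<close> and \<open>dt\<close> are the embedding into \<open>L\<^sup>2(0,T;U)\<close> and the time derivative, and \<open>tr v\<close> is the
  representative of \<open>v\<close> in \<open>C([0,T];H)\<close>, which gives a meaning to \<open>v(0)\<close> and \<open>v(T)\<close>.
\<close>

definition solution_space ::
    "real \<Rightarrow> ('u::real_inner \<Rightarrow>\<^sub>L 'h::real_inner) \<Rightarrow> ('us::real_inner \<Rightarrow> real \<Rightarrow> ('u \<Rightarrow>\<^sub>L real)) \<Rightarrow>
      ('uu::real_inner \<Rightarrow> real \<Rightarrow> 'u) \<Rightarrow>
      ('v::{real_inner,banach} \<Rightarrow> 'uu) \<Rightarrow> ('v \<Rightarrow> 'us) \<Rightarrow> ('v \<Rightarrow> real \<Rightarrow> 'h) \<Rightarrow> bool" where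
  "solution_space T \<iota> evUs evU emb dt tr \<longleftrightarrow>
    linear emb \<and> linear dt \<and> inj emb \<and>
    (\<forall>v w. v \<bullet> w = emb v \<bullet> emb w + dt v \<bullet> dt w) \<and>
    (\<forall>v. weak_derivative T \<iota> (evU (emb v)) (evUs (dt v))) \<and>
    (\<forall>u g. weak_derivative T \<iota> (evU u) (evUs g) \<longrightarrow> (\<exists>v. emb v = u \<and> dt v = g)) \<and>
    (\<forall>v. continuous_on {0..T} (tr v) \<and>
         (AE t in time_measure T. tr v t = blinfun_apply \<iota> (evU (emb v) t)))"

subsection \<open>The nonlinearity\<close>

definition caratheodory ::
    "real \<Rightarrow> (real \<Rightarrow> 'x::real_normed_vector \<Rightarrow> 'u::real_normed_vector \<Rightarrow> 'e::real_normed_vector) \<Rightarrow> bool"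
  where
  "caratheodory T f \<longleftrightarrow>
    (\<forall>\<theta> x. strongly_measurable (time_measure T) (\<lambda>t. f t \<theta> x)) \<and>
    (AE t in time_measure T. continuous_on UNIV (\<lambda>(\<theta>, x). f t \<theta> x))"

subsection \<open>The adjoint equation and the approximate adjoint\<close>

text \<open>
  \<open>-z' + B\<^sup>\<star> z = h\<close> on \<open>(0,T)\<close>, \<open>z(T) = 0\<close>; here \<open>B\<close> stands for \<open>f'\<^sub>u(\<theta>,u)\<close>.
\<close>

definition adjoint_equation ::
    "real \<Rightarrow> ('us::real_normed_vector \<Rightarrow> real \<Rightarrow> ('u::real_normed_vector \<Rightarrow>\<^sub>L real)) \<Rightarrow>
      ('uu::real_normed_vector \<Rightarrow> real \<Rightarrow> 'u) \<Rightarrow>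
      ('v \<Rightarrow> 'uu) \<Rightarrow> ('v \<Rightarrow> 'us) \<Rightarrow> ('v \<Rightarrow> real \<Rightarrow> 'h::real_normed_vector) \<Rightarrow>
      ('uu \<Rightarrow>\<^sub>L 'us) \<Rightarrow> 'us \<Rightarrow> 'v \<Rightarrow> bool" where
  "adjoint_equation T evUs evU emb dt tr B h z \<longleftrightarrow>
    - dt z + L2_adjoint T evUs evU B (emb z) = h \<and> tr z T = 0"

text \<open>
  The integral of \<open>F\<close> over \<open>(0,T)\<close> in the weak (Pettis) sense, which agrees with the Bochner integral
  whenever the latter exists.
\<close>

definition has_weak_integral :: "real \<Rightarrow> (real \<Rightarrow> 'x::real_inner) \<Rightarrow> 'x \<Rightarrow> bool" where
  "has_weak_integral T F q \<longleftrightarrow>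
    (\<forall>\<xi>. has_bochner_integral (time_measure T) (\<lambda>t. F t \<bullet> \<xi>) (q \<bullet> \<xi>))"

definition bidual :: "'u::real_normed_vector \<Rightarrow> (('u \<Rightarrow>\<^sub>L real) \<Rightarrow>\<^sub>L real)" where
  "bidual x = Blinfun (\<lambda>\<psi>. blinfun_apply \<psi> x)"

text \<open>
  \<open>p = - \<integral> I_X f'\<^sub>\<theta>(\<theta>,u)(t)\<^sup>\<star> z(t) dt + I_X A\<^sup>\<star> z(0)\<close>, where \<open>z\<close> solves the adjoint equation with
  right-hand side \<open>D_U v\<close> and obeys its stability estimate with constant \<open>C\<close>. The arguments \<open>B\<close> and
  \<open>Bt\<close> stand for \<open>f'\<^sub>u(\<theta>,u)\<close> and \<open>t \<mapsto> f'\<^sub>\<theta>(\<theta>,u)(t)\<close>. The Banach adjoint of an operator \<open>K\<close> is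
  \<open>\<psi> \<mapsto> \<psi> \<circ> K\<close>. If the adjoint equation is uniquely solvable with that estimate, then the estimate
  in this definition is redundant and \<open>p\<close> is a function of \<open>v\<close>.
\<close>

definition approx_adjoint ::
    "real \<Rightarrow> ('us::real_inner \<Rightarrow> real \<Rightarrow> ('u::real_inner \<Rightarrow>\<^sub>L real)) \<Rightarrow> ('uu::real_inner \<Rightarrow> real \<Rightarrow> 'u) \<Rightarrow>
      ('v \<Rightarrow> 'uu) \<Rightarrow> ('v \<Rightarrow> 'us) \<Rightarrow> ('v \<Rightarrow> real \<Rightarrow> 'h::real_inner) \<Rightarrow>
      real \<Rightarrow> ('x::real_inner \<Rightarrow>\<^sub>L 'h) \<Rightarrow> (real \<Rightarrow> ('x \<Rightarrow>\<^sub>L ('u \<Rightarrow>\<^sub>L real))) \<Rightarrow> ('uu \<Rightarrow>\<^sub>L 'us) \<Rightarrow>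
      'uu \<Rightarrow> 'x \<Rightarrow> bool" where
  "approx_adjoint T evUs evU emb dt tr C A Bt B v p \<longleftrightarrow>
    (\<exists>z q. adjoint_equation T evUs evU emb dt tr B (L2_riesz T evUs evU v) z \<and>
      norm (emb z) + norm (tr z 0) \<le> C * norm (L2_riesz T evUs evU v) \<and>
      has_weak_integral T
        (\<lambda>t. inv blinfun_inner_right (bidual (evU (emb z) t) o\<^sub>L Bt t)) q \<and>
      p = - q + inv blinfun_inner_right (blinfun_inner_right (tr z 0) o\<^sub>L A))"

subsection \<open>Weak convergence in a Hilbert space\<close>

definition weakly_converges :: "(nat \<Rightarrow> 'x::real_inner) \<Rightarrow> 'x \<Rightarrow> bool" where
  "weakly_converges s x \<longleftrightarrow> (\<forall>\<xi>. (\<lambda>n. s n \<bullet> \<xi>) \<longlonglongrightarrow> x \<bullet> \<xi>)"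

end

theory Submission
  imports Defs "HOL-Library.Diagonal_Subsequence"
begin

text \<open>
  The upper-level iteration is a Landweber iteration for \<open>G \<theta> = y\<close> in which the residual and the
  adjoint of the derivative are perturbed, both by an amount proportional to the state error
  \<open>\<epsilon> j\<close>. For the residual this is the boundedness of \<open>L\<close>. For the adjoint, let \<open>z\<close> be the
  adjoint state computed with the approximate state, and let \<open>w = S' k\<close> be the linearized state in
  direction \<open>k\<close>. Testing the adjoint equation with \<open>w\<close>, and the linearized state equation with
  \<open>z\<close>, expresses the exact quantity \<open>v \<bullet> emb w\<close> and the computed quantity \<open>p \<bullet> k\<close> through the same
  \<open>z\<close>. What remains of their difference are the differences of \<open>f\<theta>\<close> and of \<open>fu\<close> at the exact
  and at the approximate state, which the Lipschitz condition bounds by a multiple of \<open>\<epsilon> j\<close>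
  (\<open>approx_adjoint_error\<close>). The same duality with the exact adjoint state bounds \<open>emb w\<close> by \<open>k\<close>.

  The testing argument is an integration by parts for two elements of the solution space, whose
  values lie in \<open>U\<close> and whose derivatives lie in the dual of \<open>U\<close> (\<open>integration_by_parts\<close>). It is
  obtained by pairing the difference quotients of the \<open>H\<close>-valued trace of one element with the other
  element. These quotients are functionals on \<open>L\<^sup>2(0,T;U)\<close> that are bounded uniformly in the
  increment, and on step functions they converge by the fundamental theorem of calculus; as step
  functions are total, they converge to the pairing with the weak derivative
  (\<open>diff_quotient_tendsto\<close>). The sum of a forward quotient of one element and a backward quotient of
  the other telescopes to boundary terms.

  Given these bounds, the monotonicity condition on \<open>G\<close> and Young's inequality show that one step
  decreases the squared error by a positive multiple of the squared residual, up to
  \<open>Cpri * (\<epsilon> j)\<^sup>2\<close> (\<open>inexact_landweber_step\<close>). The bound on the sum of the \<open>(\<epsilon> j)\<^sup>2\<close>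
  therefore keeps the iterates in the ball and makes the residuals square summable
  (\<open>perturbed_descent\<close>). A weak limit point \<open>\<theta>bar\<close> exists because bounded sequences in a Hilbert space
  have weakly convergent subsequences. The monotonicity condition based at \<open>\<theta>bar\<close> bounds the squared
  norm of \<open>G \<theta>bar - G \<theta>\<close>, for \<open>\<theta>\<close> running through the subsequence, by an inner product of a
  strongly convergent sequence with one that converges weakly to zero, hence \<open>G \<theta>bar = y\<close>.
\<close>

section \<open>Riesz representation and weak compactness\<close>

lemma parallelogram_midpoint:
  fixes a b x :: "'a::real_inner"
  shows "(norm (a - b))\<^sup>2 = 2 * (norm (x - a))\<^sup>2 + 2 * (norm (x - b))\<^sup>2 - 4 * (norm (x - (1/2) *\<^sub>R (a + b)))\<^sup>2"
  unfolding power2_norm_eq_inner by (simp add: inner_simps inner_commute algebra_simps)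

text \<open>
  The parallelogram identity makes every minimizing sequence for the distance to \<open>M\<close> a Cauchy
  sequence, so completeness provides a nearest point, and perturbing it in direction \<open>y\<close> shows that
  the error is orthogonal to \<open>y\<close>.
\<close>

lemma closed_subspace_projection:
  fixes M :: "'a::{real_inner,banach} set"
  assumes M: "subspace M" "closed M"
  shows "\<exists>m\<in>M. \<forall>y\<in>M. (x - m) \<bullet> y = 0"
proof -
  define D where "D = (\<lambda>y. (norm (x - y))\<^sup>2) ` M"
  have ne: "D \<noteq> {}" using subspace_0[OF M(1)] by (auto simp: D_def)
  have bdd: "bdd_below D" by (rule bdd_belowI[where m=0]) (auto simp: D_def)
  define d where "d = Inf D"
  have low: "d \<le> (norm (x - y))\<^sup>2" if "y \<in> M" for y
    unfolding d_def using that by (intro cInf_lower[OF _ bdd]) (auto simp: D_def)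
  have "\<exists>y\<in>M. (norm (x - y))\<^sup>2 < d + inverse (real (Suc n))" for n
  proof -
    have "d < d + inverse (real (Suc n))" by simp
    then show ?thesis unfolding d_def cInf_less_iff[OF ne bdd] by (auto simp: D_def)
  qed
  then obtain m where m: "\<And>n. m n \<in> M" "\<And>n. (norm (x - m n))\<^sup>2 < d + inverse (real (Suc n))"
    by metis
  have gap: "(norm (m i - m j))\<^sup>2 \<le> 2 * inverse (real (Suc i)) + 2 * inverse (real (Suc j))" for i j
  proof -
    have "(1/2) *\<^sub>R (m i + m j) \<in> M"
      by (intro subspace_scale subspace_add M m)
    from low[OF this] m(2)[of i] m(2)[of j] show ?thesis
      unfolding parallelogram_midpoint[of "m i" "m j" x] by linarith
  qed
  have "Cauchy m"
  proof (rule metric_CauchyI)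
    fix e :: real assume "0 < e"
    then obtain N where N: "inverse (real (Suc N)) < e\<^sup>2 / 4"
      using reals_Archimedean[of "e\<^sup>2 / 4"] by auto
    have "dist (m i) (m j) < e" if "i \<ge> N" "j \<ge> N" for i j
    proof -
      have "inverse (real (Suc i)) \<le> inverse (real (Suc N))" "inverse (real (Suc j)) \<le> inverse (real (Suc N))"
        using that by (auto intro!: le_imp_inverse_le)
      with gap[of i j] N have "(norm (m i - m j))\<^sup>2 < e\<^sup>2" by linarith
      then show ?thesis using \<open>0 < e\<close> by (simp add: dist_norm power2_less_imp_less)
    qed
    then show "\<exists>N. \<forall>i\<ge>N. \<forall>j\<ge>N. dist (m i) (m j) < e" by blast
  qed
  then obtain l where l: "m \<longlonglongrightarrow> l" using Cauchy_convergent convergent_def by blast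
  have "l \<in> M" using M(2) l m(1) closed_sequentially by blast
  have "(\<lambda>n. (norm (x - m n))\<^sup>2) \<longlonglongrightarrow> (norm (x - l))\<^sup>2" by (intro tendsto_intros l)
  moreover have "(\<lambda>n. d + inverse (real (Suc n))) \<longlonglongrightarrow> d + 0"
    by (intro tendsto_add tendsto_const LIMSEQ_inverse_real_of_nat)
  ultimately have "(norm (x - l))\<^sup>2 \<le> d + 0"
    by (rule LIMSEQ_le) (use m(2) in \<open>auto intro: less_imp_le\<close>)
  then have best: "(norm (x - l))\<^sup>2 \<le> d" by simp
  have "(x - l) \<bullet> y = 0" if "y \<in> M" for y
  proof (rule ccontr)
    assume nz: "(x - l) \<bullet> y \<noteq> 0"
    then have y: "y \<bullet> y > 0" by auto
    \<comment> \<open>the minimizer over \<open>s\<close> of the distance from \<open>x\<close> to \<open>l + s y\<close>\<close>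
    define s where "s = ((x - l) \<bullet> y) / (y \<bullet> y)"
    have "l + s *\<^sub>R y \<in> M" by (intro subspace_add subspace_scale M \<open>l \<in> M\<close> that)
    from low[OF this] best have "(norm (x - l))\<^sup>2 \<le> (norm (x - (l + s *\<^sub>R y)))\<^sup>2" by linarith
    also have "\<dots> = (norm (x - l))\<^sup>2 - 2 * s * ((x - l) \<bullet> y) + s * s * (y \<bullet> y)"
      unfolding power2_norm_eq_inner by (simp add: inner_simps inner_commute algebra_simps)
    also have "\<dots> = (norm (x - l))\<^sup>2 - ((x - l) \<bullet> y)\<^sup>2 / (y \<bullet> y)"
      using y by (simp add: s_def field_simps power2_eq_square)
    finally show False using nz y by (simp add: divide_le_0_iff)
  qed
  with \<open>l \<in> M\<close> show ?thesis by blast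
qed

text \<open>
  The form in which density is used: the elements on which a limit relation holds form a closed
  subspace, so the relation holds everywhere once it holds on a total set.
\<close>

lemma closed_subspace_eq_UNIV:
  fixes M :: "'a::{real_inner,banach} set"
  assumes "subspace M" "closed M" and perp: "\<And>v. (\<And>y. y \<in> M \<Longrightarrow> v \<bullet> y = 0) \<Longrightarrow> v = 0"
  shows "M = UNIV"
  using closed_subspace_projection[OF assms(1,2)] perp by (metis UNIV_eq_I eq_iff_diff_eq_0)

text \<open>
  The representing vector is a multiple of the component, orthogonal to the kernel of \<open>\<phi>\<close>, of a
  vector outside this kernel.
\<close>

lemma riesz_representation:
  fixes \<phi> :: "'a::{real_inner,banach} \<Rightarrow> real"
  assumes "bounded_linear \<phi>"
  shows "\<exists>v. \<forall>x. \<phi> x = v \<bullet> x"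
proof (cases "\<forall>x. \<phi> x = 0")
  case True
  then show ?thesis by (intro exI[of _ 0]) simp
next
  case False
  then obtain a where a: "\<phi> a \<noteq> 0" by blast
  interpret bounded_linear \<phi> by fact
  have "subspace {x. \<phi> x = 0}" by (auto simp: subspace_def zero add scaleR)
  moreover have "closed {x. \<phi> x = 0}"
    by (intro closed_Collect_eq continuous_on_const linear_continuous_on bounded_linear_axioms)
  ultimately obtain m where m: "\<phi> m = 0" "\<And>y. \<phi> y = 0 \<Longrightarrow> (a - m) \<bullet> y = 0"
    using closed_subspace_projection[of "{x. \<phi> x = 0}" a] by auto
  define n where "n = a - m"
  have n: "\<phi> n = \<phi> a" by (simp add: n_def diff m)
  then have "n \<noteq> 0" using a zero by auto
  then have nn: "n \<bullet> n \<noteq> 0" by simp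
  have "\<phi> x = ((\<phi> n / (n \<bullet> n)) *\<^sub>R n) \<bullet> x" for x
  proof -
    have "\<phi> (x - (\<phi> x / \<phi> n) *\<^sub>R n) = 0" using a n by (simp add: diff scaleR)
    from m(2)[OF this] have "n \<bullet> x = (\<phi> x / \<phi> n) * (n \<bullet> n)"
      by (simp add: n_def[symmetric] inner_simps)
    then show ?thesis using nn a n by (simp add: field_simps)
  qed
  then show ?thesis by blast
qed

lemma riesz_isomorphism_inverse:
  fixes \<psi> :: "'a::{real_inner,banach} \<Rightarrow>\<^sub>L real"
  shows "inv blinfun_inner_right \<psi> \<bullet> x = \<psi> x"
    and "blinfun_inner_right (inv blinfun_inner_right \<psi>) = \<psi>"
proof -
  obtain v where "\<And>x. \<psi> x = v \<bullet> x"
    using riesz_representation[OF blinfun.bounded_linear_right[of \<psi>]] by blast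
  then have "blinfun_inner_right v = \<psi>" by (intro blinfun_eqI) simp
  then show *: "blinfun_inner_right (inv blinfun_inner_right \<psi>) = \<psi>" by (metis f_inv_into_f rangeI)
  show "inv blinfun_inner_right \<psi> \<bullet> x = \<psi> x" by (metis * blinfun_inner_right.rep_eq)
qed

lemma norm_blinfun_inner_right: "norm (blinfun_inner_right (v::'a::real_inner)) = norm v"
proof (rule antisym)
  show "norm (blinfun_inner_right v) \<le> norm v"
    by (rule norm_blinfun_bound) (auto simp: Cauchy_Schwarz_ineq2)
  have "norm v * norm v = norm (blinfun_inner_right v v)"
    by (simp add: power2_norm_eq_inner[symmetric] power2_eq_square)
  also have "\<dots> \<le> norm (blinfun_inner_right v) * norm v" by (rule norm_blinfun)
  finally show "norm v \<le> norm (blinfun_inner_right v)"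
    by (cases "v = 0") auto
qed

lemma inner_adjoint:
  fixes T :: "'a::{real_inner,banach} \<Rightarrow> 'b::real_inner"
  assumes "bounded_linear T"
  shows "T x \<bullet> y = x \<bullet> adjoint T y"
proof -
  have "\<exists>g. \<forall>y x. T x \<bullet> y = x \<bullet> g y"
  proof (intro choice allI)
    fix y
    have "bounded_linear (\<lambda>x. T x \<bullet> y)"
      using bounded_linear_compose[OF bounded_linear_inner_left assms] .
    from riesz_representation[OF this] show "\<exists>g. \<forall>x. T x \<bullet> y = x \<bullet> g"
      by (metis inner_commute)
  qed
  then have "\<exists>g. \<forall>x y. T x \<bullet> y = x \<bullet> g y" by blast
  then have "\<forall>x y. T x \<bullet> y = x \<bullet> adjoint T y" unfolding adjoint_def by (rule someI_ex)
  then show ?thesis by blast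
qed

lemma norm_adjoint_le:
  fixes T :: "'a::{real_inner,banach} \<Rightarrow>\<^sub>L 'b::real_inner"
  shows "norm (adjoint T y) \<le> norm T * norm y"
proof -
  have "(norm (adjoint T y))\<^sup>2 = T (adjoint T y) \<bullet> y"
    by (simp add: inner_adjoint[OF blinfun.bounded_linear_right] power2_norm_eq_inner)
  also have "\<dots> \<le> norm (T (adjoint T y)) * norm y" by (rule norm_cauchy_schwarz)
  also have "\<dots> \<le> norm T * norm (adjoint T y) * norm y"
    by (intro mult_right_mono norm_blinfun) auto
  finally have *: "norm (adjoint T y) * norm (adjoint T y) \<le> (norm T * norm y) * norm (adjoint T y)"
    by (simp add: power2_eq_square mult_ac)
  show ?thesis
  proof (cases "norm (adjoint T y) = 0")
    case True then show ?thesis by simp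
  next
    case False
    then show ?thesis using * by (metis mult_right_le_imp_le norm_ge_zero order_le_less)
  qed
qed

text \<open>
  A diagonal argument makes the inner products with all members of the sequence converge along one
  subsequence. The vectors for which the inner products converge then form a closed subspace that
  contains the sequence, and also everything orthogonal to it; so it is the whole space, and the
  limit functional is represented by a vector.
\<close>

lemma bounded_sequence_weakly_compact:
  fixes e :: "nat \<Rightarrow> 'a::{real_inner,banach}"
  assumes bd: "\<And>n. norm (e n) \<le> B"
  shows "\<exists>s l. strict_mono s \<and> weakly_converges (e \<circ> s) l"
proof -
  have B: "B \<ge> 0" using bd[of 0] norm_ge_zero order_trans by blast
  define P where "P = (\<lambda>k (s::nat \<Rightarrow> nat). convergent (\<lambda>n. e (s n) \<bullet> e k))"
  interpret subseqs P
  proof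
    fix k and s :: "nat \<Rightarrow> nat" assume s: "strict_mono s"
    have "bounded (range (\<lambda>n. e (s n) \<bullet> e k))"
    proof (rule boundedI)
      fix x assume "x \<in> range (\<lambda>n. e (s n) \<bullet> e k)"
      then obtain n where "x = e (s n) \<bullet> e k" by blast
      then have "norm x \<le> norm (e (s n)) * norm (e k)" by (simp add: Cauchy_Schwarz_ineq2)
      also have "\<dots> \<le> B * norm (e k)" by (intro mult_right_mono bd) auto
      finally show "norm x \<le> B * norm (e k)" .
    qed
    then obtain l r where "strict_mono r" "((\<lambda>n. e (s n) \<bullet> e k) \<circ> r) \<longlonglongrightarrow> l"
      using bounded_imp_convergent_subsequence by blast
    then show "\<exists>r. strict_mono r \<and> P k (s \<circ> r)"
      unfolding P_def convergent_def by (auto simp: o_def)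
  qed
  define s where "s = diagseq"
  have s: "strict_mono s" unfolding s_def by (rule subseq_diagseq)
  have base: "convergent (\<lambda>n. e (s n) \<bullet> e k)" for k
  proof -
    have "P k (diagseq \<circ> ((+) (Suc k)))"
    proof (rule diagseq_holds)
      fix r s :: "nat \<Rightarrow> nat" and n assume "strict_mono r" "P n s"
      then show "P n (s \<circ> r)"
        unfolding P_def using convergent_subseq_convergent[of "\<lambda>i. e (s i) \<bullet> e n" r]
        by (simp add: o_def)
    qed
    then have "convergent (\<lambda>n. (\<lambda>i. e (s i) \<bullet> e k) (n + Suc k))"
      by (simp add: P_def s_def o_def add_ac)
    then show ?thesis by (subst (asm) convergent_ignore_initial_segment)
  qed
  define W where "W = {\<xi>. convergent (\<lambda>n. e (s n) \<bullet> \<xi>)}"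
  have "W = UNIV"
  proof (rule closed_subspace_eq_UNIV)
    show "subspace W"
      unfolding subspace_def W_def
      by (auto simp: inner_simps intro!: convergent_add convergent_mult convergent_const)
    show "closed W"
    proof (unfold closed_sequential_limits, intro allI impI, elim conjE)
      fix x \<xi> assume x: "\<forall>n. x n \<in> W" and lim: "x \<longlonglongrightarrow> \<xi>"
      have "Cauchy (\<lambda>n. e (s n) \<bullet> \<xi>)"
      proof (rule metric_CauchyI)
        fix \<epsilon> :: real assume "0 < \<epsilon>"
        then have pos: "0 < \<epsilon> / (3 * (B + 1))" using B by simp
        obtain k where k: "norm (x k - \<xi>) < \<epsilon> / (3 * (B + 1))"
          using LIMSEQ_D[OF lim pos] by blast
        have small: "\<bar>e (s n) \<bullet> \<xi> - e (s n) \<bullet> x k\<bar> < \<epsilon> / 3" for n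
        proof -
          have "\<bar>e (s n) \<bullet> \<xi> - e (s n) \<bullet> x k\<bar> \<le> norm (e (s n)) * norm (\<xi> - x k)"
            by (metis Cauchy_Schwarz_ineq2 inner_diff_right)
          also have "\<dots> \<le> (B + 1) * norm (x k - \<xi>)"
            using bd[of "s n"] by (simp add: norm_minus_commute mult_right_mono)
          also have "\<dots> < (B + 1) * (\<epsilon> / (3 * (B + 1)))"
            by (intro mult_strict_left_mono k) (use B in auto)
          also have "\<dots> = \<epsilon> / 3" using B by (simp add: divide_simps)
          finally show ?thesis .
        qed
        have "convergent (\<lambda>n. e (s n) \<bullet> x k)" using x by (simp add: W_def)
        then have "Cauchy (\<lambda>n. e (s n) \<bullet> x k)" by (rule convergent_Cauchy)
        then obtain M where M: "\<forall>m\<ge>M. \<forall>n\<ge>M. dist (e (s m) \<bullet> x k) (e (s n) \<bullet> x k) < \<epsilon> / 3"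
          using metric_CauchyD[of _ "\<epsilon> / 3"] \<open>0 < \<epsilon>\<close> by (metis divide_pos_pos zero_less_numeral)
        have "dist (e (s m) \<bullet> \<xi>) (e (s n) \<bullet> \<xi>) < \<epsilon>" if "m \<ge> M" "n \<ge> M" for m n
          using M[rule_format, OF that] small[of m] small[of n] unfolding dist_real_def by linarith
        then show "\<exists>M. \<forall>m\<ge>M. \<forall>n\<ge>M. dist (e (s m) \<bullet> \<xi>) (e (s n) \<bullet> \<xi>) < \<epsilon>" by blast
      qed
      then show "\<xi> \<in> W" by (simp add: W_def Cauchy_convergent)
    qed
  next
    fix v assume v: "\<And>y. y \<in> W \<Longrightarrow> v \<bullet> y = 0"
    have "e k \<in> W" for k using base by (simp add: W_def)
    then have "e k \<bullet> v = 0" for k using v by (metis inner_commute)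
    then have "v \<in> W" by (simp add: W_def convergent_const)
    then show "v = 0" using v by (metis inner_eq_zero_iff)
  qed
  then have conv: "(\<lambda>n. e (s n) \<bullet> \<xi>) \<longlonglongrightarrow> lim (\<lambda>n. e (s n) \<bullet> \<xi>)" for \<xi>
    using \<open>W = UNIV\<close> by (auto simp: W_def convergent_LIMSEQ_iff)
  define \<phi> where "\<phi> = (\<lambda>\<xi>. lim (\<lambda>n. e (s n) \<bullet> \<xi>))"
  have "bounded_linear \<phi>"
  proof (rule bounded_linear_intro[where K = B])
    show "\<phi> (x + y) = \<phi> x + \<phi> y" for x y
      using LIMSEQ_unique[OF conv[of "x + y"]] tendsto_add[OF conv[of x] conv[of y]]
      by (simp add: \<phi>_def inner_add_right)
    show "\<phi> (c *\<^sub>R x) = c *\<^sub>R \<phi> x" for c x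
      using LIMSEQ_unique[OF conv[of "c *\<^sub>R x"]] tendsto_mult[OF tendsto_const conv[of x], of c]
      by (simp add: \<phi>_def)
    show "norm (\<phi> x) \<le> norm x * B" for x
    proof (rule LIMSEQ_le_const2)
      show "(\<lambda>n. norm (e (s n) \<bullet> x)) \<longlonglongrightarrow> norm (\<phi> x)"
        unfolding \<phi>_def by (intro tendsto_norm conv)
      have "norm (e (s n) \<bullet> x) \<le> norm x * B" for n
        using Cauchy_Schwarz_ineq2[of "e (s n)" x] mult_right_mono[OF bd[of "s n"], of "norm x"]
        by (simp add: mult.commute)
      then show "\<exists>N. \<forall>n\<ge>N. norm (e (s n) \<bullet> x) \<le> norm x * B" by blast
    qed
  qed
  then obtain l where "\<And>x. \<phi> x = l \<bullet> x" using riesz_representation by blast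
  then have "weakly_converges (e \<circ> s) l"
    using conv by (simp add: weakly_converges_def \<phi>_def)
  with s show ?thesis by blast
qed

lemma tendsto_inner_strong_weak:
  fixes a :: "nat \<Rightarrow> 'b::{real_inner}" and T :: "'a::{real_inner,banach} \<Rightarrow> 'b"
  assumes T: "bounded_linear T" and a: "a \<longlonglongrightarrow> l" and b: "weakly_converges b 0"
    and bd: "\<And>n. norm (b n) \<le> B"
  shows "(\<lambda>n. a n \<bullet> T (b n)) \<longlonglongrightarrow> 0"
proof -
  obtain K where K: "\<And>x. norm (T x) \<le> norm x * K" "K \<ge> 0"
    using bounded_linear.nonneg_bounded[OF T] by blast
  have "(\<lambda>n. b n \<bullet> adjoint T l) \<longlonglongrightarrow> 0"
    using b by (simp add: weakly_converges_def)
  then have 1: "(\<lambda>n. l \<bullet> T (b n)) \<longlonglongrightarrow> 0"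
    by (simp add: inner_adjoint[OF T, symmetric] inner_commute)
  have 2: "(\<lambda>n. (a n - l) \<bullet> T (b n)) \<longlonglongrightarrow> 0"
  proof (rule Lim_null_comparison)
    have "norm ((a n - l) \<bullet> T (b n)) \<le> norm (a n - l) * (B * K)" for n
    proof -
      have "norm ((a n - l) \<bullet> T (b n)) \<le> norm (a n - l) * norm (T (b n))"
        by (simp add: Cauchy_Schwarz_ineq2)
      also have "norm (T (b n)) \<le> B * K"
        using K(1)[of "b n"] mult_right_mono[OF bd[of n] K(2)] by linarith
      finally show ?thesis by (simp add: mult_left_mono)
    qed
    then show "\<forall>\<^sub>F n in sequentially. norm ((a n - l) \<bullet> T (b n)) \<le> norm (a n - l) * (B * K)"
      by simp
    show "(\<lambda>n. norm (a n - l) * (B * K)) \<longlonglongrightarrow> 0"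
      by (intro tendsto_mult_left_zero tendsto_norm_zero) (use a in \<open>simp add: LIM_zero_iff\<close>)
  qed
  from tendsto_add[OF 1 2] show ?thesis by (simp add: inner_diff_left)
qed

section \<open>The duality of the Lebesgue--Bochner spaces\<close>

text \<open>
  Completeness is what turns almost everywhere limits of simple functions, hence strongly measurable
  real functions, into measurable ones.
\<close>

lemma complete_measure_lebesgue_on:
  assumes "S \<in> sets lebesgue"
  shows "complete_measure (lebesgue_on S)"
proof
  fix A B assume "A \<subseteq> B" "B \<in> null_sets (lebesgue_on S)"
  then show "A \<in> sets (lebesgue_on S)"
    using assms null_sets_restrict_space[of S lebesgue]
    by (metis completion.complete2 null_setsD2 subset_iff)
qed

lemma (in complete_measure) borel_measurable_cong_AE_complete:
  assumes f: "f \<in> borel_measurable M" and ae: "AE t in M. f t = g t"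
  shows "g \<in> borel_measurable M"
proof (rule borel_measurableI)
  fix S :: "'b set" assume "open S"
  show "g -` S \<inter> space M \<in> sets M"
  proof (rule in_sets_AE)
    show "f -` S \<inter> space M \<in> sets M" using f \<open>open S\<close> by (simp add: measurable_sets)
    show "AE x in M. (x \<in> f -` S \<inter> space M) = (x \<in> g -` S \<inter> space M)"
      using ae by eventually_elim auto
  qed auto
qed

text \<open>
  Strong measurability passes to continuous functions of two variables by applying them to the
  approximating simple functions; inner products and dual pairings are such functions.
\<close>

lemma strongly_measurable_compose2:
  assumes a: "strongly_measurable M a" and b: "strongly_measurable M b"
    and \<Phi>: "continuous_on UNIV (\<lambda>(x, y). \<Phi> x y)"
  shows "strongly_measurable M (\<lambda>t. \<Phi> (a t) (b t))"
proof -
  from a obtain s where s: "\<And>n. simple_function M (s n)" "AE t in M. (\<lambda>n. s n t) \<longlonglongrightarrow> a t"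
    unfolding strongly_measurable_def by blast
  from b obtain r where r: "\<And>n. simple_function M (r n)" "AE t in M. (\<lambda>n. r n t) \<longlonglongrightarrow> b t"
    unfolding strongly_measurable_def by blast
  have "AE t in M. (\<lambda>n. \<Phi> (s n t) (r n t)) \<longlonglongrightarrow> \<Phi> (a t) (b t)"
    using s(2) r(2)
  proof eventually_elim
    case (elim t)
    have "(\<lambda>n. (\<lambda>(x, y). \<Phi> x y) (s n t, r n t)) \<longlonglongrightarrow> (\<lambda>(x, y). \<Phi> x y) (a t, b t)"
      by (rule continuous_on_tendsto_compose[OF \<Phi> tendsto_Pair[OF elim]]) simp_all
    then show ?case by simp
  qed
  moreover have "simple_function M (\<lambda>t. \<Phi> (s n t) (r n t))" for n
    by (rule simple_function_compose2[OF s(1) r(1), where h = \<Phi>])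
  ultimately show ?thesis
    unfolding strongly_measurable_def
    by (intro exI[of _ "\<lambda>n t. \<Phi> (s n t) (r n t)"] conjI allI)
qed

lemma strongly_measurable_compose:
  assumes a: "strongly_measurable M a" and \<Phi>: "continuous_on UNIV \<Phi>"
  shows "strongly_measurable M (\<lambda>t. \<Phi> (a t))"
proof (rule strongly_measurable_compose2[OF a a, where \<Phi> = "\<lambda>x _. \<Phi> x"])
  show "continuous_on UNIV (\<lambda>(x, y). \<Phi> x)"
    unfolding case_prod_beta
    by (rule continuous_on_compose2[OF \<Phi> continuous_on_fst[OF continuous_on_id]]) simp
qed

lemma (in complete_measure) borel_measurable_strongly_measurable:
  fixes g :: "'a \<Rightarrow> real"
  assumes "strongly_measurable M g"
  shows "g \<in> borel_measurable M"
proof -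
  from assms obtain s where s: "\<And>n. simple_function M (s n)" "AE t in M. (\<lambda>n. s n t) \<longlonglongrightarrow> g t"
    unfolding strongly_measurable_def by blast
  have "(\<lambda>t. lim (\<lambda>n. s n t)) \<in> borel_measurable M"
    by (rule borel_measurable_lim_metric) (rule borel_measurable_simple_function[OF s(1)])
  moreover have "AE t in M. lim (\<lambda>n. s n t) = g t" using s(2) by eventually_elim (rule limI)
  ultimately show ?thesis by (rule borel_measurable_cong_AE_complete)
qed

lemma complete_measure_time: "complete_measure (time_measure T)"
  by (rule complete_measure_lebesgue_on) simp

lemma finite_measure_time: "finite_measure (time_measure T)"
  by (rule finite_measure_lebesgue_on) simp

lemma borel_measurable_time_measure:
  fixes g :: "real \<Rightarrow> real"
  shows "strongly_measurable (time_measure T) g \<Longrightarrow> g \<in> borel_measurable (time_measure T)"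
  by (rule complete_measure.borel_measurable_strongly_measurable[OF complete_measure_time])

lemma square_integrable_isometry:
  assumes g: "square_integrable T g" and \<Phi>: "continuous_on UNIV \<Phi>" "\<And>x. norm (\<Phi> x) = norm x"
  shows "square_integrable T (\<lambda>t. \<Phi> (g t))"
  using g strongly_measurable_compose[OF _ \<Phi>(1)] by (auto simp: square_integrable_def \<Phi>(2))

text \<open>
  Young's inequality alone gives integrability, with the mean of the squared norms as a bound;
  \<open>abs_le_norm_product\<close> upgrades such a bound to the Cauchy--Schwarz inequality.
\<close>

lemma square_integrable_product:
  fixes \<Phi> :: "'b::real_normed_vector \<Rightarrow> 'c::real_normed_vector \<Rightarrow> real"
  assumes a: "square_integrable T a" and b: "square_integrable T b"
    and \<Phi>: "bounded_bilinear \<Phi>" and le: "\<And>x y. \<bar>\<Phi> x y\<bar> \<le> norm x * norm y"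
  shows "integrable (time_measure T) (\<lambda>t. \<Phi> (a t) (b t))" (is "integrable ?M ?f")
    and "\<bar>\<integral>t. \<Phi> (a t) (b t) \<partial>time_measure T\<bar> \<le>
      ((\<integral>t. (norm (a t))\<^sup>2 \<partial>time_measure T) + (\<integral>t. (norm (b t))\<^sup>2 \<partial>time_measure T)) / 2"
proof -
  have [measurable]: "?f \<in> borel_measurable ?M"
  proof (rule borel_measurable_time_measure, rule strongly_measurable_compose2[where \<Phi> = \<Phi>])
    show "continuous_on UNIV (\<lambda>(x, y). \<Phi> x y)"
      unfolding case_prod_beta
      by (rule bounded_bilinear.continuous_on[OF \<Phi> continuous_on_fst[OF continuous_on_id]
            continuous_on_snd[OF continuous_on_id]])
  qed (use a b in \<open>auto simp: square_integrable_def\<close>)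
  have pt: "\<bar>?f t\<bar> \<le> ((norm (a t))\<^sup>2 + (norm (b t))\<^sup>2) / 2" for t
    using le[of "a t" "b t"] sum_squares_bound[of "norm (a t)" "norm (b t)"] by (simp add: mult.assoc)
  have ab: "integrable ?M (\<lambda>t. (norm (a t))\<^sup>2)" "integrable ?M (\<lambda>t. (norm (b t))\<^sup>2)"
    using a b by (auto simp: square_integrable_def)
  then have i: "integrable ?M (\<lambda>t. ((norm (a t))\<^sup>2 + (norm (b t))\<^sup>2) / 2)" by simp
  show f: "integrable ?M ?f"
    by (rule Bochner_Integration.integrable_bound[OF i]) (use pt in \<open>auto intro!: AE_I2 order_trans[OF pt]\<close>)
  have "\<bar>\<integral>t. ?f t \<partial>?M\<bar> \<le> (\<integral>t. \<bar>?f t\<bar> \<partial>?M)" by (rule integral_abs_bound)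
  also have "\<dots> \<le> (\<integral>t. ((norm (a t))\<^sup>2 + (norm (b t))\<^sup>2) / 2 \<partial>?M)"
    using f i pt by (intro integral_mono) auto
  also have "\<dots> = ((\<integral>t. (norm (a t))\<^sup>2 \<partial>?M) + (\<integral>t. (norm (b t))\<^sup>2 \<partial>?M)) / 2"
    using ab by simp
  finally show "\<bar>\<integral>t. ?f t \<partial>?M\<bar> \<le> ((\<integral>t. (norm (a t))\<^sup>2 \<partial>?M) + (\<integral>t. (norm (b t))\<^sup>2 \<partial>?M)) / 2" .
qed

text \<open>
  A form that is homogeneous in both arguments and bounded by the mean of the squared norms satisfies
  the Cauchy--Schwarz inequality: normalize both arguments.
\<close>

lemma abs_le_norm_product:
  fixes p :: "'b::real_normed_vector \<Rightarrow> 'c::real_normed_vector \<Rightarrow> real"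
  assumes sc: "\<And>c d g w. p (c *\<^sub>R g) (d *\<^sub>R w) = c * d * p g w"
    and le: "\<And>g w. \<bar>p g w\<bar> \<le> ((norm g)\<^sup>2 + (norm w)\<^sup>2) / 2"
  shows "\<bar>p g w\<bar> \<le> norm g * norm w"
proof (cases "g = 0 \<or> w = 0")
  case True
  then show ?thesis using sc[of 0 g 1 w] sc[of 1 g 0 w] by auto
next
  case False
  then have n: "norm g > 0" "norm w > 0" by auto
  have "\<bar>(1 / norm g) * (1 / norm w) * p g w\<bar>
      \<le> ((norm ((1 / norm g) *\<^sub>R g))\<^sup>2 + (norm ((1 / norm w) *\<^sub>R w))\<^sup>2) / 2"
    unfolding sc[symmetric] by (rule le)
  also have "\<dots> = 1" using n by simp
  finally have "\<bar>p g w\<bar> / (norm g * norm w) \<le> 1" using n by (simp add: abs_mult)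
  moreover have "norm g * norm w > 0" using n by simp
  ultimately show ?thesis by (metis mult_1 pos_divide_le_eq)
qed

lemma L2_space_AE_unique:
  assumes E: "L2_space T ev" and ae: "AE t in time_measure T. ev v t = ev w t"
  shows "v = w"
proof -
  have add: "AE t in time_measure T. ev (v + (-1) *\<^sub>R w) t = ev v t + ev ((-1) *\<^sub>R w) t"
    and sc: "AE t in time_measure T. ev ((-1) *\<^sub>R w) t = (-1) *\<^sub>R ev w t"
    using E unfolding L2_space_def by blast+
  have "AE t in time_measure T. (norm (ev (v + (-1) *\<^sub>R w) t))\<^sup>2 = 0"
    using add sc ae by eventually_elim simp
  then have "(\<integral>t. (norm (ev (v + (-1) *\<^sub>R w) t))\<^sup>2 \<partial>time_measure T) = 0"
    by (rule integral_eq_zero_AE)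
  then have "(norm (v + (-1) *\<^sub>R w))\<^sup>2 = 0" using E unfolding L2_space_def by metis
  then show ?thesis by simp
qed

lemma bounded_bilinear_dual_pairing:
  "bounded_bilinear (\<lambda>(\<psi>::'u::real_normed_vector \<Rightarrow>\<^sub>L real) x. \<psi> x)"
  by (rule bounded_bilinear_blinfun_apply)

lemma abs_dual_pairing_le: "\<bar>blinfun_apply \<psi> x\<bar> \<le> norm \<psi> * norm x"
  using norm_blinfun[of \<psi> x] by simp

text \<open>
  The type \<open>'us\<close> is a Hilbert space of classes of dual-valued functions; the pairing identifies it
  isometrically with the dual of \<open>'uu\<close>.
\<close>

locale L2_duality =
  fixes T :: real
    and evU :: "'uu::{real_inner,banach} \<Rightarrow> real \<Rightarrow> 'u::{real_inner,banach}"
    and evUs :: "'us::{real_inner,banach} \<Rightarrow> real \<Rightarrow> ('u \<Rightarrow>\<^sub>L real)"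
  assumes space_U: "L2_space T evU" and space_Us: "L2_space T evUs"
begin

abbreviation "M \<equiv> time_measure T"
abbreviation "pairing \<equiv> L2_pairing T evUs evU"

lemma square_integrable_ev: "square_integrable T (evU w)" "square_integrable T (evUs g)"
  using space_U space_Us unfolding L2_space_def by blast+

lemma norm_square_ev:
  "(\<integral>t. (norm (evU w t))\<^sup>2 \<partial>M) = (norm w)\<^sup>2" "(\<integral>t. (norm (evUs g t))\<^sup>2 \<partial>M) = (norm g)\<^sup>2"
  using space_U space_Us unfolding L2_space_def by metis+

lemma ev_linear:
  "AE t in M. evU (v + w) t = evU v t + evU w t" "AE t in M. evU (c *\<^sub>R w) t = c *\<^sub>R evU w t"
  "AE t in M. evUs (g + h) t = evUs g t + evUs h t" "AE t in M. evUs (c *\<^sub>R g) t = c *\<^sub>R evUs g t"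
  using space_U space_Us unfolding L2_space_def by blast+

lemma pairing_integrable: "integrable M (\<lambda>t. evUs g t (evU w t))"
  by (rule square_integrable_product(1)[OF square_integrable_ev(2,1) bounded_bilinear_dual_pairing
        abs_dual_pairing_le])

lemma pairing_le_squares: "\<bar>pairing g w\<bar> \<le> ((norm g)\<^sup>2 + (norm w)\<^sup>2) / 2"
  using square_integrable_product(2)[OF square_integrable_ev(2,1) bounded_bilinear_dual_pairing
        abs_dual_pairing_le]
  unfolding L2_pairing_def norm_square_ev .

lemma pairing_cong_AE:
  assumes "AE t in M. evUs g t (evU w t) = k t" "integrable M k"
  shows "pairing g w = (\<integral>t. k t \<partial>M)"
  unfolding L2_pairing_def
  by (rule integral_cong_AE[OF _ _ assms(1)]) (use pairing_integrable assms in auto)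

lemma pairing_add_left: "pairing (g + h) w = pairing g w + pairing h w"
proof -
  have "AE t in M. evUs (g + h) t (evU w t) = evUs g t (evU w t) + evUs h t (evU w t)"
    using ev_linear(3)[of g h] by eventually_elim (simp add: blinfun.add_left)
  from pairing_cong_AE[OF this] show ?thesis
    by (simp add: pairing_integrable L2_pairing_def)
qed

lemma pairing_add_right: "pairing g (v + w) = pairing g v + pairing g w"
proof -
  have "AE t in M. evUs g t (evU (v + w) t) = evUs g t (evU v t) + evUs g t (evU w t)"
    using ev_linear(1)[of v w] by eventually_elim (simp add: blinfun.add_right)
  from pairing_cong_AE[OF this] show ?thesis
    by (simp add: pairing_integrable L2_pairing_def)
qed

lemma pairing_scaleR: "pairing (c *\<^sub>R g) (d *\<^sub>R w) = c * d * pairing g w"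
proof -
  have "AE t in M. evUs (c *\<^sub>R g) t (evU (d *\<^sub>R w) t) = (c * d) * evUs g t (evU w t)"
    using ev_linear(2)[of d w] ev_linear(4)[of c g]
    by eventually_elim (simp add: blinfun.scaleR_left blinfun.scaleR_right)
  from pairing_cong_AE[OF this] show ?thesis
    by (simp add: pairing_integrable L2_pairing_def)
qed

lemma abs_pairing_le: "\<bar>pairing g w\<bar> \<le> norm g * norm w"
  by (rule abs_le_norm_product[of pairing, OF pairing_scaleR pairing_le_squares])

sublocale pairing: bounded_bilinear pairing
proof
  show "pairing (r *\<^sub>R a) b = r *\<^sub>R pairing a b" for a b r
    using pairing_scaleR[of r a 1 b] by simp
  show "pairing a (r *\<^sub>R b) = r *\<^sub>R pairing a b" for a b r
    using pairing_scaleR[of 1 a r b] by simp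
  show "\<exists>K. \<forall>a b. norm (pairing a b) \<le> norm a * norm b * K"
    using abs_pairing_le by (intro exI[of _ 1]) simp
qed (rule pairing_add_left pairing_add_right)+

lemma inner_eq_integral: "v \<bullet> w = (\<integral>t. evU v t \<bullet> evU w t \<partial>M)"
proof -
  have int: "integrable M (\<lambda>t. evU v t \<bullet> evU w t)"
    by (rule square_integrable_product(1)[OF square_integrable_ev(1,1) bounded_bilinear_inner
          Cauchy_Schwarz_ineq2])
  have sq: "integrable M (\<lambda>t. (norm (evU x t))\<^sup>2)" for x
    using square_integrable_ev(1) by (simp add: square_integrable_def)
  have "(norm (v + w))\<^sup>2 = (\<integral>t. (norm (evU v t))\<^sup>2 + 2 * (evU v t \<bullet> evU w t) + (norm (evU w t))\<^sup>2 \<partial>M)"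
    unfolding norm_square_ev(1)[symmetric]
  proof (rule integral_cong_AE)
    show "AE t in M. (norm (evU (v + w) t))\<^sup>2 = (norm (evU v t))\<^sup>2 + 2 * (evU v t \<bullet> evU w t) + (norm (evU w t))\<^sup>2"
      using ev_linear(1)[of v w]
      by eventually_elim (simp add: power2_norm_eq_inner inner_simps inner_commute)
  qed (use sq int in auto)
  also have "\<dots> = (norm v)\<^sup>2 + 2 * (\<integral>t. evU v t \<bullet> evU w t \<partial>M) + (norm w)\<^sup>2"
    using sq int by (simp add: norm_square_ev)
  finally show ?thesis
    by (simp add: power2_norm_eq_inner inner_simps inner_commute)
qed

text \<open>
  The definite description in \<^const>\<open>L2_riesz\<close> denotes: the pointwise Riesz isometry preserves square
  integrability, and a class is determined by its representative up to null sets.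
\<close>

lemma L2_riesz_AE: "AE t in M. evUs (L2_riesz T evUs evU v) t = blinfun_inner_right (evU v t)"
proof -
  let ?P = "\<lambda>g. AE t in M. evUs g t = blinfun_inner_right (evU v t)"
  have "square_integrable T (\<lambda>t. blinfun_inner_right (evU v t))"
    by (rule square_integrable_isometry[OF square_integrable_ev(1)
          linear_continuous_on[OF bounded_linear_blinfun_inner_right]
          norm_blinfun_inner_right])
  then obtain g where g: "?P g" using space_Us unfolding L2_space_def by blast
  have "?P (THE g. ?P g)"
  proof (rule theI[of ?P, OF g])
    fix g' assume g': "?P g'"
    have "AE t in M. evUs g' t = evUs g t" using g g' by eventually_elim simp
    then show "g' = g" by (rule L2_space_AE_unique[OF space_Us])
  qed
  then show ?thesis by (simp add: L2_riesz_def)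
qed

lemma pairing_riesz: "pairing (L2_riesz T evUs evU v) w = v \<bullet> w"
proof -
  have "AE t in M. evUs (L2_riesz T evUs evU v) t (evU w t) = evU v t \<bullet> evU w t"
    using L2_riesz_AE[of v] by eventually_elim simp
  from pairing_cong_AE[OF this] show ?thesis
    unfolding inner_eq_integral
    using square_integrable_product(1)[OF square_integrable_ev(1,1) bounded_bilinear_inner Cauchy_Schwarz_ineq2]
    by blast
qed

lemma norm_riesz: "norm (L2_riesz T evUs evU v) = norm v"
proof -
  have "(norm (L2_riesz T evUs evU v))\<^sup>2 = (norm v)\<^sup>2"
    unfolding norm_square_ev[symmetric]
  proof (rule integral_cong_AE)
    show "AE t in M. (norm (evUs (L2_riesz T evUs evU v) t))\<^sup>2 = (norm (evU v t))\<^sup>2"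
      using L2_riesz_AE[of v] by eventually_elim (simp add: norm_blinfun_inner_right)
  qed (use square_integrable_ev in \<open>auto simp: square_integrable_def\<close>)
  then show ?thesis by simp
qed

text \<open>
  The pointwise inverse Riesz image of \<open>g - h\<close> is a square integrable test function \<open>w\<close>, against
  which \<open>g - h\<close> pairs to the square of its norm.
\<close>

lemma pairing_nondegenerate:
  assumes "\<And>w. pairing g w = pairing h w"
  shows "g = h"
proof -
  let ?I = "\<lambda>\<psi>. inv blinfun_inner_right \<psi> :: 'u"
  have nI: "norm (?I \<psi>) = norm \<psi>" for \<psi>
    by (metis norm_blinfun_inner_right riesz_isomorphism_inverse(2))
  have I_diff: "?I \<psi> - ?I \<psi>' = ?I (\<psi> - \<psi>')" for \<psi> \<psi>'
    by (rule vector_eq_ldot[THEN iffD1])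
      (simp add: inner_diff_left inner_commute[of "_::'u" "inv _ _"] inner_diff_right
        riesz_isomorphism_inverse blinfun.diff_left)
  have "continuous_on UNIV ?I"
  proof (rule continuous_on_iff[THEN iffD2], intro ballI allI impI)
    fix x and e :: real assume "0 < e"
    then show "\<exists>d>0. \<forall>x'\<in>UNIV. dist x' x < d \<longrightarrow> dist (?I x') (?I x) < e"
      by (intro exI[of _ e]) (simp add: dist_norm I_diff nI)
  qed
  then have "square_integrable T (\<lambda>t. ?I (evUs (g - h) t))"
    by (rule square_integrable_isometry[OF square_integrable_ev(2) _ nI])
  then obtain w where w: "AE t in M. evU w t = ?I (evUs (g - h) t)"
    using space_U unfolding L2_space_def by blast
  have "AE t in M. evUs (g - h) t (evU w t) = (norm (evUs (g - h) t))\<^sup>2"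
    using w by eventually_elim
      (metis nI power2_norm_eq_inner riesz_isomorphism_inverse(1))
  from pairing_cong_AE[OF this] have "pairing (g - h) w = (norm (g - h))\<^sup>2"
    using square_integrable_ev(2) by (simp add: norm_square_ev square_integrable_def)
  then show ?thesis using assms by (simp add: pairing.diff_left)
qed

text \<open>
  The definite description in \<^const>\<open>L2_adjoint\<close> denotes: existence is the Riesz representation on
  \<open>L\<^sup>2(0,T;U)\<close>, transported to the dual by the pointwise Riesz map, and uniqueness is the
  nondegeneracy of the pairing.
\<close>

lemma pairing_L2_adjoint:
  "pairing (L2_adjoint T evUs evU B z) w = pairing (blinfun_apply B w) z"
proof -
  let ?P = "\<lambda>g. \<forall>w. pairing g w = pairing (blinfun_apply B w) z"
  have "bounded_linear (\<lambda>w. pairing (blinfun_apply B w) z)"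
    by (rule bounded_linear_compose[OF pairing.bounded_linear_left blinfun.bounded_linear_right])
  then obtain v where "\<forall>w. pairing (blinfun_apply B w) z = v \<bullet> w"
    using riesz_representation by blast
  then have v: "?P (L2_riesz T evUs evU v)" by (simp add: pairing_riesz)
  have "?P (THE g. ?P g)"
    by (rule theI[of ?P, OF v]) (metis v pairing_nondegenerate)
  then show ?thesis unfolding L2_adjoint_def by blast
qed

end

section \<open>The weak derivative and the fundamental theorem of calculus\<close>

text \<open>
  Sampling at the points of a grid gives the approximating simple functions: only finitely many grid
  points lie below a point of the bounded time interval.
\<close>

lemma strongly_measurable_continuous:
  fixes g :: "real \<Rightarrow> 'e::real_normed_vector"
  assumes g: "continuous_on UNIV g"
  shows "strongly_measurable (time_measure T) g"
proof -
  define r where "r = (\<lambda>n t. real_of_int \<lfloor>real (Suc n) * t\<rfloor> / real (Suc n))"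
  have "simple_function (time_measure T) (\<lambda>t. \<lfloor>real (Suc n) * t\<rfloor>)" for n
    unfolding simple_function_def
  proof (intro conjI ballI)
    have "(\<lambda>t. \<lfloor>real (Suc n) * t\<rfloor>) ` space (time_measure T) \<subseteq> {0..\<lfloor>real (Suc n) * T\<rfloor>}"
      by (auto intro!: floor_mono mult_left_mono)
    then show "finite ((\<lambda>t. \<lfloor>real (Suc n) * t\<rfloor>) ` space (time_measure T))"
      by (rule finite_subset) simp
    have "(\<lambda>t. \<lfloor>real (Suc n) * t\<rfloor>) \<in> borel \<rightarrow>\<^sub>M count_space UNIV" by measurable
    then have "(\<lambda>t. \<lfloor>real (Suc n) * t\<rfloor>) \<in> time_measure T \<rightarrow>\<^sub>M count_space UNIV"
      by (intro measurable_restrict_space1 measurable_completion) simp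
    then show "(\<lambda>t. \<lfloor>real (Suc n) * t\<rfloor>) -` {x} \<inter> space (time_measure T) \<in> sets (time_measure T)" for x
      by (rule measurable_sets) simp
  qed
  then have simple: "simple_function (time_measure T) (\<lambda>t. g (r n t))" for n
    unfolding r_def by (rule simple_function_compose1)
  have "(\<lambda>n. g (r n t)) \<longlonglongrightarrow> g t" for t
  proof (rule continuous_on_tendsto_compose[OF g])
    have "norm (r n t - t) \<le> inverse (real (Suc n))" for n
    proof -
      have "r n t - t = (real_of_int \<lfloor>real (Suc n) * t\<rfloor> - real (Suc n) * t) / real (Suc n)"
        by (simp add: r_def field_simps del: of_nat_Suc)
      moreover have "\<bar>real_of_int \<lfloor>real (Suc n) * t\<rfloor> - real (Suc n) * t\<bar> \<le> 1" by linarith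
      ultimately show ?thesis
        by (simp add: divide_right_mono inverse_eq_divide del: of_nat_Suc)
    qed
    then have "(\<lambda>n. r n t - t) \<longlonglongrightarrow> 0"
      by (intro Lim_null_comparison[OF _ LIMSEQ_inverse_real_of_nat]) auto
    then show "(\<lambda>n. r n t) \<longlonglongrightarrow> t" by (simp add: LIM_zero_iff)
  qed auto
  with simple show ?thesis
    unfolding strongly_measurable_def by (intro exI[of _ "\<lambda>n t. g (r n t)"]) auto
qed

lemma time_integral:
  fixes k :: "real \<Rightarrow> real"
  assumes "integrable (time_measure T) k"
  shows "(k has_integral (\<integral>t. k t \<partial>time_measure T)) {0..T}"
  using has_integral_integral_lebesgue_on[OF assms] by (simp add: has_integral_Icc_iff_Ioo)

lemma integrable_time_continuous:
  fixes k :: "real \<Rightarrow> real"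
  assumes "continuous_on UNIV k"
  shows "integrable (time_measure T) k"
proof -
  have "compact (k ` {0..T})"
    by (rule compact_continuous_image[OF continuous_on_subset[OF assms]]) auto
  then obtain B where "\<forall>x\<in>k ` {0..T}. norm x \<le> B"
    using compact_imp_bounded bounded_iff by blast
  then have "AE t in time_measure T. norm (k t) \<le> B" by (intro AE_I2) auto
  moreover have "k \<in> borel_measurable (time_measure T)"
    by (rule borel_measurable_time_measure strongly_measurable_continuous assms)+
  ultimately show ?thesis
    by (rule finite_measure.integrable_const_bound[OF finite_measure_time])
qed

lemma square_integrable_continuous:
  fixes g :: "real \<Rightarrow> 'e::real_normed_vector"
  assumes "continuous_on UNIV g"
  shows "square_integrable T g"
  unfolding square_integrable_def
  by (intro conjI strongly_measurable_continuous integrable_time_continuous continuous_intros assms)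

lemma square_integrable_bounded_linear:
  assumes g: "square_integrable T g" and B: "bounded_linear B"
  shows "square_integrable T (\<lambda>t. B (g t))"
  unfolding square_integrable_def
proof
  show sm: "strongly_measurable (time_measure T) (\<lambda>t. B (g t))"
    by (rule strongly_measurable_compose[OF _ linear_continuous_on[OF B]])
      (use g in \<open>simp add: square_integrable_def\<close>)
  obtain K where K: "\<And>x. norm (B x) \<le> norm x * K" using bounded_linear.bounded[OF B] by blast
  have i: "integrable (time_measure T) (\<lambda>t. (norm (g t))\<^sup>2 * K\<^sup>2)"
    using g by (simp add: square_integrable_def)
  show "integrable (time_measure T) (\<lambda>t. (norm (B (g t)))\<^sup>2)"
  proof (rule Bochner_Integration.integrable_bound[OF i])
    show "(\<lambda>t. (norm (B (g t)))\<^sup>2) \<in> borel_measurable (time_measure T)"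
      by (rule borel_measurable_time_measure, rule strongly_measurable_compose[OF sm])
        (intro continuous_intros)
    have "(norm (B (g t)))\<^sup>2 \<le> (norm (g t))\<^sup>2 * K\<^sup>2" for t
      using power_mono[OF K[of "g t"], of 2] by (simp add: power_mult_distrib)
    then show "AE t in time_measure T. norm ((norm (B (g t)))\<^sup>2) \<le> norm ((norm (g t))\<^sup>2 * K\<^sup>2)"
      by simp
  qed
qed

lemma continuous_real_antiderivative:
  fixes k :: "real \<Rightarrow> real"
  assumes "continuous_on UNIV k"
  obtains K where "\<And>t. (K has_real_derivative k t) (at t)"
    and "\<And>a b. a \<le> b \<Longrightarrow> (k has_integral (K b - K a)) {a..b}"
proof -
  obtain K where K: "\<And>t. (K has_vector_derivative k t) (at t)"
    using einterval_antiderivative[of "-\<infinity>" \<infinity> k] assms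
    by (auto simp: continuous_on_eq_continuous_at)
  then have "(K has_real_derivative k t) (at t)" for t
    by (simp add: has_real_derivative_iff_has_vector_derivative)
  moreover have "(k has_integral (K b - K a)) {a..b}" if "a \<le> b" for a b
    by (rule fundamental_theorem_of_calculus[OF that]) (use K has_vector_derivative_at_within in blast)
  ultimately show ?thesis by (rule that)
qed

text \<open>
  Composition with the projection onto \<open>{0..T}\<close> extends a continuous function by its end values to the
  whole line, so that increments \<open>t + d\<close> may leave the interval and no boundary layers have to be cut
  off.
\<close>

definition clamp_time :: "real \<Rightarrow> real \<Rightarrow> real" where
  "clamp_time T t = max 0 (min t T)"

lemma clamp_time_id: "t \<in> {0..T} \<Longrightarrow> clamp_time T t = t"
  by (auto simp: clamp_time_def)

lemma continuous_on_clamp_time: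
  fixes g :: "real \<Rightarrow> 'e::topological_space"
  assumes "continuous_on {0..T} g" "0 < T"
  shows "continuous_on UNIV (\<lambda>t. g (clamp_time T t))"
  by (rule continuous_on_compose2[OF assms(1)])
    (use assms(2) in \<open>auto simp: clamp_time_def intro!: continuous_intros\<close>)

definition tent :: "real \<Rightarrow> real" where
  "tent s = max 0 s - 2 * max 0 (s - 1) + max 0 (s - 2)"

text \<open>
  The antiderivative of \<^const>\<open>tent\<close> that vanishes on the negative half line. It rises from 0 to 1 on
  \<open>{0..2}\<close> and is continuously differentiable; differences of two scaled and shifted copies are test
  functions that approximate the indicator of an interval.
\<close>

definition smooth_step :: "real \<Rightarrow> real" where
  "smooth_step s = ((max 0 s)\<^sup>2 - 2 * (max 0 (s - 1))\<^sup>2 + (max 0 (s - 2))\<^sup>2) / 2"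

lemma positive_part_square_derivative:
  "((\<lambda>s. (max 0 s)\<^sup>2) has_real_derivative 2 * max 0 s) (at (s::real))"
proof -
  consider "s < 0" | "s > 0" | "s = 0" by linarith
  then show ?thesis
  proof cases
    case 1
    have "((\<lambda>s. 0) has_real_derivative 2 * max 0 s) (at s)" using 1 by simp
    then show ?thesis
      by (rule has_field_derivative_transform_within_open[where S = "{..<0}"]) (use 1 in auto)
  next
    case 2
    have "((\<lambda>s. s\<^sup>2) has_real_derivative 2 * max 0 s) (at s)"
      using 2 by (auto intro!: derivative_eq_intros)
    then show ?thesis
      by (rule has_field_derivative_transform_within_open[where S = "{0<..}"]) (use 2 in auto)
  next
    case 3
    have "((\<lambda>h. ((max 0 h)\<^sup>2) / h) \<longlongrightarrow> 0) (at (0::real))"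
    proof (rule Lim_null_comparison)
      show "\<forall>\<^sub>F h in at (0::real). norm ((max 0 h)\<^sup>2 / h) \<le> \<bar>h\<bar>"
        by (intro always_eventually allI) (auto simp: max_def power2_eq_square)
      show "((\<lambda>h. \<bar>h\<bar>) \<longlongrightarrow> 0) (at (0::real))" by (intro tendsto_rabs_zero tendsto_ident_at)
    qed
    then show ?thesis by (simp add: 3 DERIV_def)
  qed
qed

lemma smooth_step_derivative: "(smooth_step has_real_derivative tent s) (at s)"
proof -
  have sh: "((\<lambda>s. (max 0 (s - c))\<^sup>2) has_real_derivative 2 * max 0 (s - c)) (at s)" for c
    using DERIV_chain2[OF positive_part_square_derivative, of "\<lambda>s. s - c" 1 s]
      DERIV_diff[OF DERIV_ident DERIV_const, of c s] by simp
  have "((\<lambda>s. ((max 0 (s - 0))\<^sup>2 - 2 * (max 0 (s - 1))\<^sup>2 + (max 0 (s - 2))\<^sup>2) / 2) has_real_derivative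
      (2 * max 0 (s - 0) - 2 * (2 * max 0 (s - 1)) + 2 * max 0 (s - 2)) / 2) (at s)"
    by (intro DERIV_cdivide DERIV_add DERIV_diff DERIV_cmult sh)
  then show ?thesis by (simp add: smooth_step_def[abs_def] tent_def add_divide_distrib diff_divide_distrib)
qed

lemma continuous_tent: "continuous_on S tent"
  unfolding tent_def[abs_def] by (intro continuous_intros)

lemma tent_bounds: "0 \<le> tent s" "s \<notin> {0..2} \<Longrightarrow> tent s = 0"
  by (auto simp: tent_def max_def)

lemma smooth_step_values: "s \<le> 0 \<Longrightarrow> smooth_step s = 0" "2 \<le> s \<Longrightarrow> smooth_step s = 1"
  by (auto simp: smooth_step_def max_def power2_eq_square algebra_simps)

lemma smooth_step_bounds: "0 \<le> smooth_step s" "smooth_step s \<le> 1"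
proof -
  have mono: "smooth_step a \<le> smooth_step b" if "a \<le> b" for a b
    using DERIV_nonneg_imp_nondecreasing[OF that, of smooth_step] smooth_step_derivative tent_bounds(1)
    by blast
  show "0 \<le> smooth_step s" using mono[of "min 0 s" s] smooth_step_values(1)[of "min 0 s"] by simp
  show "smooth_step s \<le> 1" using mono[of s "max 2 s"] smooth_step_values(2)[of "max 2 s"] by simp
qed

lemma scaled_step_derivative:
  "((\<lambda>t. smooth_step (c * (t - a))) has_real_derivative c * tent (c * (t - a))) (at t)"
proof -
  have "((\<lambda>t. c * (t - a)) has_real_derivative c) (at t)"
    by (auto intro!: derivative_eq_intros)
  from DERIV_chain2[OF smooth_step_derivative this] show ?thesis by (simp add: mult.commute)
qed

text \<open>
  The scaled tents are nonnegative, concentrate at \<open>a\<close>, and have integral one as soon as their support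
  lies in the interval.
\<close>

lemma tent_delta_sequence:
  fixes m :: "real \<Rightarrow> real"
  assumes m: "continuous_on {0..T} m" and a: "0 < a" "a < T"
  shows "(\<lambda>n. integral {0..T} (\<lambda>t. m t * (real (Suc n) * tent (real (Suc n) * (t - a))))) \<longlonglongrightarrow> m a"
proof (rule LIMSEQ_I)
  fix e :: real assume "0 < e"
  then obtain d where d: "d > 0" "\<And>t. t \<in> {0..T} \<Longrightarrow> dist t a < d \<Longrightarrow> dist (m t) (m a) < e / 2"
    using m a unfolding continuous_on_iff by (metis atLeastAtMost_iff half_gt_zero less_imp_le)
  obtain N where N: "inverse (real (Suc N)) < min d (T - a) / 2"
    using reals_Archimedean[of "min d (T - a) / 2"] d a by auto
  have "norm (integral {0..T} (\<lambda>t. m t * (c * tent (c * (t - a)))) - m a) < e"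
    if "N \<le> n" and c: "c = real (Suc n)" for n c
  proof -
    have c_pos: "c > 0" by (simp add: c)
    have small: "2 / c < min d (T - a)"
    proof -
      have "inverse c \<le> inverse (real (Suc N))" using that by (simp add: le_imp_inverse_le)
      then have "2 / c \<le> inverse (real (Suc N)) * 2"
        by (simp only: divide_inverse)
      also have "\<dots> < min d (T - a)" using N by (simp only: pos_less_divide_eq[OF zero_less_numeral])
      finally show ?thesis by simp
    qed
    have "((\<lambda>t. c * tent (c * (t - a))) has_integral
        (smooth_step (c * (T - a)) - smooth_step (c * (0 - a)))) {0..T}"
      using a by (intro fundamental_theorem_of_calculus)
        (auto simp: has_real_derivative_iff_has_vector_derivative[symmetric]
          intro: has_field_derivative_at_within scaled_step_derivative)
    moreover have "smooth_step (c * (T - a)) = 1"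
    proof (rule smooth_step_values)
      have "2 / c < T - a" using small by simp
      then show "2 \<le> c * (T - a)" using c_pos by (simp add: divide_less_eq mult.commute)
    qed
    moreover have "smooth_step (c * (0 - a)) = 0"
      using a c_pos by (intro smooth_step_values) (simp add: mult_nonneg_nonneg)
    ultimately have one: "((\<lambda>t. c * tent (c * (t - a))) has_integral 1) {0..T}" by simp
    have "continuous_on {0..T} (\<lambda>t. m t * (c * tent (c * (t - a))))"
      by (intro continuous_intros m continuous_on_compose2[OF continuous_tent[of UNIV]]) auto
    then have int: "(\<lambda>t. m t * (c * tent (c * (t - a)))) integrable_on {0..T}"
      by (rule integrable_continuous_real)
    have diff: "((\<lambda>t. m t * (c * tent (c * (t - a))) - m a * (c * tent (c * (t - a)))) has_integral
        (integral {0..T} (\<lambda>t. m t * (c * tent (c * (t - a)))) - m a * 1)) {0..T}"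
      by (intro has_integral_diff integrable_integral int has_integral_mult_right one)
    have "norm (integral {0..T} (\<lambda>t. m t * (c * tent (c * (t - a)))) - m a * 1) \<le> e / 2 * 1"
      unfolding integral_unique[OF diff, symmetric] integral_unique[OF has_integral_mult_right[OF one, of "e/2"], symmetric]
    proof (rule integral_norm_bound_integral)
      show "(\<lambda>t. m t * (c * tent (c * (t - a))) - m a * (c * tent (c * (t - a)))) integrable_on {0..T}"
        using diff by blast
      show "(\<lambda>t. e / 2 * (c * tent (c * (t - a)))) integrable_on {0..T}"
        using has_integral_mult_right[OF one] by blast
      fix t assume t: "t \<in> {0..T}"
      show "norm (m t * (c * tent (c * (t - a))) - m a * (c * tent (c * (t - a))))
          \<le> e / 2 * (c * tent (c * (t - a)))"
      proof (cases "c * (t - a) \<in> {0..2}")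
        case True
        then have "0 \<le> t - a" "t - a \<le> 2 / c"
          using c_pos by (auto simp: zero_le_mult_iff field_simps)
        then have "dist t a < d" using small by (simp add: dist_real_def)
        from d(2)[OF t this] have "norm (m t - m a) \<le> e / 2" by (simp add: dist_norm)
        then have "norm (m t - m a) * (c * tent (c * (t - a))) \<le> e / 2 * (c * tent (c * (t - a)))"
          using c_pos tent_bounds(1) by (intro mult_right_mono) auto
        then show ?thesis
          using c_pos tent_bounds(1)[of "c * (t - a)"]
          by (simp add: left_diff_distrib[symmetric] abs_mult)
      qed (simp add: tent_bounds(2))
    qed
    then show ?thesis using \<open>0 < e\<close> by simp
  qed
  then show "\<exists>N. \<forall>n\<ge>N. norm (integral {0..T} (\<lambda>t. m t * (real (Suc n) * tent (real (Suc n) * (t - a)))) - m a) < e"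
    by blast
qed

lemma scaled_step_limit:
  "(\<lambda>n. smooth_step (real (Suc n) * (t - a))) \<longlonglongrightarrow> (if a < t then 1 else 0)"
proof (cases "a < t")
  case True
  obtain N where N: "2 / (t - a) < real N" using reals_Archimedean2 by blast
  have "smooth_step (real (Suc n) * (t - a)) = 1" if "n \<ge> N" for n
  proof (rule smooth_step_values)
    have "2 / (t - a) \<le> real (Suc n)" using N that by linarith
    then show "2 \<le> real (Suc n) * (t - a)" using True by (simp add: divide_le_eq del: of_nat_Suc)
  qed
  then show ?thesis using True
    by (intro tendsto_eventually) (auto simp: eventually_sequentially simp del: of_nat_Suc)
next
  case False
  then have "smooth_step (real (Suc n) * (t - a)) = 0" for n
    by (intro smooth_step_values) (simp add: mult_le_0_iff)
  then show ?thesis using False by simp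
qed

text \<open>
  The test functions \<open>\<phi> n\<close> tend boundedly to the indicator of the interval from \<open>a\<close> to \<open>b\<close>, while
  their derivatives form a delta sequence at \<open>a\<close> minus one at \<open>b\<close>. The weak derivative identity
  becomes the assertion in the limit.
\<close>

text \<open>
  Both sides are continuous up to the end points, so the interior case suffices.
\<close>

lemma weak_derivative_FTC_interior:
  fixes m k :: "real \<Rightarrow> real"
  assumes k: "integrable (time_measure T) k" and m: "continuous_on {0..T} m"
    and weak: "\<And>\<phi> \<phi>'. test_function T \<phi> \<phi>' \<Longrightarrow>
      (\<integral>t. m t * \<phi>' t \<partial>time_measure T) = - (\<integral>t. k t * \<phi> t \<partial>time_measure T)"
    and ab: "0 < a" "a \<le> b" "b < T"
  shows "m b - m a = integral {a..b} k"
proof -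
  let ?M = "time_measure T"
  define \<phi> where "\<phi> = (\<lambda>n t. smooth_step (real (Suc n) * (t - a)) - smooth_step (real (Suc n) * (t - b)))"
  define \<phi>' where "\<phi>' = (\<lambda>n t. real (Suc n) * tent (real (Suc n) * (t - a)) - real (Suc n) * tent (real (Suc n) * (t - b)))"
  have cont': "continuous_on S (\<phi>' n)" for S n
    unfolding \<phi>'_def
    by (intro continuous_intros continuous_on_compose2[OF continuous_tent[of UNIV]]) auto
  have der: "(\<phi> n has_real_derivative \<phi>' n t) (at t)" for n t
    unfolding \<phi>_def \<phi>'_def by (intro DERIV_diff scaled_step_derivative)
  have cont: "continuous_on S (\<phi> n)" for S n
    using der by (intro DERIV_continuous_on) (auto intro: has_field_derivative_at_within)
  have bound: "norm (\<phi> n t) \<le> 1" for n t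
    unfolding \<phi>_def real_norm_def abs_le_iff
    using smooth_step_bounds[of "real (Suc n) * (t - a)"] smooth_step_bounds[of "real (Suc n) * (t - b)"]
    by linarith
  have test: "\<forall>\<^sub>F n in sequentially. test_function T (\<phi> n) (\<phi>' n)"
  proof -
    \<comment> \<open>for these \<open>n\<close> the right end \<open>b + 2 / (n + 1)\<close> of the support stays below \<open>T\<close>\<close>
    obtain N where N: "inverse (real (Suc N)) < (T - b) / 2"
      using reals_Archimedean[of "(T - b) / 2"] ab by auto
    have "test_function T (\<phi> n) (\<phi>' n)" if "N \<le> n" for n
      unfolding test_function_def
    proof (intro conjI allI der cont' exI impI)
      define c where "c = real (Suc n)"
      have c: "c > 0" by (simp add: c_def)
      have "inverse c \<le> inverse (real (Suc N))" using that by (simp add: c_def le_imp_inverse_le)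
      then have "2 / c \<le> inverse (real (Suc N)) * 2"
        by (simp only: divide_inverse)
      also have "\<dots> < T - b" using N by (simp only: pos_less_divide_eq[OF zero_less_numeral])
      finally show "b + 2 / c < T" by simp
      fix t assume t: "t \<notin> {a..b + 2 / c}"
      show "\<phi> n t = 0"
      proof (cases "t < a")
        case True
        then have "c * (t - a) \<le> 0" "c * (t - b) \<le> 0" using c ab by (auto simp: mult_le_0_iff)
        then show ?thesis by (simp add: \<phi>_def c_def smooth_step_values del: of_nat_Suc)
      next
        case False
        then have "t - b \<ge> 2 / c" using t by auto
        moreover from this have "t - a \<ge> 2 / c" using ab by linarith
        ultimately have "2 \<le> c * (t - a)" "2 \<le> c * (t - b)"
          using c by (auto simp: divide_le_eq mult.commute)
        then show ?thesis by (simp add: \<phi>_def c_def smooth_step_values del: of_nat_Suc)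
      qed
    qed (use ab in auto)
    then show ?thesis by (auto simp: eventually_sequentially)
  qed
  have left: "(\<lambda>n. \<integral>t. m t * \<phi>' n t \<partial>?M) \<longlonglongrightarrow> m a - m b"
  proof -
    have "(\<integral>t. m t * \<phi>' n t \<partial>?M) =
        integral {0..T} (\<lambda>t. m t * (real (Suc n) * tent (real (Suc n) * (t - a)))) -
        integral {0..T} (\<lambda>t. m t * (real (Suc n) * tent (real (Suc n) * (t - b))))" for n
    proof -
      let ?h = "\<lambda>t. m (clamp_time T t) * \<phi>' n t"
      have h: "continuous_on UNIV ?h"
        using ab by (intro continuous_intros cont' continuous_on_clamp_time m) auto
      have "(\<integral>t. m t * \<phi>' n t \<partial>?M) = (\<integral>t. ?h t \<partial>?M)"
        by (rule Bochner_Integration.integral_cong) (auto simp: clamp_time_def)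
      also have "\<dots> = integral {0..T} ?h"
        using time_integral[OF integrable_time_continuous[OF h], of T] by (simp add: integral_unique)
      also have "\<dots> = integral {0..T} (\<lambda>t. m t * (real (Suc n) * tent (real (Suc n) * (t - a)))
          - m t * (real (Suc n) * tent (real (Suc n) * (t - b))))"
        by (rule Henstock_Kurzweil_Integration.integral_cong)
          (simp add: clamp_time_id \<phi>'_def right_diff_distrib)
      also have "\<dots> = integral {0..T} (\<lambda>t. m t * (real (Suc n) * tent (real (Suc n) * (t - a)))) -
        integral {0..T} (\<lambda>t. m t * (real (Suc n) * tent (real (Suc n) * (t - b))))"
        by (intro Henstock_Kurzweil_Integration.integral_diff integrable_continuous_real
            continuous_intros m continuous_on_compose2[OF continuous_tent[of UNIV]]) auto
      finally show ?thesis .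
    qed
    then show ?thesis using ab by (simp only:) (intro tendsto_diff tent_delta_sequence m, auto)
  qed
  have meas: "(\<lambda>t. k t * indicator {a<..b} t) \<in> borel_measurable ?M"
    by (intro borel_measurable_times borel_measurable_integrable[OF k] borel_measurable_indicator)
      (use ab in \<open>auto simp: sets_restrict_space intro!: image_eqI[where x = "{a<..b}"]\<close>)
  have right: "(\<lambda>n. \<integral>t. k t * \<phi> n t \<partial>?M) \<longlonglongrightarrow> (\<integral>t. k t * (indicator {a<..b} t) \<partial>?M)"
  proof (rule integral_dominated_convergence[where w = "\<lambda>t. norm (k t)"])
    show "(\<lambda>t. k t * indicator {a<..b} t) \<in> borel_measurable ?M" by (rule meas)
    show "(\<lambda>t. k t * \<phi> n t) \<in> borel_measurable ?M" for n
      by (intro borel_measurable_times borel_measurable_integrable[OF k]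
          borel_measurable_integrable[OF integrable_time_continuous[OF cont]])
    show "integrable ?M (\<lambda>t. norm (k t))" using k by simp
    show "AE t in ?M. (\<lambda>n. k t * \<phi> n t) \<longlonglongrightarrow> k t * indicator {a<..b} t"
    proof (intro AE_I2 tendsto_mult tendsto_const)
      fix t
      have "(\<lambda>n. \<phi> n t) \<longlonglongrightarrow> (if a < t then 1 else 0) - (if b < t then 1 else 0)"
        unfolding \<phi>_def by (intro tendsto_diff scaled_step_limit)
      then show "(\<lambda>n. \<phi> n t) \<longlonglongrightarrow> indicator {a<..b} t"
        using ab by (auto simp: indicator_def split: if_splits)
    qed
    show "AE t in ?M. norm (k t * \<phi> n t) \<le> norm (k t)" for n
      using bound by (auto simp: abs_mult mult_left_le)
  qed
  have int: "integrable ?M (\<lambda>t. k t * indicator {a<..b} t)"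
    by (rule Bochner_Integration.integrable_bound[OF k meas]) (auto simp: indicator_def)
  have eq: "(\<integral>t. k t * (indicator {a<..b} t) \<partial>?M) = integral {a..b} k"
  proof -
    have "(\<integral>t. k t * (indicator {a<..b} t) \<partial>?M) = integral {0..T} (\<lambda>t. k t * indicator {a<..b} t)"
      using time_integral[OF int] by (simp add: integral_unique)
    also have "\<dots> = integral {0..T} (\<lambda>t. if t \<in> {a..b} then k t else 0)"
      by (rule integral_spike[of "{a}"]) (auto simp: indicator_def)
    also have "\<dots> = integral ({a..b} \<inter> {0..T}) k" by (rule Henstock_Kurzweil_Integration.integral_restrict_Int)
    also have "{a..b} \<inter> {0..T} = {a..b}" using ab by auto
    finally show ?thesis .
  qed
  have "(\<lambda>n. \<integral>t. m t * \<phi>' n t \<partial>?M) \<longlonglongrightarrow> - (\<integral>t. k t * (indicator {a<..b} t) \<partial>?M)"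
    using test by (intro Lim_transform_eventually[OF tendsto_minus[OF right]])
      (auto elim!: eventually_mono simp: weak)
  from LIMSEQ_unique[OF left this] show ?thesis by (simp add: eq)
qed

lemma constant_on_closed_interval:
  fixes d :: "real \<Rightarrow> real"
  assumes d: "continuous_on {0..T} d" and "0 < T"
    and const: "\<And>a b. 0 < a \<Longrightarrow> a \<le> b \<Longrightarrow> b < T \<Longrightarrow> d a = d b" and t: "t \<in> {0..T}"
  shows "d t = d 0"
proof -
  have cl: "closure {0<..<T} = {0..T}" using \<open>0 < T\<close> by simp
  have "d t = d (T / 2)" if "t \<in> {0..T}" for t
  proof (rule continuous_constant_on_closure[of "{0<..<T}" d])
    show "d x = d (T / 2)" if "x \<in> {0<..<T}" for x
      using const[of x "T / 2"] const[of "T / 2" x] that by (cases "x \<le> T / 2") auto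
  qed (use d that cl in auto)
  from this[OF t] this[of 0] show ?thesis using \<open>0 < T\<close> by simp
qed

lemma weak_derivative_FTC:
  fixes m k :: "real \<Rightarrow> real"
  assumes k: "integrable (time_measure T) k" and m: "continuous_on {0..T} m"
    and weak: "\<And>\<phi> \<phi>'. test_function T \<phi> \<phi>' \<Longrightarrow>
      (\<integral>t. m t * \<phi>' t \<partial>time_measure T) = - (\<integral>t. k t * \<phi> t \<partial>time_measure T)"
    and ab: "0 < T" "0 \<le> a" "a \<le> b" "b \<le> T"
  shows "m b - m a = integral {a..b} k"
proof -
  have k_int: "k integrable_on {0..T}" using time_integral[OF k] by blast
  have comb: "integral {0..s} k + integral {s..t} k = integral {0..t} k" if "0 \<le> s" "s \<le> t" "t \<le> T" for s t
    by (rule Henstock_Kurzweil_Integration.integral_combine[OF that(1,2) integrable_on_subinterval[OF k_int]])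
      (use that in auto)
  have "m t - integral {0..t} k = m 0 - integral {0..0} k" if "t \<in> {0..T}" for t
  proof (rule constant_on_closed_interval[OF _ ab(1) _ that])
    show "continuous_on {0..T} (\<lambda>t. m t - integral {0..t} k)"
      by (intro continuous_intros m indefinite_integral_continuous_1 k_int)
    fix a b assume "0 < a" "a \<le> b" "b < T"
    then show "m a - integral {0..a} k = m b - integral {0..b} k"
      using weak_derivative_FTC_interior[OF k m weak, of a b] comb[of a b] by simp
  qed
  from this[of a] this[of b] comb[of a b] ab show ?thesis by simp
qed

section \<open>Totality of step functions\<close>

text \<open>
  The positive and the negative part of \<open>g\<close> are densities of finite measures that agree on rays. Rays
  generate the Borel sets, so the measures coincide, and densities are unique.
\<close>

lemma AE_zero_of_ray_integrals:
  fixes g :: "real \<Rightarrow> real"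
  assumes g: "integrable lborel g"
    and zero: "\<And>x. (\<integral>t. g t * indicator {x<..} t \<partial>lborel) = 0"
  shows "AE t in lborel. g t = 0"
proof -
  define p where "p = (\<lambda>t. max 0 (g t))"
  define q where "q = (\<lambda>t. max 0 (- g t))"
  have pq: "integrable lborel p" "integrable lborel q"
    unfolding p_def q_def using g by auto
  have [measurable]: "p \<in> borel_measurable borel" "q \<in> borel_measurable borel"
    using pq by auto
  have em: "emeasure (density lborel h) {x<..} = ennreal (\<integral>t. h t * indicator {x<..} t \<partial>lborel)"
    if h: "integrable lborel h" and nn: "\<And>t. 0 \<le> h t" for h :: "real \<Rightarrow> real" and x
  proof -
    have [measurable]: "h \<in> borel_measurable borel" using h by auto
    have "emeasure (density lborel h) {x<..} = (\<integral>\<^sup>+t. ennreal (h t * indicator {x<..} t) \<partial>lborel)"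
      by (subst emeasure_density)
        (auto intro!: nn_integral_cong simp: indicator_def)
    also have "\<dots> = ennreal (\<integral>t. h t * indicator {x<..} t \<partial>lborel)"
      using nn by (intro nn_integral_eq_integral integrable_real_mult_indicator h) auto
    finally show ?thesis .
  qed
  have same: "(\<integral>t. p t * indicator {x<..} t \<partial>lborel) = (\<integral>t. q t * indicator {x<..} t \<partial>lborel)" for x
  proof -
    have "(\<integral>t. p t * indicator {x<..} t \<partial>lborel) - (\<integral>t. q t * indicator {x<..} t \<partial>lborel)
        = (\<integral>t. p t * indicator {x<..} t - q t * indicator {x<..} t \<partial>lborel)"
      by (intro Bochner_Integration.integral_diff[symmetric] integrable_real_mult_indicator pq) auto
    also have "\<dots> = (\<integral>t. g t * indicator {x<..} t \<partial>lborel)"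
      by (intro Bochner_Integration.integral_cong) (auto simp: p_def q_def max_def indicator_def)
    finally show ?thesis using zero by simp
  qed
  have "density lborel p = density lborel q"
    by (rule measure_eqI_lessThan) (use em[OF pq(1)] em[OF pq(2)] same in \<open>auto simp: p_def q_def\<close>)
  then have "AE t in lborel. ennreal (p t) = ennreal (q t)"
    by (intro sigma_finite_measure.density_unique[OF sigma_finite_lborel]) auto
  then show ?thesis
    by eventually_elim (auto simp: p_def q_def max_def split: if_splits)
qed

lemma AE_zero_of_interval_integrals:
  fixes k :: "real \<Rightarrow> real"
  assumes k: "integrable (time_measure T) k"
    and zero: "\<And>a b. 0 \<le> a \<Longrightarrow> a < b \<Longrightarrow> b \<le> T \<Longrightarrow> integral {a..b} k = 0"
  shows "AE t in time_measure T. k t = 0"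
proof -
  let ?k = "\<lambda>t. indicator {0<..<T} t * k t"
  have lk: "integrable lebesgue ?k"
    using k by (subst (asm) integrable_restrict_space) auto
  then obtain g where g: "g \<in> borel_measurable lborel" "AE t in lborel. ?k t = g t"
    using completion_ex_borel_measurable_real[of ?k lborel] borel_measurable_integrable by blast
  have AEl: "AE t in lebesgue. ?k t = g t" using g(2) by (rule AE_completion)
  have gm: "g \<in> borel_measurable lebesgue" using g(1) by (rule measurable_completion)
  have "integrable lebesgue g"
    using lk AEl gm by (subst integrable_cong_AE[where g = ?k]) auto
  then have gi: "integrable lborel g" using g(1) by (simp add: integrable_completion)
  have "(\<integral>t. g t * indicator {x<..} t \<partial>lborel) = 0" for x
  proof -
    have ind: "indicat_real {x<..} \<in> borel_measurable lebesgue"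
      by (rule measurable_completion) simp
    have "(\<integral>t. g t * indicator {x<..} t \<partial>lborel) = (\<integral>t. g t * indicator {x<..} t \<partial>lebesgue)"
      using g(1) by (intro integral_completion[symmetric]) simp
    also have "\<dots> = (\<integral>t. indicator {0<..<T} t *\<^sub>R (k t * indicator {x<..} t) \<partial>lebesgue)"
    proof (rule integral_cong_AE)
      show "(\<lambda>t. indicator {0<..<T} t *\<^sub>R (k t * indicator {x<..} t)) \<in> borel_measurable lebesgue"
        using borel_measurable_times[OF borel_measurable_integrable[OF lk] ind]
        by (simp add: mult.assoc)
      show "AE t in lebesgue. g t * indicator {x<..} t = indicator {0<..<T} t *\<^sub>R (k t * indicator {x<..} t)"
        using AEl by eventually_elim (metis mult.assoc real_scaleR_def)
    qed (rule borel_measurable_times[OF gm ind])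
    also have "\<dots> = (\<integral>t. k t * indicator {x<..} t \<partial>time_measure T)"
      by (rule integral_restrict_space[symmetric]) simp
    also have "\<dots> = integral {0..T} (\<lambda>t. k t * indicator {x<..} t)"
    proof -
      have "integrable (time_measure T) (\<lambda>t. k t * indicator {x<..} t)"
      proof (rule Bochner_Integration.integrable_bound[OF k])
        show "(\<lambda>t. k t * indicator {x<..} t) \<in> borel_measurable (time_measure T)"
          by (intro borel_measurable_times borel_measurable_integrable[OF k] measurable_restrict_space1
              measurable_completion) simp
      qed (auto simp: indicator_def)
      from time_integral[OF this] show ?thesis by (simp add: integral_unique)
    qed
    also have "\<dots> = integral {0..T} (\<lambda>t. if t \<in> {max 0 x..T} then k t else 0)"
      by (rule integral_spike[of "{x}"]) (auto simp: indicator_def)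
    also have "\<dots> = integral ({max 0 x..T} \<inter> {0..T}) k"
      by (rule Henstock_Kurzweil_Integration.integral_restrict_Int)
    also have "{max 0 x..T} \<inter> {0..T} = {max 0 x..T}" by auto
    also have "integral {max 0 x..T} k = 0"
    proof (cases "max 0 x < T")
      case True
      then show ?thesis using zero[of "max 0 x" T] by simp
    next
      case False
      then have "max 0 x = T \<or> {max 0 x..T} = {}" by (simp only: atLeastatMost_empty_iff) linarith
      then have "(k has_integral 0) {max 0 x..T}" by (elim disjE ssubst) (auto intro: has_integral_refl)
      then show ?thesis by (rule integral_unique)
    qed
    finally show ?thesis .
  qed
  from AE_zero_of_ray_integrals[OF gi this] have "AE t in lborel. ?k t = 0"
    using g(2) by eventually_elim simp
  then have "AE t in lebesgue. t \<in> {0<..<T} \<longrightarrow> k t = 0"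
    by (rule AE_mp[OF AE_completion]) (auto simp: indicator_def)
  then show ?thesis by (subst AE_restrict_space_iff) auto
qed

text \<open>
  Uniform boundedness makes the set on which the functionals converge to \<open>l\<close> a closed subspace.
\<close>

lemma tendsto_functionals_of_total_set:
  fixes P :: "'b \<Rightarrow> 'a::{real_inner,banach} \<Rightarrow> real"
  assumes lin: "\<And>d. linear (P d)" and bd: "\<And>d w. \<bar>P d w\<bar> \<le> C * norm w"
    and l: "bounded_linear l"
    and total: "\<And>v. (\<And>y. y \<in> D \<Longrightarrow> v \<bullet> y = 0) \<Longrightarrow> v = 0"
    and conv: "\<And>y. y \<in> D \<Longrightarrow> ((\<lambda>d. P d y) \<longlongrightarrow> l y) F"
  shows "((\<lambda>d. P d w) \<longlongrightarrow> l w) F"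
proof -
  define W where "W = {w. ((\<lambda>d. P d w) \<longlongrightarrow> l w) F}"
  interpret l: bounded_linear l by fact
  obtain K where K: "\<And>w. \<bar>l w\<bar> \<le> norm w * K" "K \<ge> 0" using l.nonneg_bounded by auto
  \<comment> \<open>only an upper bound of \<open>C + K\<close>; the summand 1 makes it positive\<close>
  define B where "B = \<bar>C\<bar> + K + 1"
  have B: "B > 0" using K(2) by (simp add: B_def)
  have "W = UNIV"
  proof (rule closed_subspace_eq_UNIV)
    show "subspace W"
      unfolding subspace_def W_def
      by (auto simp: linear_0[OF lin] linear_add[OF lin] linear_cmul[OF lin] l.zero l.add l.scaleR
          intro!: tendsto_add tendsto_mult_left)
    show "closed W"
    proof (unfold closed_sequential_limits, intro allI impI, elim conjE)
      fix x w assume x: "\<forall>n. x n \<in> W" and lim: "x \<longlonglongrightarrow> w"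
      have "((\<lambda>d. P d w) \<longlongrightarrow> l w) F"
      proof (rule tendstoI)
        fix e :: real assume "0 < e"
        then have "0 < e / (2 * B)" using B by simp
        then obtain n where n: "norm (x n - w) < e / (2 * B)"
          using LIMSEQ_D[OF lim] by blast
        have "\<forall>\<^sub>F d in F. dist (P d (x n)) (l (x n)) < e / 2"
          using x \<open>0 < e\<close> by (auto simp: W_def dest!: tendstoD[where e = "e/2"])
        then show "\<forall>\<^sub>F d in F. dist (P d w) (l w) < e"
        proof eventually_elim
          case (elim d)
          have "\<bar>P d (w - x n)\<bar> + \<bar>l (w - x n)\<bar> \<le> (C + K) * norm (w - x n)"
            using bd[of d "w - x n"] K(1)[of "w - x n"] by (simp add: algebra_simps)
          also have "\<dots> \<le> B * norm (w - x n)" by (intro mult_right_mono) (auto simp: B_def)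
          also have "\<dots> < e / 2" using n B by (simp add: norm_minus_commute field_simps)
          finally have "\<bar>P d w - P d (x n)\<bar> + \<bar>l w - l (x n)\<bar> < e / 2"
            by (simp add: linear_diff[OF lin] l.diff)
          then show ?case using elim unfolding dist_real_def by linarith
        qed
      qed
      then show "w \<in> W" by (simp add: W_def)
    qed
  qed (use total conv in \<open>auto simp: W_def\<close>)
  then show ?thesis by (auto simp: W_def)
qed

text \<open>
  Integrals of shifted functions are differences of one fixed antiderivative; difference quotients
  of integrals thus become difference quotients of this antiderivative.
\<close>

lemma shifted_antiderivative_integral:
  fixes K k :: "real \<Rightarrow> real"
  assumes "\<And>t. (K has_real_derivative k t) (at t)" "a \<le> b"
  shows "((\<lambda>t. k (t + d)) has_integral (K (b + d) - K (a + d))) {a..b}"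
proof (rule fundamental_theorem_of_calculus[OF assms(2)])
  fix t
  have "((\<lambda>t. t + d) has_real_derivative 1) (at t)" by (auto intro!: derivative_eq_intros)
  from DERIV_chain2[OF assms(1) this]
  have "((\<lambda>t. K (t + d)) has_real_derivative k (t + d)) (at t)" by simp
  then show "((\<lambda>t. K (t + d)) has_vector_derivative k (t + d)) (at t within {a..b})"
    by (metis has_field_derivative_at_within has_real_derivative_iff_has_vector_derivative)
qed

lemma DERIV_difference_quotient:
  assumes "(K has_real_derivative k) (at t)"
  shows "((\<lambda>d. (K (t + d) - K t) / d) \<longlongrightarrow> k) (at 0)"
  using assms by (simp add: DERIV_def)

context L2_duality
begin

lemma step_function_element:
  "\<exists>w. AE t in M. evU w t = indicator {a<..<b} t *\<^sub>R x"
proof -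
  have ind: "{a<..<b} \<inter> {0<..<T} \<in> sets M"
    by (auto simp: sets_restrict_space)
  have sf: "simple_function M (indicator ({a<..<b} \<inter> {0<..<T}) :: real \<Rightarrow> real)"
    by (rule simple_function_indicator[OF ind])
  let ?s = "\<lambda>t. indicator ({a<..<b} \<inter> {0<..<T}) t *\<^sub>R x"
  have "square_integrable T ?s"
    unfolding square_integrable_def
  proof
    show "strongly_measurable M ?s"
      unfolding strongly_measurable_def
      by (intro exI[of _ "\<lambda>n. ?s"] conjI allI AE_I2 tendsto_const simple_function_compose1[OF sf])
    have "integrable M (\<lambda>t. indicator ({a<..<b} \<inter> {0<..<T}) t *\<^sub>R (norm x)\<^sup>2)"
      by (rule integrable_mult_indicator[OF ind finite_measure.integrable_const[OF finite_measure_time]])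
    then show "integrable M (\<lambda>t. (norm (?s t))\<^sup>2)"
      by (rule Bochner_Integration.integrable_cong[THEN iffD1, rotated -1]) (auto simp: indicator_def)
  qed
  then obtain w where "AE t in M. evU w t = ?s t" using space_U unfolding L2_space_def by blast
  then have "AE t in M. evU w t = indicator {a<..<b} t *\<^sub>R x"
    using AE_space by eventually_elim (auto simp: indicator_def)
  then show ?thesis by blast
qed

definition step_elements :: "'uu set" where
  "step_elements = {w. \<exists>a b x. 0 \<le> a \<and> a < b \<and> b \<le> T \<and> (AE t in M. evU w t = indicator {a<..<b} t *\<^sub>R x)}"

lemma integral_indicator_time:
  fixes k :: "real \<Rightarrow> real"
  assumes k: "integrable M k" and ab: "0 \<le> a" "b \<le> T"
  shows "(\<integral>t. indicator {a<..<b} t * k t \<partial>M) = integral {a..b} k"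
proof -
  have "integrable M (\<lambda>t. indicator {a<..<b} t *\<^sub>R k t)"
    by (rule integrable_mult_indicator[OF _ k])
      (use ab in \<open>auto simp: sets_restrict_space intro!: image_eqI[where x = "{a<..<b}"]\<close>)
  then have int: "integrable M (\<lambda>t. indicator {a<..<b} t * k t)" by simp
  have "(\<integral>t. indicator {a<..<b} t * k t \<partial>M) = integral {0..T} (\<lambda>t. indicator {a<..<b} t * k t)"
    using time_integral[OF int] by (simp add: integral_unique)
  also have "\<dots> = integral {0..T} (\<lambda>t. if t \<in> {a..b} then k t else 0)"
    by (rule integral_spike[of "{a, b}"]) (auto simp: indicator_def)
  also have "\<dots> = integral ({a..b} \<inter> {0..T}) k" by (rule Henstock_Kurzweil_Integration.integral_restrict_Int)
  also have "{a..b} \<inter> {0..T} = {a..b}" using ab by auto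
  finally show ?thesis .
qed

lemma constant_square_integrable: "square_integrable T (\<lambda>t. x)"
  by (rule square_integrable_continuous) (rule continuous_on_const)

text \<open>
  For each fixed \<open>x\<close> the function \<open>evU v t \<bullet> x\<close> has zero integral over every interval, so it vanishes
  outside a null set that may depend on \<open>x\<close>. Strong measurability reduces this to the countably many
  values of the approximating simple functions, and along these \<open>evU v t\<close> is orthogonal to itself.
\<close>

lemma step_elements_total:
  assumes "\<And>y. y \<in> step_elements \<Longrightarrow> v \<bullet> y = 0"
  shows "v = 0"
proof -
  have int: "integrable M (\<lambda>t. evU v t \<bullet> x)" for x
    by (rule square_integrable_product(1)[OF square_integrable_ev(1) constant_square_integrable
          bounded_bilinear_inner Cauchy_Schwarz_ineq2])
  have zero: "AE t in M. evU v t \<bullet> x = 0" for x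
  proof (rule AE_zero_of_interval_integrals[OF int])
    fix a b assume ab: "0 \<le> a" "a < b" "b \<le> T"
    obtain w where w: "AE t in M. evU w t = indicator {a<..<b} t *\<^sub>R x"
      using step_function_element by blast
    have "integral {a..b} (\<lambda>t. evU v t \<bullet> x) = (\<integral>t. indicator {a<..<b} t * (evU v t \<bullet> x) \<partial>M)"
      using integral_indicator_time[OF int] ab by simp
    also have "\<dots> = v \<bullet> w"
      unfolding inner_eq_integral
    proof (rule integral_cong_AE)
      show "(\<lambda>t. indicator {a<..<b} t * (evU v t \<bullet> x)) \<in> borel_measurable M"
        using ab by (intro borel_measurable_times borel_measurable_integrable[OF int] borel_measurable_indicator)
          (auto simp: sets_restrict_space intro!: image_eqI[where x = "{a<..<b}"])
      show "(\<lambda>t. evU v t \<bullet> evU w t) \<in> borel_measurable M"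
        by (rule borel_measurable_integrable, rule square_integrable_product(1)[OF square_integrable_ev(1,1)
              bounded_bilinear_inner Cauchy_Schwarz_ineq2])
      show "AE t in M. indicator {a<..<b} t * (evU v t \<bullet> x) = evU v t \<bullet> evU w t"
        using w by eventually_elim simp
    qed
    also have "\<dots> = 0" using w ab by (intro assms) (auto simp: step_elements_def)
    finally show "integral {a..b} (\<lambda>t. evU v t \<bullet> x) = 0" .
  qed
  obtain s where s: "\<And>n. simple_function M (s n)" "AE t in M. (\<lambda>n. s n t) \<longlonglongrightarrow> evU v t"
    using square_integrable_ev(1)[of v] unfolding square_integrable_def strongly_measurable_def by blast
  define C where "C = (\<Union>n. s n ` space M)"
  have "countable C"
    unfolding C_def using simple_functionD(1)[OF s(1)]
    by (intro countable_UN countableI_type countable_finite)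
  then have "AE t in M. \<forall>x\<in>C. evU v t \<bullet> x = 0" using zero by (simp add: AE_ball_countable)
  then have "AE t in M. evU v t = 0"
    using s(2) AE_space
  proof eventually_elim
    case (elim t)
    have "(\<lambda>n. evU v t \<bullet> s n t) \<longlonglongrightarrow> evU v t \<bullet> evU v t" by (intro tendsto_intros elim)
    moreover have "evU v t \<bullet> s n t = 0" for n using elim by (auto simp: C_def)
    ultimately have "evU v t \<bullet> evU v t = 0" by (simp add: LIMSEQ_const_iff)
    then show ?case by simp
  qed
  moreover have "AE t in M. evU 0 t = 0" using ev_linear(2)[of 0 0] by simp
  ultimately have "AE t in M. evU v t = evU 0 t" by eventually_elim simp
  then show ?thesis by (rule L2_space_AE_unique[OF space_U])
qed

lemma dual_integrable: "integrable M (\<lambda>t. evUs g t x)"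
  by (rule square_integrable_product(1)[OF square_integrable_ev(2) constant_square_integrable
        bounded_bilinear_dual_pairing abs_dual_pairing_le])

end

section \<open>Integration by parts in the solution space\<close>

locale evolution_space = L2_duality T evU evUs
  for T and evU :: "'uu::{real_inner,banach} \<Rightarrow> real \<Rightarrow> 'u::{real_inner,banach}"
    and evUs :: "'us::{real_inner,banach} \<Rightarrow> real \<Rightarrow> ('u \<Rightarrow>\<^sub>L real)" +
  fixes \<iota> :: "'u \<Rightarrow>\<^sub>L 'h::{real_inner,banach}"
    and emb :: "'v::{real_inner,banach} \<Rightarrow> 'uu" and dt :: "'v \<Rightarrow> 'us" and tr :: "'v \<Rightarrow> real \<Rightarrow> 'h"
  assumes T_pos: "0 < T" and space_V: "solution_space T \<iota> evUs evU emb dt tr"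
begin

abbreviation "trc v t \<equiv> tr v (clamp_time T t)"

lemma continuous_trace: "continuous_on {0..T} (tr v)" "continuous_on UNIV (\<lambda>t. trc v t)"
proof -
  show "continuous_on {0..T} (tr v)" using space_V unfolding solution_space_def by blast
  then show "continuous_on UNIV (\<lambda>t. trc v t)" by (rule continuous_on_clamp_time) (rule T_pos)
qed

lemma trace_AE: "AE t in M. trc v t = \<iota> (evU (emb v) t)"
proof -
  have "AE t in M. tr v t = \<iota> (evU (emb v) t)" using space_V unfolding solution_space_def by blast
  then show ?thesis using AE_space by eventually_elim (simp add: clamp_time_id)
qed

text \<open>
  Testing the weak derivative with the products of scalar test functions and \<open>x\<close> shows that it is the
  derivative of the scalar function \<open>tr v t \<bullet> \<iota> x\<close>.
\<close>

lemma trace_increment: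
  assumes "0 \<le> a" "a \<le> b" "b \<le> T"
  shows "(tr v b - tr v a) \<bullet> \<iota> x = integral {a..b} (\<lambda>t. evUs (dt v) t x)"
proof -
  have "tr v b \<bullet> \<iota> x - tr v a \<bullet> \<iota> x = integral {a..b} (\<lambda>t. evUs (dt v) t x)"
  proof (rule weak_derivative_FTC[OF dual_integrable _ _ T_pos assms])
    show "continuous_on {0..T} (\<lambda>t. tr v t \<bullet> \<iota> x)" by (intro continuous_intros continuous_trace)
    fix \<phi> \<phi>' assume test: "test_function T \<phi> \<phi>'"
    then have c': "continuous_on UNIV \<phi>'" by (simp add: test_function_def)
    have 1: "integrable M (\<lambda>t. (trc v t \<bullet> \<iota> x) * \<phi>' t)"
      by (intro integrable_time_continuous continuous_intros continuous_trace c')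
    have "(\<integral>t. (tr v t \<bullet> \<iota> x) * \<phi>' t \<partial>M) = (\<integral>t. (trc v t \<bullet> \<iota> x) * \<phi>' t \<partial>M)"
      by (rule Bochner_Integration.integral_cong) (auto simp: clamp_time_id)
    also have "\<dots> = (\<integral>t. (\<iota> (evU (emb v) t) \<bullet> \<iota> x) * \<phi>' t \<partial>M)"
    proof (rule integral_cong_AE)
      have "integrable M (\<lambda>t. \<iota> (evU (emb v) t) \<bullet> (\<phi>' t *\<^sub>R \<iota> x))"
        by (rule square_integrable_product(1)[OF square_integrable_bounded_linear[OF
              square_integrable_ev(1) blinfun.bounded_linear_right] square_integrable_continuous
              bounded_bilinear_inner Cauchy_Schwarz_ineq2])
          (intro continuous_intros c')
      then show "(\<lambda>t. (\<iota> (evU (emb v) t) \<bullet> \<iota> x) * \<phi>' t) \<in> borel_measurable M"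
        by (simp add: mult.commute)
      show "AE t in M. (trc v t \<bullet> \<iota> x) * \<phi>' t = (\<iota> (evU (emb v) t) \<bullet> \<iota> x) * \<phi>' t"
        using trace_AE[of v] by eventually_elim simp
    qed (use 1 in auto)
    also have "\<dots> = - (\<integral>t. evUs (dt v) t x * \<phi> t \<partial>M)"
      using space_V test unfolding solution_space_def weak_derivative_def by blast
    finally show "(\<integral>t. (tr v t \<bullet> \<iota> x) * \<phi>' t \<partial>M) = - (\<integral>t. evUs (dt v) t x * \<phi> t \<partial>M)" .
  qed
  then show ?thesis by (simp add: inner_diff_left)
qed

text \<open>
  A monotone continuous function of time that controls the increments of the trace; the integral of
  its own increments telescopes, which keeps the difference quotients bounded as \<open>d\<close> tends to 0.
\<close>

definition derivative_energy :: "'v \<Rightarrow> real \<Rightarrow> real" where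
  "derivative_energy v t = integral {0..t} (\<lambda>s. (norm (evUs (dt v) s))\<^sup>2)"

lemma derivative_energy_integrable: "(\<lambda>s. (norm (evUs (dt v) s))\<^sup>2) integrable_on {0..T}"
  using time_integral[of T "\<lambda>s. (norm (evUs (dt v) s))\<^sup>2"] square_integrable_ev(2)[of "dt v"]
  unfolding square_integrable_def by blast

lemma derivative_energy_diff:
  assumes "0 \<le> a" "a \<le> b" "b \<le> T"
  shows "integral {a..b} (\<lambda>s. (norm (evUs (dt v) s))\<^sup>2) = derivative_energy v b - derivative_energy v a"
  using Henstock_Kurzweil_Integration.integral_combine[OF assms(1,2)
      integrable_on_subinterval[OF derivative_energy_integrable[of v]]] assms
  by (simp add: derivative_energy_def)

lemma derivative_energy_mono:
  assumes "0 \<le> a" "a \<le> b" "b \<le> T"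
  shows "derivative_energy v a \<le> derivative_energy v b"
proof -
  have "0 \<le> integral {a..b} (\<lambda>s. (norm (evUs (dt v) s))\<^sup>2)"
    by (rule Henstock_Kurzweil_Integration.integral_nonneg)
      (use integrable_on_subinterval[OF derivative_energy_integrable[of v]] assms in auto)
  then show ?thesis using derivative_energy_diff[OF assms] by simp
qed

lemma derivative_energy_ends: "derivative_energy v 0 = 0" "derivative_energy v T = (norm (dt v))\<^sup>2"
proof -
  show "derivative_energy v 0 = 0" by (simp add: derivative_energy_def)
  have "integrable M (\<lambda>s. (norm (evUs (dt v) s))\<^sup>2)"
    using square_integrable_ev(2)[of "dt v"] by (simp add: square_integrable_def)
  from time_integral[OF this] show "derivative_energy v T = (norm (dt v))\<^sup>2"
    by (simp add: derivative_energy_def norm_square_ev integral_unique)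
qed

text \<open>
  Young's inequality under the integral, instead of Cauchy--Schwarz, keeps the bound additive in the
  energy.
\<close>

lemma trace_increment_bound:
  assumes "0 \<le> a" "a \<le> b" "b \<le> T"
  shows "\<bar>(tr v b - tr v a) \<bullet> \<iota> x\<bar> \<le> ((b - a) * (norm x)\<^sup>2 + (derivative_energy v b - derivative_energy v a)) / 2"
proof -
  have sub: "k integrable_on {a..b}" if "k integrable_on {0..T}" for k :: "real \<Rightarrow> real"
    using integrable_on_subinterval[OF that] assms by auto
  have en: "(\<lambda>s. (norm (evUs (dt v) s))\<^sup>2) integrable_on {a..b}"
    by (rule sub[OF derivative_energy_integrable])
  have "norm (integral {a..b} (\<lambda>t. evUs (dt v) t x)) \<le> integral {a..b} (\<lambda>t. ((norm x)\<^sup>2 + (norm (evUs (dt v) t))\<^sup>2) / 2)"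
  proof (rule integral_norm_bound_integral)
    show "(\<lambda>t. evUs (dt v) t x) integrable_on {a..b}"
      using time_integral[OF dual_integrable] by (blast intro: sub)
    show "(\<lambda>t. ((norm x)\<^sup>2 + (norm (evUs (dt v) t))\<^sup>2) / 2) integrable_on {a..b}"
      by (intro integrable_on_divide integrable_add en integrable_const_ivl)
    show "norm (evUs (dt v) t x) \<le> ((norm x)\<^sup>2 + (norm (evUs (dt v) t))\<^sup>2) / 2" for t
      using abs_dual_pairing_le[of "evUs (dt v) t" x] sum_squares_bound[of "norm (evUs (dt v) t)" "norm x"]
      by (simp add: mult.assoc)
  qed
  also have "\<dots> = (integral {a..b} (\<lambda>t. (norm x)\<^sup>2) + integral {a..b} (\<lambda>t. (norm (evUs (dt v) t))\<^sup>2)) / 2"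
    by (simp add: Henstock_Kurzweil_Integration.integral_add[OF integrable_const_ivl en])
  also have "\<dots> = ((b - a) * (norm x)\<^sup>2 + (derivative_energy v b - derivative_energy v a)) / 2"
    using assms by (simp add: derivative_energy_diff[OF assms])
  finally show ?thesis using assms by (simp add: trace_increment)
qed

text \<open>
  At \<open>d = 0\<close> the division by zero gives the value 0, so the bounds below hold for every \<open>d\<close>.
\<close>

definition diff_quotient :: "'v \<Rightarrow> real \<Rightarrow> 'uu \<Rightarrow> real" where
  "diff_quotient v d w = (\<integral>t. (trc v (t + d) - trc v t) \<bullet> \<iota> (evU w t) \<partial>M) / d"

lemma shifted_trace_continuous: "continuous_on UNIV (\<lambda>t. trc v (t + d))"
  by (rule continuous_on_compose2[OF continuous_trace(2)]) (auto intro!: continuous_intros)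

lemma diff_quotient_integrable: "integrable M (\<lambda>t. (trc v (t + d) - trc v t) \<bullet> \<iota> (evU w t))"
  by (rule square_integrable_product(1)[OF square_integrable_continuous
        square_integrable_bounded_linear[OF square_integrable_ev(1) blinfun.bounded_linear_right]
        bounded_bilinear_inner Cauchy_Schwarz_ineq2])
    (intro continuous_intros shifted_trace_continuous continuous_trace)

lemma linear_diff_quotient: "linear (diff_quotient v d)"
proof (rule linearI)
  fix w1 w2
  let ?z = "\<lambda>t. trc v (t + d) - trc v t"
  have "(\<integral>t. ?z t \<bullet> \<iota> (evU (w1 + w2) t) \<partial>M) = (\<integral>t. ?z t \<bullet> \<iota> (evU w1 t) + ?z t \<bullet> \<iota> (evU w2 t) \<partial>M)"
  proof (rule integral_cong_AE)
    show "AE t in M. ?z t \<bullet> \<iota> (evU (w1 + w2) t) = ?z t \<bullet> \<iota> (evU w1 t) + ?z t \<bullet> \<iota> (evU w2 t)"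
      using ev_linear(1)[of w1 w2] by eventually_elim (simp add: blinfun.add_right inner_add_right)
  qed (intro borel_measurable_integrable Bochner_Integration.integrable_add diff_quotient_integrable)+
  then show "diff_quotient v d (w1 + w2) = diff_quotient v d w1 + diff_quotient v d w2"
    by (simp add: diff_quotient_def diff_quotient_integrable add_divide_distrib)
next
  fix c w
  let ?z = "\<lambda>t. trc v (t + d) - trc v t"
  have "(\<integral>t. ?z t \<bullet> \<iota> (evU (c *\<^sub>R w) t) \<partial>M) = (\<integral>t. c * (?z t \<bullet> \<iota> (evU w t)) \<partial>M)"
  proof (rule integral_cong_AE)
    show "AE t in M. ?z t \<bullet> \<iota> (evU (c *\<^sub>R w) t) = c * (?z t \<bullet> \<iota> (evU w t))"
      using ev_linear(2)[of c w] by eventually_elim (simp add: blinfun.scaleR_right)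
  qed (intro borel_measurable_integrable Bochner_Integration.integrable_mult_right diff_quotient_integrable)+
  then show "diff_quotient v d (c *\<^sub>R w) = c *\<^sub>R diff_quotient v d w"
    by (simp add: diff_quotient_def diff_quotient_integrable)
qed

lemma trace_increment_bound_signed:
  assumes d: "d \<noteq> 0" and t: "t \<in> {0..T}"
  shows "\<bar>(trc v (t + d) - trc v t) \<bullet> \<iota> x\<bar> \<le>
    (\<bar>d\<bar> * (norm x)\<^sup>2 + sgn d * (derivative_energy v (clamp_time T (t + d)) - derivative_energy v (clamp_time T t))) / 2"
proof -
  let ?p = "clamp_time T (t + d)"
  have ct: "clamp_time T t = t" using t by (rule clamp_time_id)
  have p: "0 \<le> ?p" "?p \<le> T" using T_pos by (auto simp: clamp_time_def)
  have close: "\<bar>?p - t\<bar> \<le> \<bar>d\<bar>" using t by (auto simp: clamp_time_def)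
  show ?thesis
  proof (cases "d > 0")
    case True
    then have le: "t \<le> ?p" using t by (auto simp: clamp_time_def)
    have "(?p - t) * (norm x)\<^sup>2 \<le> \<bar>d\<bar> * (norm x)\<^sup>2" using close by (intro mult_right_mono) auto
    then show ?thesis using trace_increment_bound[OF _ le p(2), of v x] t True by (simp add: ct)
  next
    case False
    then have le: "?p \<le> t" using t by (auto simp: clamp_time_def)
    have "(t - ?p) * (norm x)\<^sup>2 \<le> \<bar>d\<bar> * (norm x)\<^sup>2" using close by (intro mult_right_mono) auto
    moreover have "\<bar>(tr v ?p - tr v t) \<bullet> \<iota> x\<bar> = \<bar>(tr v t - tr v ?p) \<bullet> \<iota> x\<bar>"
      by (simp add: inner_diff_left)
    ultimately show ?thesis using trace_increment_bound[OF p(1) le, of v x] t False d by (simp add: ct)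
  qed
qed

text \<open>
  The pointwise increment bound leaves the integral of \<open>e (t + d) - e t\<close> for the energy \<open>e\<close>, which in
  terms of an antiderivative \<open>Q\<close> of \<open>e\<close> is a difference of two increments of \<open>Q\<close> of length \<open>d\<close>. As \<open>e\<close>
  takes values between 0 and \<open>(norm (dt v))\<^sup>2\<close>, it is of order \<open>d\<close>.
\<close>

lemma diff_quotient_le_squares: "\<bar>diff_quotient v d w\<bar> \<le> ((norm w)\<^sup>2 + (norm (dt v))\<^sup>2) / 2"
proof (cases "d = 0")
  case True
  then show ?thesis by (simp add: diff_quotient_def)
next
  case False
  let ?e = "\<lambda>t. derivative_energy v (clamp_time T t)"
  let ?N = "(norm (dt v))\<^sup>2"
  have e_cont: "continuous_on UNIV ?e"
    unfolding derivative_energy_def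
    by (rule continuous_on_clamp_time[OF indefinite_integral_continuous_1[OF derivative_energy_integrable] T_pos])
  have e_bounds: "0 \<le> ?e t" "?e t \<le> ?N" for t
    using derivative_energy_mono[of 0 "clamp_time T t" v] derivative_energy_mono[of "clamp_time T t" T v]
      derivative_energy_ends[of v] T_pos by (auto simp: clamp_time_def)
  obtain Q where Q: "\<And>t. (Q has_real_derivative ?e t) (at t)"
      "\<And>a b. a \<le> b \<Longrightarrow> (?e has_integral (Q b - Q a)) {a..b}"
    using continuous_real_antiderivative[OF e_cont] by blast
  have Q_bounds: "0 \<le> Q b - Q a" "Q b - Q a \<le> ?N * (b - a)" if "a \<le> b" for a b
    using has_integral_nonneg[OF Q(2)[OF that]] e_bounds
      has_integral_le[OF Q(2)[OF that] has_integral_const_real[of ?N a b]] that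
    by (auto simp: mult.commute)
  have e_shift: "continuous_on UNIV (\<lambda>t. ?e (t + d))"
    by (rule continuous_on_compose2[OF e_cont]) (auto intro!: continuous_intros)
  have int_e: "integrable M (\<lambda>t. ?e (t + d) - ?e t)"
    by (intro integrable_time_continuous continuous_intros e_cont e_shift)
  have "((\<lambda>t. ?e (t + d) - ?e t) has_integral ((Q (T + d) - Q (0 + d)) - (Q T - Q 0))) {0..T}"
    using T_pos by (intro has_integral_diff shifted_antiderivative_integral Q) auto
  then have I: "(\<integral>t. ?e (t + d) - ?e t \<partial>M) = (Q (T + d) - Q d) - (Q T - Q 0)"
    using has_integral_unique[OF time_integral[OF int_e]] by simp
  have sI: "sgn d * (\<integral>t. ?e (t + d) - ?e t \<partial>M) \<le> \<bar>d\<bar> * ?N"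
  proof (cases "d > 0")
    case True
    then show ?thesis using Q_bounds[of T "T + d"] Q_bounds[of 0 d] by (simp add: I mult.commute)
  next
    case neg: False
    then have "sgn d = -1" using False by simp
    then show ?thesis using Q_bounds[of "T + d" T] Q_bounds[of d 0] neg by (simp add: I mult.commute)
  qed
  have w2: "integrable M (\<lambda>t. (norm (evU w t))\<^sup>2)"
    using square_integrable_ev(1) by (simp add: square_integrable_def)
  have bi: "integrable M (\<lambda>t. (\<bar>d\<bar> * (norm (evU w t))\<^sup>2 + sgn d * (?e (t + d) - ?e t)) / 2)"
    using w2 int_e by simp
  have "\<bar>\<integral>t. (trc v (t + d) - trc v t) \<bullet> \<iota> (evU w t) \<partial>M\<bar>
      \<le> (\<integral>t. \<bar>(trc v (t + d) - trc v t) \<bullet> \<iota> (evU w t)\<bar> \<partial>M)"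
    by (rule integral_abs_bound)
  also have "\<dots> \<le> (\<integral>t. (\<bar>d\<bar> * (norm (evU w t))\<^sup>2 + sgn d * (?e (t + d) - ?e t)) / 2 \<partial>M)"
    using diff_quotient_integrable[of v d w] bi
    by (intro integral_mono trace_increment_bound_signed False) auto
  also have "\<dots> = (\<bar>d\<bar> * (norm w)\<^sup>2 + sgn d * (\<integral>t. ?e (t + d) - ?e t \<partial>M)) / 2"
  proof -
    have "(\<integral>t. (\<bar>d\<bar> * (norm (evU w t))\<^sup>2 + sgn d * (?e (t + d) - ?e t)) / 2 \<partial>M)
        = ((\<integral>t. \<bar>d\<bar> * (norm (evU w t))\<^sup>2 \<partial>M) + (\<integral>t. sgn d * (?e (t + d) - ?e t) \<partial>M)) / 2"
      using Bochner_Integration.integral_add[OF integrable_mult_right[OF w2, of "\<bar>d\<bar>"] integrable_mult_right[OF int_e, of "sgn d"]]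
      by (simp only: integral_divide_zero)
    then show ?thesis by (simp only: integral_mult_right_zero norm_square_ev)
  qed
  also have "\<dots> \<le> \<bar>d\<bar> * (((norm w)\<^sup>2 + ?N) / 2)"
    using sI by (simp add: distrib_left)
  finally show ?thesis using False by (simp add: diff_quotient_def abs_mult field_simps)
qed

lemma diff_quotient_bound: "\<bar>diff_quotient v d w\<bar> \<le> ((1 + (norm (dt v))\<^sup>2) / 2) * norm w"
proof (cases "w = 0")
  case True
  then show ?thesis by (simp add: linear_0[OF linear_diff_quotient])
next
  case False
  have "diff_quotient v d w = norm w * diff_quotient v d ((1 / norm w) *\<^sub>R w)"
    using False by (simp add: linear_cmul[OF linear_diff_quotient])
  then have "\<bar>diff_quotient v d w\<bar> = norm w * \<bar>diff_quotient v d ((1 / norm w) *\<^sub>R w)\<bar>"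
    by (simp add: abs_mult)
  also have "\<dots> \<le> norm w * ((1 + (norm (dt v))\<^sup>2) / 2)"
    using diff_quotient_le_squares[of v d "(1 / norm w) *\<^sub>R w"] False
    by (intro mult_left_mono) auto
  finally show ?thesis by (simp add: mult.commute)
qed

text \<open>
  On a step function the integral of the increments of the trace is a difference of increments of an
  antiderivative at the two ends of the step; the quotient converges by the definition of the
  derivative.
\<close>

lemma diff_quotient_tendsto_step:
  assumes w: "w \<in> step_elements"
  shows "((\<lambda>d. diff_quotient v d w) \<longlongrightarrow> pairing (dt v) w) (at 0)"
proof -
  obtain a b x where ab: "0 \<le> a" "a < b" "b \<le> T"
    and ae: "AE t in M. evU w t = indicator {a<..<b} t *\<^sub>R x"
    using w by (auto simp: step_elements_def)
  let ?m = "\<lambda>t. trc v t \<bullet> \<iota> x"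
  have m: "continuous_on UNIV ?m" by (intro continuous_intros continuous_trace)
  obtain K where K: "\<And>t. (K has_real_derivative ?m t) (at t)"
      "\<And>a b. a \<le> b \<Longrightarrow> (?m has_integral (K b - K a)) {a..b}"
    using continuous_real_antiderivative[OF m] by blast
  have Sm: "{a<..<b} \<in> sets M"
    using ab by (auto simp: sets_restrict_space intro!: image_eqI[where x = "{a<..<b}"])
  have "diff_quotient v d w = (K (b + d) - K b) / d - (K (a + d) - K a) / d" for d
  proof -
    have int: "integrable M (\<lambda>t. ?m (t + d) - ?m t)"
      by (intro integrable_time_continuous continuous_intros shifted_trace_continuous continuous_trace)
    have "(\<integral>t. (trc v (t + d) - trc v t) \<bullet> \<iota> (evU w t) \<partial>M) = (\<integral>t. indicator {a<..<b} t * (?m (t + d) - ?m t) \<partial>M)"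
    proof (rule integral_cong_AE)
      show "AE t in M. (trc v (t + d) - trc v t) \<bullet> \<iota> (evU w t) = indicator {a<..<b} t * (?m (t + d) - ?m t)"
        using ae by eventually_elim (simp add: blinfun.scaleR_right inner_diff_left)
      show "(\<lambda>t. (trc v (t + d) - trc v t) \<bullet> \<iota> (evU w t)) \<in> borel_measurable M"
        by (rule borel_measurable_integrable[OF diff_quotient_integrable])
      show "(\<lambda>t. indicator {a<..<b} t * (?m (t + d) - ?m t)) \<in> borel_measurable M"
        by (rule borel_measurable_times[OF borel_measurable_indicator[OF Sm] borel_measurable_integrable[OF int]])
    qed
    also have "\<dots> = integral {a..b} (\<lambda>t. ?m (t + d) - ?m t)"
      by (rule integral_indicator_time[OF int ab(1,3)])
    also have "\<dots> = (K (b + d) - K (a + d)) - (K b - K a)"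
      using ab by (intro integral_unique has_integral_diff shifted_antiderivative_integral[OF K(1)] K(2)) auto
    finally show ?thesis by (simp add: diff_quotient_def diff_divide_distrib)
  qed
  moreover have "((\<lambda>d. (K (b + d) - K b) / d - (K (a + d) - K a) / d) \<longlongrightarrow> ?m b - ?m a) (at 0)"
    by (intro tendsto_diff DERIV_difference_quotient K)
  moreover have "?m b - ?m a = pairing (dt v) w"
  proof -
    have "AE t in M. evUs (dt v) t (evU w t) = indicator {a<..<b} t * evUs (dt v) t x"
      using ae by eventually_elim (simp add: blinfun.scaleR_right)
    moreover have "integrable M (\<lambda>t. indicator {a<..<b} t * evUs (dt v) t x)"
      using integrable_mult_indicator[OF Sm dual_integrable] by simp
    ultimately have "pairing (dt v) w = (\<integral>t. indicator {a<..<b} t * evUs (dt v) t x \<partial>M)"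
      by (rule pairing_cong_AE)
    also have "\<dots> = integral {a..b} (\<lambda>t. evUs (dt v) t x)"
      by (rule integral_indicator_time[OF dual_integrable ab(1,3)])
    finally show ?thesis using trace_increment[of a b v x] ab by (simp add: clamp_time_id inner_diff_left)
  qed
  ultimately show ?thesis by simp
qed

lemma diff_quotient_tendsto: "((\<lambda>d. diff_quotient v d w) \<longlongrightarrow> pairing (dt v) w) (at 0)"
  by (rule tendsto_functionals_of_total_set[OF linear_diff_quotient diff_quotient_bound
        pairing.bounded_linear_right step_elements_total diff_quotient_tendsto_step])

lemma diff_quotient_emb:
  "diff_quotient v d (emb w) = integral {0..T} (\<lambda>t. (trc v (t + d) - trc v t) \<bullet> trc w t) / d"
proof -
  have c: "integrable M (\<lambda>t. (trc v (t + d) - trc v t) \<bullet> trc w t)"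
    by (intro integrable_time_continuous continuous_intros shifted_trace_continuous continuous_trace)
  have "(\<integral>t. (trc v (t + d) - trc v t) \<bullet> \<iota> (evU (emb w) t) \<partial>M) = (\<integral>t. (trc v (t + d) - trc v t) \<bullet> trc w t \<partial>M)"
  proof (rule integral_cong_AE)
    show "AE t in M. (trc v (t + d) - trc v t) \<bullet> \<iota> (evU (emb w) t) = (trc v (t + d) - trc v t) \<bullet> trc w t"
      using trace_AE[of w] by eventually_elim simp
  qed (intro borel_measurable_integrable diff_quotient_integrable c)+
  then show ?thesis using time_integral[OF c] by (simp add: diff_quotient_def integral_unique)
qed

text \<open>
  With the traces extended constantly beyond the interval, let \<open>q t\<close> be the inner product of the trace
  of \<open>v\<close> at \<open>t + d\<close> and the trace of \<open>w\<close> at \<open>t\<close>. The forward quotient of \<open>v\<close> against \<open>w\<close> plus the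
  backward quotient of \<open>w\<close> against \<open>v\<close> equals the integral of \<open>q t - q (t - d)\<close>, divided by \<open>d\<close>. Only
  the integrals of \<open>q\<close> over \<open>{T - d..T}\<close> and \<open>{- d..0}\<close> survive; there one factor is constantly equal
  to an end value, and the limit is the boundary term.
\<close>

theorem integration_by_parts:
  "pairing (dt v) (emb w) + pairing (dt w) (emb v) = tr v T \<bullet> tr w T - tr v 0 \<bullet> tr w 0"
proof -
  have c: "continuous_on UNIV (\<lambda>t. tr v T \<bullet> trc w t)" "continuous_on UNIV (\<lambda>t. trc v t \<bullet> tr w 0)"
    by (intro continuous_intros continuous_trace)+
  obtain Y where Y: "\<And>t. (Y has_real_derivative tr v T \<bullet> trc w t) (at t)"
      "\<And>a b. a \<le> b \<Longrightarrow> ((\<lambda>t. tr v T \<bullet> trc w t) has_integral (Y b - Y a)) {a..b}"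
    using continuous_real_antiderivative[OF c(1)]
    by blast
  obtain Z where Z: "\<And>t. (Z has_real_derivative trc v t \<bullet> tr w 0) (at t)"
      "\<And>a b. a \<le> b \<Longrightarrow> ((\<lambda>t. trc v t \<bullet> tr w 0) has_integral (Z b - Z a)) {a..b}"
    using continuous_real_antiderivative[OF c(2)] by blast
  have telescoped: "diff_quotient v d (emb w) + diff_quotient w (- d) (emb v)
      = (Y (T + (- d)) - Y T) / (- d) - (Z (0 + d) - Z 0) / d" if d: "d > 0" for d
  proof -
    let ?q = "\<lambda>t. trc v (t + d) \<bullet> trc w t"
    have q: "continuous_on UNIV ?q"
      by (intro continuous_intros shifted_trace_continuous continuous_trace)
    obtain Q where Q: "\<And>t. (Q has_real_derivative ?q t) (at t)"
        "\<And>a b. a \<le> b \<Longrightarrow> (?q has_integral (Q b - Q a)) {a..b}"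
      using continuous_real_antiderivative[OF q] by blast
    have vw: "(\<lambda>t. trc v t \<bullet> trc w t) integrable_on {0..T}"
      by (rule integrable_continuous_real) (intro continuous_intros continuous_on_subset[OF continuous_trace(2)], auto)
    have 1: "integral {0..T} (\<lambda>t. (trc v (t + d) - trc v t) \<bullet> trc w t)
        = (Q T - Q 0) - integral {0..T} (\<lambda>t. trc v t \<bullet> trc w t)"
      unfolding inner_diff_left
      using T_pos by (intro integral_unique has_integral_diff Q(2) integrable_integral vw) auto
    have shifted: "((\<lambda>t. trc w (t + (- d)) \<bullet> trc v t) has_integral (Q (T - d) - Q (- d))) {0..T}"
      using shifted_antiderivative_integral[of Q ?q 0 T "- d", OF Q(1)] T_pos by (simp add: inner_commute)
    have 2: "integral {0..T} (\<lambda>t. (trc w (t + (- d)) - trc w t) \<bullet> trc v t)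
        = (Q (T - d) - Q (- d)) - integral {0..T} (\<lambda>t. trc v t \<bullet> trc w t)"
      unfolding inner_diff_left
      using has_integral_diff[OF shifted integrable_integral[OF vw]]
      by (simp add: integral_unique inner_commute)
    \<comment> \<open>on \<open>{T - d..T}\<close> the shifted trace of \<open>v\<close> equals \<open>tr v T\<close>\<close>
    have right: "Q T - Q (T - d) = Y T - Y (T - d)"
    proof (rule has_integral_unique)
      show "(?q has_integral (Q T - Q (T - d))) {T - d..T}" using d by (intro Q) simp
      show "(?q has_integral (Y T - Y (T - d))) {T - d..T}"
      proof (rule has_integral_eq[rotated])
        show "((\<lambda>t. tr v T \<bullet> trc w t) has_integral (Y T - Y (T - d))) {T - d..T}" using d by (intro Y) simp
        show "tr v T \<bullet> trc w t = ?q t" if "t \<in> {T - d..T}" for t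
        proof -
          have "clamp_time T (t + d) = T" using that T_pos by (auto simp: clamp_time_def)
          then show ?thesis by simp
        qed
      qed
    qed
    \<comment> \<open>on \<open>{- d..0}\<close> the trace of \<open>w\<close> equals \<open>tr w 0\<close>\<close>
    have left: "Q 0 - Q (- d) = Z d - Z 0"
    proof (rule has_integral_unique)
      show "(?q has_integral (Q 0 - Q (- d))) {- d..0}" using d by (intro Q) simp
      show "(?q has_integral (Z d - Z 0)) {- d..0}"
      proof (rule has_integral_eq[rotated])
        show "((\<lambda>t. trc v (t + d) \<bullet> tr w 0) has_integral (Z d - Z 0)) {- d..0}"
          using shifted_antiderivative_integral[of Z "\<lambda>t. trc v t \<bullet> tr w 0" "- d" 0 d, OF Z(1)] d by simp
        show "trc v (t + d) \<bullet> tr w 0 = ?q t" if "t \<in> {- d..0}" for t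
        proof -
          have "clamp_time T t = 0" using that T_pos by (auto simp: clamp_time_def)
          then show ?thesis by simp
        qed
      qed
    qed
    have "diff_quotient v d (emb w) + diff_quotient w (- d) (emb v)
        = ((Q T - Q (T - d)) - (Q 0 - Q (- d))) / d"
      using d unfolding diff_quotient_emb 1 2 by (simp add: field_simps)
    then show ?thesis unfolding right left by (simp add: diff_divide_distrib)
  qed
  have flip: "LIM d at_right 0. - d :> at (0::real)"
    unfolding filterlim_at by (auto intro!: tendsto_eq_intros simp: eventually_at_filter)
  have sub: "at_right 0 \<le> at (0::real)" by (rule at_le) simp
  have lhs: "((\<lambda>d. diff_quotient v d (emb w) + diff_quotient w (- d) (emb v)) \<longlongrightarrow>
      pairing (dt v) (emb w) + pairing (dt w) (emb v)) (at_right 0)"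
    by (intro tendsto_add tendsto_mono[OF sub diff_quotient_tendsto]
        filterlim_compose[OF diff_quotient_tendsto flip])
  have rhs: "((\<lambda>d. (Y (T + (- d)) - Y T) / (- d) - (Z (0 + d) - Z 0) / d) \<longlongrightarrow>
      tr v T \<bullet> trc w T - trc v 0 \<bullet> tr w 0) (at_right 0)"
    by (intro tendsto_diff filterlim_compose[OF DERIV_difference_quotient[OF Y(1)] flip]
        tendsto_mono[OF sub DERIV_difference_quotient[OF Z(1)]])
  have ev: "\<forall>\<^sub>F d in at_right 0. (Y (T + (- d)) - Y T) / (- d) - (Z (0 + d) - Z 0) / d
      = diff_quotient v d (emb w) + diff_quotient w (- d) (emb v)"
    unfolding eventually_at_right_field using telescoped by (intro exI[of _ 1]) auto
  have "pairing (dt v) (emb w) + pairing (dt w) (emb v) = tr v T \<bullet> trc w T - trc v 0 \<bullet> tr w 0"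
    by (rule tendsto_unique[OF _ lhs Lim_transform_eventually[OF rhs ev]]) simp
  then show ?thesis using T_pos by (simp add: clamp_time_id)
qed

end

section \<open>The error of the approximate adjoint\<close>

context evolution_space
begin

lemma bounded_linear_emb_dt: "bounded_linear emb" "bounded_linear dt"
proof -
  have lin: "linear emb" "linear dt" and ip: "\<And>v. v \<bullet> v = emb v \<bullet> emb v + dt v \<bullet> dt v"
    using space_V unfolding solution_space_def by blast+
  have "(norm (emb v))\<^sup>2 \<le> (norm v)\<^sup>2" "(norm (dt v))\<^sup>2 \<le> (norm v)\<^sup>2" for v
    using ip[of v] by (simp_all add: power2_norm_eq_inner)
  then have le: "norm (emb v) \<le> norm v" "norm (dt v) \<le> norm v" for v
    using power2_le_imp_le norm_ge_zero by blast+
  show "bounded_linear emb"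
    by (rule bounded_linear_intro[where K = 1]) (use lin le in \<open>auto simp: linear_add linear_cmul\<close>)
  show "bounded_linear dt"
    by (rule bounded_linear_intro[where K = 1]) (use lin le in \<open>auto simp: linear_add linear_cmul\<close>)
qed

text \<open>
  Integration by parts moves the time derivative from the adjoint state to \<open>w\<close>; the boundary term at
  \<open>T\<close> vanishes by the terminal condition.
\<close>

lemma adjoint_equation_duality:
  assumes "adjoint_equation T evUs evU emb dt tr B h z"
  shows "pairing h (emb w) - pairing (dt w) (emb z) - pairing (blinfun_apply B (emb w)) (emb z) = tr z 0 \<bullet> tr w 0"
proof -
  have h: "h = - dt z + L2_adjoint T evUs evU B (emb z)" and "tr z T = 0"
    using assms by (auto simp: adjoint_equation_def)
  then show ?thesis
    using integration_by_parts[of z w]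
    by (simp add: h pairing.diff_left pairing_L2_adjoint)
qed

text \<open>
  The left-hand side of \<open>adjoint_equation_duality\<close> is a bounded functional of \<open>w\<close>, and on the states
  \<open>S x\<close> it equals the linear function \<open>tr z 0 \<bullet> A x\<close>. Differentiating this identity in \<open>x\<close> gives the
  boundary term for the linearized state although \<open>w \<mapsto> tr w 0\<close> is not known to be continuous.
  Differentiating the state equation then replaces the time derivative of the linearized state.
\<close>

lemma linearized_state_duality:
  fixes S :: "'x::real_normed_vector \<Rightarrow> 'v" and f :: "'x \<Rightarrow> 'v \<Rightarrow> 'us"
    and A :: "'x \<Rightarrow>\<^sub>L 'h" and f\<theta> :: "'x \<Rightarrow>\<^sub>L 'us" and fu :: "'uu \<Rightarrow>\<^sub>L 'us"
  assumes S: "(S has_derivative S') (at x)"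
    and f: "((\<lambda>(x, v). f x v) has_derivative
      (\<lambda>(h, w). blinfun_apply f\<theta> h + blinfun_apply fu (emb w))) (at (x, S x))"
    and solves: "\<And>x. dt (S x) + f x (S x) = 0" "\<And>x. tr (S x) 0 = blinfun_apply A x"
    and z: "adjoint_equation T evUs evU emb dt tr B h z"
  shows "pairing h (emb (S' k)) = pairing (blinfun_apply (B - fu) (emb (S' k))) (emb z)
    - pairing (blinfun_apply f\<theta> k) (emb z) + tr z 0 \<bullet> blinfun_apply A k"
proof -
  let ?\<Phi> = "\<lambda>v. pairing h (emb v) - pairing (dt v) (emb z) - pairing (blinfun_apply B (emb v)) (emb z)"
  have "bounded_linear ?\<Phi>"
    by (intro bounded_linear_sub bounded_linear_compose[OF pairing.bounded_linear_right bounded_linear_emb_dt(1)]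
        bounded_linear_compose[OF pairing.bounded_linear_left bounded_linear_emb_dt(2)]
        bounded_linear_compose[OF pairing.bounded_linear_left
          bounded_linear_compose[OF blinfun.bounded_linear_right bounded_linear_emb_dt(1)]])
  from bounded_linear.has_derivative[OF this S]
  have d1: "((\<lambda>x. ?\<Phi> (S x)) has_derivative (\<lambda>k. ?\<Phi> (S' k))) (at x)" .
  have "(\<lambda>x. ?\<Phi> (S x)) = (\<lambda>x. tr z 0 \<bullet> blinfun_apply A x)"
    using adjoint_equation_duality[OF z] solves(2) by simp
  moreover have "((\<lambda>x. tr z 0 \<bullet> blinfun_apply A x) has_derivative (\<lambda>k. tr z 0 \<bullet> blinfun_apply A k)) (at x)"
    by (intro bounded_linear.has_derivative[OF bounded_linear_inner_right]
        blinfun.bounded_linear_right[THEN bounded_linear_imp_has_derivative])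
  ultimately have "(\<lambda>k. ?\<Phi> (S' k)) = (\<lambda>k. tr z 0 \<bullet> blinfun_apply A k)"
    using has_derivative_unique[OF d1] by simp
  then have \<Phi>: "?\<Phi> (S' k) = tr z 0 \<bullet> blinfun_apply A k" by (rule fun_cong)
  have pair: "((\<lambda>x. (x, S x)) has_derivative (\<lambda>k. (k, S' k))) (at x)"
    by (intro has_derivative_Pair has_derivative_ident S)
  have "((\<lambda>x. f x (S x)) has_derivative (\<lambda>k. blinfun_apply f\<theta> k + blinfun_apply fu (emb (S' k)))) (at x)"
    using has_derivative_compose[OF pair f] by simp
  then have "((\<lambda>x. dt (S x) + f x (S x)) has_derivative
      (\<lambda>k. dt (S' k) + (blinfun_apply f\<theta> k + blinfun_apply fu (emb (S' k))))) (at x)"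
    by (intro has_derivative_add bounded_linear.has_derivative[OF bounded_linear_emb_dt(2) S])
  then have "((\<lambda>x. 0) has_derivative
      (\<lambda>k. dt (S' k) + (blinfun_apply f\<theta> k + blinfun_apply fu (emb (S' k))))) (at x)"
    by (simp add: solves(1))
  from has_derivative_unique[OF this has_derivative_const]
  have "dt (S' k) + (blinfun_apply f\<theta> k + blinfun_apply fu (emb (S' k))) = 0" by (rule fun_cong)
  then have "dt (S' k) = - (blinfun_apply f\<theta> k + blinfun_apply fu (emb (S' k)))"
    by (rule eq_neg_iff_add_eq_0[THEN iffD2])
  then show ?thesis
    using \<Phi> by (simp add: pairing.minus_left pairing.add_left pairing.diff_left blinfun.diff_left)
qed

text \<open>
  Duality with the adjoint state for the right-hand side \<open>emb (S' k)\<close> itself: the stability of the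
  adjoint equation carries over to the linearized equation.
\<close>

lemma linearized_state_bound:
  fixes S :: "'x::real_normed_vector \<Rightarrow> 'v" and f :: "'x \<Rightarrow> 'v \<Rightarrow> 'us"
    and A :: "'x \<Rightarrow>\<^sub>L 'h" and f\<theta> :: "'x \<Rightarrow>\<^sub>L 'us" and fu :: "'uu \<Rightarrow>\<^sub>L 'us"
  assumes S: "(S has_derivative S') (at x)"
    and f: "((\<lambda>(x, v). f x v) has_derivative
      (\<lambda>(h, w). blinfun_apply f\<theta> h + blinfun_apply fu (emb w))) (at (x, S x))"
    and solves: "\<And>x. dt (S x) + f x (S x) = 0" "\<And>x. tr (S x) 0 = blinfun_apply A x"
    and C: "0 \<le> C"
    and stable: "\<And>h. \<exists>z. adjoint_equation T evUs evU emb dt tr fu h z \<and>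
      norm (emb z) + norm (tr z 0) \<le> C * norm h"
  shows "norm (emb (S' k)) \<le> (norm f\<theta> + norm A) * C * norm k"
proof -
  let ?w = "emb (S' k)"
  obtain z where z: "adjoint_equation T evUs evU emb dt tr fu (L2_riesz T evUs evU ?w) z"
    and zb: "norm (emb z) + norm (tr z 0) \<le> C * norm ?w"
    using stable[of "L2_riesz T evUs evU ?w"] by (auto simp: norm_riesz)
  have "(norm ?w)\<^sup>2 = - pairing (blinfun_apply f\<theta> k) (emb z) + tr z 0 \<bullet> blinfun_apply A k"
    using linearized_state_duality[OF S f solves z, of k]
    by (simp add: pairing_riesz power2_norm_eq_inner pairing.zero_left)
  also have "\<dots> \<le> norm (blinfun_apply f\<theta> k) * norm (emb z) + norm (tr z 0) * norm (blinfun_apply A k)"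
    using abs_pairing_le[of "blinfun_apply f\<theta> k" "emb z"] Cauchy_Schwarz_ineq2[of "tr z 0" "blinfun_apply A k"]
    by linarith
  also have "\<dots> \<le> (norm f\<theta> * norm k) * norm (emb z) + norm (tr z 0) * (norm A * norm k)"
    by (intro add_mono mult_mono norm_blinfun) auto
  also have "\<dots> \<le> (norm f\<theta> + norm A) * norm k * (norm (emb z) + norm (tr z 0))"
    by (simp add: algebra_simps)
  also have "\<dots> \<le> (norm f\<theta> + norm A) * norm k * (C * norm ?w)"
    by (intro mult_left_mono zb) auto
  finally have "norm ?w * norm ?w \<le> ((norm f\<theta> + norm A) * C * norm k) * norm ?w"
    by (simp add: power2_eq_square mult_ac)
  then show ?thesis
    using C by (cases "?w = 0") auto
qed

lemma approx_adjoint_representation: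
  fixes A :: "'x::{real_inner,banach} \<Rightarrow>\<^sub>L 'h" and f\<theta> :: "'x \<Rightarrow>\<^sub>L 'us"
  assumes p: "approx_adjoint T evUs evU emb dt tr C A Bt B v p"
    and slices: "\<And>k. AE t in M. evUs (blinfun_apply f\<theta> k) t = blinfun_apply (Bt t) k"
  obtains z where "adjoint_equation T evUs evU emb dt tr B (L2_riesz T evUs evU v) z"
    and "norm (emb z) + norm (tr z 0) \<le> C * norm v"
    and "\<And>k. p \<bullet> k = - pairing (blinfun_apply f\<theta> k) (emb z) + tr z 0 \<bullet> blinfun_apply A k"
proof -
  obtain z q where z: "adjoint_equation T evUs evU emb dt tr B (L2_riesz T evUs evU v) z"
      "norm (emb z) + norm (tr z 0) \<le> C * norm v"
    and q: "has_weak_integral T (\<lambda>t. inv blinfun_inner_right (bidual (evU (emb z) t) o\<^sub>L Bt t)) q"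
    and p_eq: "p = - q + inv blinfun_inner_right (blinfun_inner_right (tr z 0) o\<^sub>L A)"
    using p unfolding approx_adjoint_def norm_riesz by blast
  have bidual: "blinfun_apply (bidual x) \<psi> = blinfun_apply \<psi> x" for x :: 'u and \<psi>
    unfolding bidual_def
    by (subst bounded_linear_Blinfun_apply) (auto intro: blinfun.bounded_linear_left)
  have "q \<bullet> k = pairing (blinfun_apply f\<theta> k) (emb z)" for k
  proof -
    have hb: "has_bochner_integral M (\<lambda>t. blinfun_apply (blinfun_apply (Bt t) k) (evU (emb z) t)) (q \<bullet> k)"
      using q unfolding has_weak_integral_def
      by (simp add: riesz_isomorphism_inverse bidual)
    have "AE t in M. evUs (blinfun_apply f\<theta> k) t (evU (emb z) t) = blinfun_apply (blinfun_apply (Bt t) k) (evU (emb z) t)"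
      using slices[of k] by eventually_elim simp
    from pairing_cong_AE[OF this] show ?thesis
      using hb by (simp add: has_bochner_integral_iff)
  qed
  then have "p \<bullet> k = - pairing (blinfun_apply f\<theta> k) (emb z) + tr z 0 \<bullet> blinfun_apply A k" for k
    by (simp add: p_eq inner_simps riesz_isomorphism_inverse)
  with z show ?thesis by (rule that)
qed

text \<open>
  Both \<open>p \<bullet> k\<close> and \<open>v \<bullet> emb (S' k)\<close> are expressed through the adjoint state of the perturbed operator
  \<open>fu'\<close>; the terms with the initial value cancel.
\<close>

lemma approx_adjoint_error:
  fixes S :: "'x::{real_inner,banach} \<Rightarrow> 'v" and f :: "'x \<Rightarrow> 'v \<Rightarrow> 'us"
    and A :: "'x \<Rightarrow>\<^sub>L 'h" and f\<theta> f\<theta>' :: "'x \<Rightarrow>\<^sub>L 'us" and fu fu' :: "'uu \<Rightarrow>\<^sub>L 'us"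
  assumes S: "(S has_derivative S') (at x)"
    and f: "((\<lambda>(x, v). f x v) has_derivative
      (\<lambda>(h, w). blinfun_apply f\<theta> h + blinfun_apply fu (emb w))) (at (x, S x))"
    and solves: "\<And>x. dt (S x) + f x (S x) = 0" "\<And>x. tr (S x) 0 = blinfun_apply A x"
    and stable: "\<And>h. \<exists>z. adjoint_equation T evUs evU emb dt tr fu h z \<and>
      norm (emb z) + norm (tr z 0) \<le> C * norm h"
    and C: "0 \<le> C"
    and p: "approx_adjoint T evUs evU emb dt tr C A Bt fu' v p"
    and slices: "\<And>k. AE t in M. evUs (blinfun_apply f\<theta>' k) t = blinfun_apply (Bt t) k"
  shows "\<bar>p \<bullet> k - v \<bullet> emb (S' k)\<bar> \<le>
    (norm (f\<theta> - f\<theta>') + norm (fu - fu')) * C * ((norm f\<theta> + norm A) * C + 1) * (norm v * norm k)"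
proof -
  let ?w = "emb (S' k)" and ?D = "(norm f\<theta> + norm A) * C"
  obtain z where z: "adjoint_equation T evUs evU emb dt tr fu' (L2_riesz T evUs evU v) z"
      "norm (emb z) + norm (tr z 0) \<le> C * norm v"
      "\<And>k. p \<bullet> k = - pairing (blinfun_apply f\<theta>' k) (emb z) + tr z 0 \<bullet> blinfun_apply A k"
    using approx_adjoint_representation[OF p slices] by blast
  have w: "norm ?w \<le> ?D * norm k"
    by (rule linearized_state_bound[OF S f solves C stable])
  have D: "0 \<le> ?D" using C by simp
  have "p \<bullet> k - v \<bullet> ?w = pairing (blinfun_apply (f\<theta> - f\<theta>') k) (emb z) + pairing (blinfun_apply (fu - fu') ?w) (emb z)"
    using linearized_state_duality[OF S f solves z(1), of k] z(3)[of k]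
    by (simp add: pairing_riesz pairing.diff_left blinfun.diff_left)
  then have "\<bar>p \<bullet> k - v \<bullet> ?w\<bar> \<le> norm (blinfun_apply (f\<theta> - f\<theta>') k) * norm (emb z) + norm (blinfun_apply (fu - fu') ?w) * norm (emb z)"
    using abs_pairing_le[of "blinfun_apply (f\<theta> - f\<theta>') k" "emb z"]
      abs_pairing_le[of "blinfun_apply (fu - fu') ?w" "emb z"] by linarith
  also have "\<dots> \<le> (norm (f\<theta> - f\<theta>') * norm k) * norm (emb z) + (norm (fu - fu') * (?D * norm k)) * norm (emb z)"
    by (intro add_mono mult_right_mono norm_blinfun order_trans[OF norm_blinfun] mult_left_mono w) auto
  also have "\<dots> \<le> (norm (f\<theta> - f\<theta>') + norm (fu - fu')) * (?D + 1) * norm k * norm (emb z)"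
  proof -
    have "norm (f\<theta> - f\<theta>') + norm (fu - fu') * ?D \<le> (norm (f\<theta> - f\<theta>') + norm (fu - fu')) * (?D + 1)"
    proof -
      have "0 \<le> norm (f\<theta> - f\<theta>') * ?D" by (intro mult_nonneg_nonneg D norm_ge_zero)
      then show ?thesis using norm_ge_zero[of "fu - fu'"] by (simp only: distrib_left distrib_right mult_1_right)
    qed
    then have "(norm (f\<theta> - f\<theta>') + norm (fu - fu') * ?D) * (norm k * norm (emb z))
        \<le> (norm (f\<theta> - f\<theta>') + norm (fu - fu')) * (?D + 1) * (norm k * norm (emb z))"
      by (intro mult_right_mono) auto
    then show ?thesis by (simp add: algebra_simps)
  qed
  also have "\<dots> \<le> (norm (f\<theta> - f\<theta>') + norm (fu - fu')) * (?D + 1) * norm k * (C * norm v)"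
  proof (rule mult_left_mono)
    show "norm (emb z) \<le> C * norm v" using z(2) norm_ge_zero[of "tr z 0"] by linarith
    show "0 \<le> (norm (f\<theta> - f\<theta>') + norm (fu - fu')) * (?D + 1) * norm k"
      using C by (intro mult_nonneg_nonneg add_nonneg_nonneg) auto
  qed
  finally show ?thesis by (simp add: mult_ac)
qed

text \<open>
  The operator norm of the Riesz isometry is 1 unless the space is trivial, where it is 0; the
  inequality covers both cases.
\<close>

lemma norm_le_onorm_riesz: "norm v \<le> onorm (blinfun_inner_right :: 'u \<Rightarrow> 'u \<Rightarrow>\<^sub>L real) * norm (v::'uu)"
proof (cases "\<forall>x::'u. x = 0")
  case True
  then have "norm (evU v t) = 0" for t by (metis norm_zero)
  then have "(\<integral>t. (norm (evU v t))\<^sup>2 \<partial>M) = 0" by simp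
  then show ?thesis by (simp add: norm_square_ev)
next
  case False
  then obtain x :: 'u where "x \<noteq> 0" by blast
  have "norm x \<le> onorm (blinfun_inner_right :: 'u \<Rightarrow> 'u \<Rightarrow>\<^sub>L real) * norm x"
    using onorm[OF bounded_linear_blinfun_inner_right, of x] by (simp add: norm_blinfun_inner_right)
  then have "1 \<le> onorm (blinfun_inner_right :: 'u \<Rightarrow> 'u \<Rightarrow>\<^sub>L real)" using \<open>x \<noteq> 0\<close> by simp
  then show ?thesis by (simp add: mult_le_cancel_right1)
qed

end

lemma norm_inv_riesz: "norm (inv blinfun_inner_right \<psi> :: 'a::{real_inner,banach}) = norm \<psi>"
  by (metis norm_blinfun_inner_right riesz_isomorphism_inverse(2))

lemma bounded_linear_inv_riesz:
  "bounded_linear (inv blinfun_inner_right :: ('a::{real_inner,banach} \<Rightarrow>\<^sub>L real) \<Rightarrow> 'a)"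
proof (rule bounded_linear_intro[where K = 1])
  show "inv blinfun_inner_right (\<psi> + \<psi>') = inv blinfun_inner_right \<psi> + (inv blinfun_inner_right \<psi>' :: 'a)" for \<psi> \<psi>'
    by (rule vector_eq_rdot[THEN iffD1]) (simp add: inner_add_left riesz_isomorphism_inverse blinfun.add_left)
  show "inv blinfun_inner_right (c *\<^sub>R \<psi>) = c *\<^sub>R (inv blinfun_inner_right \<psi> :: 'a)" for c \<psi>
    by (rule vector_eq_rdot[THEN iffD1]) (simp add: riesz_isomorphism_inverse blinfun.scaleR_left)
qed (simp add: norm_inv_riesz)

lemma norm_le_onorm_inv_riesz:
  "norm k \<le> onorm (inv blinfun_inner_right :: ('a::{real_inner,banach} \<Rightarrow>\<^sub>L real) \<Rightarrow> 'a) * norm (k::'a)"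
proof -
  have "norm (inv blinfun_inner_right (blinfun_inner_right k) :: 'a)
      \<le> onorm (inv blinfun_inner_right :: ('a \<Rightarrow>\<^sub>L real) \<Rightarrow> 'a) * norm (blinfun_inner_right k)"
    by (rule onorm[OF bounded_linear_inv_riesz])
  then show ?thesis by (simp add: norm_inv_riesz norm_blinfun_inner_right)
qed

section \<open>A perturbed Landweber iteration\<close>

text \<open>
  Here \<open>e\<close> is the error, \<open>r\<close> the residual, \<open>\<delta>\<close> its perturbation, \<open>g\<close> the image of \<open>e\<close> under the
  derivative, and \<open>c * \<epsilon>\<close> the relative error of the adjoint. After expanding the square, Young's
  inequality with weight \<open>\<nu>\<close> absorbs the terms that are linear in \<open>r\<close>, and with weight \<open>\<eta>\<close> it separates
  \<open>r\<close> from \<open>\<delta>\<close> in the square of \<open>p\<close>.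
\<close>

lemma inexact_landweber_step:
  fixes e p :: "'a::real_inner" and r \<delta> g :: "'b::real_inner"
  assumes pe: "p \<bullet> e \<ge> (r + \<delta>) \<bullet> g - c * \<epsilon> * (N * norm (r + \<delta>)) * norm e"
    and p: "norm p \<le> m * norm (r + \<delta>)" and \<delta>: "norm \<delta> \<le> N * \<epsilon>"
    and mono: "2 * (r \<bullet> g) \<ge> a * (norm r)\<^sup>2" and g: "norm g \<le> K * norm r" and e: "norm e \<le> R"
    and nonneg: "0 \<le> c" "0 \<le> \<epsilon>" "0 \<le> N" "0 < \<nu>" "0 < \<eta>" "0 \<le> R"
  shows "(norm (e - p))\<^sup>2 \<le> (norm e)\<^sup>2 - (a - \<nu> / 2 - (1 + \<eta>) * m\<^sup>2) * (norm r)\<^sup>2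
    + N\<^sup>2 * (2 * (K + c * R)\<^sup>2 / \<nu> + (1 + 1 / \<eta>) * m\<^sup>2 + 2 * c * R) * \<epsilon>\<^sup>2"
proof -
  define s where "s = norm r"
  define d where "d = N * \<epsilon>"
  have d: "0 \<le> d" using nonneg by (simp add: d_def)
  have rd: "norm (r + \<delta>) \<le> s + d" using norm_triangle_ineq[of r \<delta>] \<delta> by (simp add: s_def d_def)
  have s: "0 \<le> s" by (simp add: s_def)
  have "(norm p)\<^sup>2 \<le> (m * norm (r + \<delta>))\<^sup>2" by (intro power_mono p) simp
  also have "\<dots> \<le> m\<^sup>2 * (s + d)\<^sup>2"
    unfolding power_mult_distrib by (intro mult_left_mono power_mono rd) auto
  also have "\<dots> \<le> m\<^sup>2 * ((1 + \<eta>) * s\<^sup>2 + (1 + 1 / \<eta>) * d\<^sup>2)"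
  proof (intro mult_left_mono)
    have "0 \<le> (\<eta> * s - d)\<^sup>2 / \<eta>" using nonneg by simp
    also have "\<dots> = \<eta> * s\<^sup>2 - 2 * s * d + d\<^sup>2 / \<eta>"
      using nonneg by (simp add: power2_eq_square field_simps)
    finally show "(s + d)\<^sup>2 \<le> (1 + \<eta>) * s\<^sup>2 + (1 + 1 / \<eta>) * d\<^sup>2"
      by (simp add: power2_eq_square algebra_simps)
  qed simp
  finally have pp: "(norm p)\<^sup>2 \<le> (1 + \<eta>) * m\<^sup>2 * s\<^sup>2 + (1 + 1 / \<eta>) * m\<^sup>2 * d\<^sup>2"
    by (simp add: algebra_simps)
  have \<delta>g: "- (\<delta> \<bullet> g) \<le> d * (K * s)"
  proof -
    have "- (\<delta> \<bullet> g) \<le> norm \<delta> * norm g" using Cauchy_Schwarz_ineq2[of \<delta> g] by linarith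
    also have "\<dots> \<le> d * (K * s)" using \<delta> g d by (intro mult_mono) (auto simp: s_def d_def)
    finally show ?thesis .
  qed
  have err: "c * \<epsilon> * (N * norm (r + \<delta>)) * norm e \<le> c * d * (s + d) * R"
  proof -
    have "c * \<epsilon> * (N * norm (r + \<delta>)) * norm e = c * d * (norm (r + \<delta>) * norm e)"
      by (simp add: d_def mult_ac)
    also have "\<dots> \<le> c * d * ((s + d) * R)"
      using nonneg d rd e s by (intro mult_left_mono mult_mono) auto
    finally show ?thesis by (simp add: mult_ac)
  qed
  have young: "2 * d * (K + c * R) * s \<le> \<nu> / 2 * s\<^sup>2 + 2 * (K + c * R)\<^sup>2 / \<nu> * d\<^sup>2"
  proof -
    have "0 \<le> (\<nu> * s - 2 * (K + c * R) * d)\<^sup>2 / (2 * \<nu>)" using nonneg by simp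
    also have "\<dots> = \<nu> / 2 * s\<^sup>2 - 2 * d * (K + c * R) * s + 2 * (K + c * R)\<^sup>2 / \<nu> * d\<^sup>2"
      using nonneg by (simp add: power2_eq_square field_simps)
    finally show ?thesis by simp
  qed
  have "(norm (e - p))\<^sup>2 = (norm e)\<^sup>2 - 2 * (p \<bullet> e) + (norm p)\<^sup>2"
    unfolding power2_norm_eq_inner by (simp add: inner_simps inner_commute)
  also have "\<dots> \<le> (norm e)\<^sup>2 - a * s\<^sup>2 + 2 * (d * (K * s)) + 2 * (c * d * (s + d) * R) + (norm p)\<^sup>2"
    using pe \<delta>g err mono unfolding s_def[symmetric] inner_add_left by linarith
  also have "\<dots> = (norm e)\<^sup>2 - a * s\<^sup>2 + 2 * d * (K + c * R) * s + 2 * c * R * d\<^sup>2 + (norm p)\<^sup>2"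
    by (simp add: algebra_simps power2_eq_square)
  also have "\<dots> \<le> (norm e)\<^sup>2 - a * s\<^sup>2 + (\<nu> / 2 * s\<^sup>2 + 2 * (K + c * R)\<^sup>2 / \<nu> * d\<^sup>2) + 2 * c * R * d\<^sup>2
      + ((1 + \<eta>) * m\<^sup>2 * s\<^sup>2 + (1 + 1 / \<eta>) * m\<^sup>2 * d\<^sup>2)"
    using young pp by linarith
  also have "\<dots> = (norm e)\<^sup>2 - (a - \<nu> / 2 - (1 + \<eta>) * m\<^sup>2) * s\<^sup>2
    + (2 * (K + c * R)\<^sup>2 / \<nu> + (1 + 1 / \<eta>) * m\<^sup>2 + 2 * c * R) * d\<^sup>2"
    by (simp only: left_diff_distrib distrib_right)
  also have "d\<^sup>2 = N\<^sup>2 * \<epsilon>\<^sup>2" by (simp add: d_def power_mult_distrib)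
  finally show ?thesis by (simp add: s_def mult_ac)
qed

text \<open>
  The descent is only available while \<open>a j\<close> is at most \<open>R\<close>; the bound on the sum of the perturbations
  shows inductively that it never exceeds \<open>R\<close>. Then the weighted partial sums of \<open>b\<close> are bounded by \<open>R\<close>.
\<close>

lemma perturbed_descent:
  fixes a b s :: "nat \<Rightarrow> real"
  assumes step: "\<And>j. a j \<le> R \<Longrightarrow> a (Suc j) \<le> a j - c * b j + C * s j"
    and a0: "a 0 \<le> R0" and a: "\<And>j. 0 \<le> a j" and b: "\<And>j. 0 \<le> b j" and s: "\<And>j. 0 \<le> s j"
    and c: "0 < c" and C: "0 \<le> C" and sum: "summable s" "C * (\<Sum>j. s j) \<le> R - R0"
  shows "a j \<le> R" and "b \<longlonglongrightarrow> 0"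
proof -
  have partial: "C * (\<Sum>j<n. s j) \<le> R - R0" for n
    using mult_left_mono[OF sum_le_suminf[OF sum(1), of "{..<n}"] C] sum(2) s by auto
  have inv: "a n + c * (\<Sum>j<n. b j) \<le> R0 + C * (\<Sum>j<n. s j)" for n
  proof (induction n)
    case 0
    then show ?case using a0 by simp
  next
    case (Suc n)
    have "0 \<le> c * (\<Sum>j<n. b j)" using b c by (simp add: sum_nonneg)
    then have "a n \<le> R" using Suc partial[of n] by linarith
    from step[OF this] Suc show ?case by (simp add: distrib_left)
  qed
  have "0 \<le> c * (\<Sum>j<n. b j)" for n using b c by (simp add: sum_nonneg)
  then show "a j \<le> R" using inv[of j] partial[of j] by (smt (verit))
  have "(\<Sum>j<n. b j) \<le> R / c" for n
  proof -
    have "c * (\<Sum>j<n. b j) \<le> R" using inv[of n] partial[of n] a[of n] by linarith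
    then show ?thesis using c by (simp add: pos_le_divide_eq mult.commute)
  qed
  then have "summable b" using b by (intro bounded_imp_summable[where B = "R / c"]) (auto simp only: lessThan_Suc_atMost[symmetric])
  then show "b \<longlonglongrightarrow> 0" by (rule summable_LIMSEQ_zero)
qed

lemma weakly_converges_cball:
  fixes x :: "nat \<Rightarrow> 'a::real_inner"
  assumes "weakly_converges x l" and bd: "\<And>n. x n \<in> cball c R"
  shows "l \<in> cball c R"
proof -
  have "(\<lambda>n. (x n - c) \<bullet> (l - c)) \<longlonglongrightarrow> (l - c) \<bullet> (l - c)"
    using assms(1) unfolding weakly_converges_def inner_diff_left by (intro tendsto_diff tendsto_const) blast
  moreover have "(x n - c) \<bullet> (l - c) \<le> R * norm (l - c)" for n
  proof -
    have "(x n - c) \<bullet> (l - c) \<le> norm (x n - c) * norm (l - c)" by (rule norm_cauchy_schwarz)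
    also have "\<dots> \<le> R * norm (l - c)"
      using bd[of n] by (intro mult_right_mono) (auto simp: dist_norm norm_minus_commute)
    finally show ?thesis .
  qed
  ultimately have "(l - c) \<bullet> (l - c) \<le> R * norm (l - c)" by (intro LIMSEQ_le_const2) auto
  then have "norm (l - c) * norm (l - c) \<le> R * norm (l - c)" by (simp add: power2_norm_eq_inner[symmetric] power2_eq_square)
  moreover have "0 \<le> R" using bd[of 0] by (metis dist_not_less_zero mem_cball not_le_imp_less order_less_le_trans order_le_less_trans)
  ultimately have "norm (l - c) \<le> R" by (cases "l = c") auto
  then show ?thesis by (simp add: dist_norm norm_minus_commute)
qed

section \<open>Convergence of the bi-level iteration\<close>

theorem proposition3:
  fixes T :: real
    and \<iota> :: "'u::{real_inner,banach} \<Rightarrow>\<^sub>L 'h::{real_inner,banach}"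
    and evU :: "'uu::{real_inner,banach} \<Rightarrow> real \<Rightarrow> 'u"
    and evUs :: "'us::{real_inner,banach} \<Rightarrow> real \<Rightarrow> ('u \<Rightarrow>\<^sub>L real)"
    and emb :: "'v::{real_inner,banach} \<Rightarrow> 'uu"
    and dt :: "'v \<Rightarrow> 'us"
    and tr :: "'v \<Rightarrow> real \<Rightarrow> 'h"
    and A :: "'x::{real_inner,banach} \<Rightarrow>\<^sub>L 'h"
    and L :: "'uu \<Rightarrow>\<^sub>L 'y::{real_inner,banach}"
    and f0 :: "real \<Rightarrow> 'x \<Rightarrow> 'u \<Rightarrow> ('u \<Rightarrow>\<^sub>L real)"
    and f :: "'x \<Rightarrow> 'v \<Rightarrow> 'us"
    and f\<theta> :: "'x \<Rightarrow> 'v \<Rightarrow> ('x \<Rightarrow>\<^sub>L 'us)"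
    and f\<theta>t :: "'x \<Rightarrow> 'v \<Rightarrow> real \<Rightarrow> ('x \<Rightarrow>\<^sub>L ('u \<Rightarrow>\<^sub>L real))"
    and fu :: "'x \<Rightarrow> 'v \<Rightarrow> ('uu \<Rightarrow>\<^sub>L 'us)"
    and S :: "'x \<Rightarrow> 'v"
    and G :: "'x \<Rightarrow> 'y"
    and F :: "'x \<Rightarrow> 'v \<Rightarrow> 'us \<times> 'h"
    and \<theta>d :: 'x and ud :: 'v and y :: 'y
    and R R0 r :: real
    and MSbar MS Cfu Lf Ccoe Mr \<mu>r MR \<mu>R KR \<alpha> :: real
    and LRr Cnab \<epsilon>bar MRt \<sigma> \<eta> Cpri :: real
    and \<theta> :: "nat \<Rightarrow> 'x"
    and u :: "nat \<Rightarrow> nat \<Rightarrow> 'v"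
    and \<kappa> :: "nat \<Rightarrow> nat"
    and \<epsilon> :: "nat \<Rightarrow> real"
  assumes T_pos: "0 < T"
    and gelfand: "gelfand_triple \<iota>"
    and space_U: "L2_space T evU"
    and space_Us: "L2_space T evUs"
    and space_V: "solution_space T \<iota> evUs evU emb dt tr"
    (* the nonlinearity, the induced operator and its partial derivatives *)
    and f0_carath: "caratheodory T f0"
    and f_induced: "\<And>x v. AE t in time_measure T. evUs (f x v) t = f0 t x (evU (emb v) t)"
    and f_deriv: "\<And>x v. x \<in> cball \<theta>d R \<Longrightarrow> v \<in> cball ud r \<Longrightarrow>
        ((\<lambda>(x, v). f x v) has_derivative
          (\<lambda>(h, w). blinfun_apply (f\<theta> x v) h + blinfun_apply (fu x v) (emb w))) (at (x, v))"
    and f\<theta>_slices: "\<And>x v h. x \<in> cball \<theta>d R \<Longrightarrow> v \<in> cball ud r \<Longrightarrow>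
        AE t in time_measure T.
          evUs (blinfun_apply (f\<theta> x v) h) t = blinfun_apply (f\<theta>t x v t) h"
    (* parameter-to-state map, forward operators, exact data *)
    and S_solves: "\<And>x. dt (S x) + f x (S x) = 0 \<and> tr (S x) 0 = blinfun_apply A x"
    and S_diff: "\<And>x. S differentiable (at x)"
    and G_def: "\<And>x. G x = blinfun_apply L (emb (S x))"
    and F_def: "\<And>x v. F x v = (dt v + f x v, tr v 0 - blinfun_apply A x)"
    and ud_def: "ud = S \<theta>d"
    and y_def: "y = G \<theta>d"
    (* constants *)
    and r_pos: "0 < r"
    and consts_pos: "0 < MSbar" "0 < MS" "0 < Cfu" "0 < Lf" "0 < Ccoe"
        "0 < Mr" "0 < \<mu>r" "0 < MR" "0 < \<mu>R" "0 < KR"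
    and Mr_bound: "Mr\<^sup>2 + \<mu>r < 2"
    and MR_bound: "MR\<^sup>2 + \<mu>R < 2"
    and \<alpha>_ge: "1 \<le> \<alpha>"
    (* (A1)--(A7) *)
    and A1: "\<And>x. x \<in> cball \<theta>d R \<Longrightarrow>
        onorm (frechet_derivative S (at x)) \<le> MSbar \<and>
        onorm (\<lambda>h. emb (frechet_derivative S (at x) h)) \<le> MS \<and>
        onorm (frechet_derivative G (at x)) \<le> MR"
    and A2: "\<And>x v h. x \<in> cball \<theta>d R \<Longrightarrow> v \<in> cball ud r \<Longrightarrow>
        \<exists>z. adjoint_equation T evUs evU emb dt tr (fu x v) h z \<and>
            norm (emb z) + norm (tr z 0) \<le> Cfu * norm h"
    and A3: "\<And>x x' v v'. x \<in> cball \<theta>d R \<Longrightarrow> x' \<in> cball \<theta>d R \<Longrightarrow>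
        v \<in> cball ud r \<Longrightarrow> v' \<in> cball ud r \<Longrightarrow>
        norm (f\<theta> x v - f\<theta> x' v') + norm (fu x v - fu x' v')
          \<le> Lf * (norm (x - x') + norm (emb v - emb v'))"
    and A4: "\<And>x v. x \<in> cball \<theta>d R \<Longrightarrow> v \<in> cball ud r \<Longrightarrow>
        onorm (frechet_derivative (F x) (at v)) \<le> Mr"
    and A5: "\<And>x v v'. x \<in> cball \<theta>d R \<Longrightarrow> v \<in> cball ud r \<Longrightarrow> v' \<in> cball ud r \<Longrightarrow>
        2 * ((F x v - F x v') \<bullet> frechet_derivative (F x) (at v) (v - v'))
          \<ge> (Mr\<^sup>2 + \<mu>r) * (norm (F x v - F x v'))\<^sup>2"
    and A6: "\<And>x v. x \<in> cball \<theta>d R \<Longrightarrow> v \<in> cball ud r \<Longrightarrow>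
        Ccoe * norm (F x v - F x (S x)) \<ge> norm (v - S x) powr \<alpha>"
    and A7: "\<And>x x'. x \<in> cball \<theta>d R \<Longrightarrow> x' \<in> cball \<theta>d R \<Longrightarrow>
        2 * ((G x - G x') \<bullet> frechet_derivative G (at x) (x - x'))
          \<ge> (MR\<^sup>2 + \<mu>R) * (norm (G x - G x'))\<^sup>2 \<and>
        norm (frechet_derivative G (at x) (x - x')) \<le> KR * norm (G x - G x')"
    (* derived constants *)
    and LRr_def: "LRr = Lf * (R + r * onorm emb) + norm (f\<theta> \<theta>d ud) + norm (fu \<theta>d ud)"
    and Cnab_def: "Cnab = Lf * Cfu * onorm (inv blinfun_inner_right :: ('x \<Rightarrow>\<^sub>L real) \<Rightarrow> 'x)
        * onorm (blinfun_inner_right :: 'u \<Rightarrow> 'u \<Rightarrow>\<^sub>L real) * (LRr * Cfu + 1 + norm A * Cfu)"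
    and \<epsilon>_def: "\<And>j. \<epsilon> j = norm (emb (u j (\<kappa> j)) - emb (S (\<theta> j)))"
    and \<epsilon>bar: "\<And>j. \<epsilon> j \<le> \<epsilon>bar"
    and MRt_def: "MRt = (MS + Cnab * \<epsilon>bar) * norm L"
    and Cpri_def: "Cpri = (norm L)\<^sup>2 *
        (2 * (KR + Cnab * R)\<^sup>2 / (\<mu>R - \<sigma>) + (1 + 1 / \<eta>) * MRt\<^sup>2 + 2 * Cnab * R)"
    (* the algorithm *)
    and init_upper: "norm (\<theta> 0 - \<theta>d) \<le> R0" "R0 < R"
    and upper: "\<And>j. \<exists>p. approx_adjoint T evUs evU emb dt tr Cfu A
          (f\<theta>t (\<theta> j) (u j (\<kappa> j))) (fu (\<theta> j) (u j (\<kappa> j)))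
          (adjoint (blinfun_apply L) (blinfun_apply L (emb (u j (\<kappa> j))) - y)) p \<and>
        \<theta> (Suc j) = \<theta> j - p"
    and lower: "\<And>j k. k < \<kappa> j \<Longrightarrow> u j (Suc k) = u j k -
          adjoint (frechet_derivative (F (\<theta> j)) (at (u j k))) (F (\<theta> j) (u j k))"
    and init_lower:
        "(\<forall>j. u j 0 \<in> cball (S (\<theta> j)) (r / 2)) \<or>
         ((\<forall>j. u (Suc j) 0 = u j (\<kappa> j)) \<and> (\<forall>j. u j 0 \<in> cball (S (\<theta> j)) (r / 2)))"
    and in_balls: "\<And>j. \<theta> j \<in> cball \<theta>d R \<Longrightarrow>
        S (\<theta> j) \<in> cball ud r \<and> (\<forall>k\<le>\<kappa> j. u j k \<in> cball ud r)"
    (* parameter choice and stopping rule *)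
    and \<sigma>: "0 \<le> \<sigma>" "\<sigma> < \<mu>R"
    and \<eta>: "0 < \<eta>" "(1 + \<eta>) * MRt\<^sup>2 < MR\<^sup>2 + \<mu>R / 2"
    and stopping: "summable (\<lambda>j. (\<epsilon> j)\<^sup>2)" "Cpri * (\<Sum>j. (\<epsilon> j)\<^sup>2) \<le> R\<^sup>2 - R0\<^sup>2"
  shows "(\<forall>j. \<theta> j \<in> cball \<theta>d R) \<and>
    (\<exists>s \<theta>bar. strict_mono s \<and> weakly_converges (\<theta> \<circ> s) \<theta>bar \<and> G \<theta>bar = y) \<and>
    (\<lambda>j. G (\<theta> j)) \<longlonglongrightarrow> y"
proof -
  interpret L2_duality T evU evUs
    by unfold_locales (rule space_U space_Us)+
  interpret evolution_space T evU evUs \<iota> emb dt tr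
    by unfold_locales (rule T_pos space_V)+
  define S' where "S' = (\<lambda>x. frechet_derivative S (at x))"
  have S_der: "(S has_derivative S' x) (at x)" for x
    using S_diff unfolding S'_def frechet_derivative_works .
  have G_der: "(G has_derivative (\<lambda>k. blinfun_apply L (emb (S' x k)))) (at x)" for x
    unfolding G_def[abs_def]
    by (intro bounded_linear.has_derivative[OF blinfun.bounded_linear_right]
        bounded_linear.has_derivative[OF bounded_linear_emb_dt(1)] S_der)
  have G'_eq: "frechet_derivative G (at x) = (\<lambda>k. blinfun_apply L (emb (S' x k)))" for x
    using frechet_derivative_at[OF G_der] by simp
  have R0: "0 \<le> R0" using init_upper(1) norm_ge_zero[of "\<theta> 0 - \<theta>d"] by linarith
  then have R: "0 < R" using init_upper(2) by linarith
  have \<theta>d_in: "\<theta>d \<in> cball \<theta>d R" and ud_in: "ud \<in> cball ud r" using R r_pos by auto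
  have emb_nn: "0 \<le> onorm emb" by (rule onorm_pos_le[OF bounded_linear_emb_dt(1)])
  have LRr_nn: "0 \<le> LRr"
    unfolding LRr_def using consts_pos R r_pos emb_nn by simp
  have onorms: "0 \<le> onorm (inv blinfun_inner_right :: ('x \<Rightarrow>\<^sub>L real) \<Rightarrow> 'x)"
      "0 \<le> onorm (blinfun_inner_right :: 'u \<Rightarrow> 'u \<Rightarrow>\<^sub>L real)"
    by (rule onorm_pos_le[OF bounded_linear_inv_riesz] onorm_pos_le[OF bounded_linear_blinfun_inner_right])+
  have Cnab_nn: "0 \<le> Cnab"
    unfolding Cnab_def using consts_pos LRr_nn onorms by simp
  have \<epsilon>_nn: "0 \<le> \<epsilon> j" for j by (simp add: \<epsilon>_def)
  have f\<theta>_bound: "norm (f\<theta> x v) \<le> LRr" if x: "x \<in> cball \<theta>d R" and v: "v \<in> cball ud r" for x v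
  proof -
    have "norm (f\<theta> x v - f\<theta> \<theta>d ud) \<le> Lf * (norm (x - \<theta>d) + norm (emb v - emb ud))"
      using A3[OF x \<theta>d_in v ud_in] norm_ge_zero[of "fu x v - fu \<theta>d ud"] by linarith
    also have "\<dots> \<le> Lf * (R + r * onorm emb)"
    proof (intro mult_left_mono add_mono)
      have "emb v - emb ud = emb (v - ud)"
        by (simp add: bounded_linear_emb_dt(1)[THEN bounded_linear.linear] linear_diff)
      then have "norm (emb v - emb ud) \<le> onorm emb * norm (v - ud)"
        using onorm[OF bounded_linear_emb_dt(1)] by simp
      also have "\<dots> \<le> onorm emb * r"
        using v emb_nn by (intro mult_left_mono) (auto simp: dist_norm norm_minus_commute)
      finally show "norm (emb v - emb ud) \<le> r * onorm emb" by (simp add: mult.commute)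
    qed (use x consts_pos in \<open>auto simp: dist_norm norm_minus_commute\<close>)
    finally have "norm (f\<theta> x v) \<le> Lf * (R + r * onorm emb) + norm (f\<theta> \<theta>d ud)"
      using norm_triangle_ineq2[of "f\<theta> x v" "f\<theta> \<theta>d ud"] by linarith
    then show ?thesis unfolding LRr_def using norm_ge_zero[of "fu \<theta>d ud"] by linarith
  qed
  \<comment> \<open>the coefficient of the squared residual in \<open>inexact_landweber_step\<close> with \<open>\<nu> = \<mu>R - \<sigma>\<close>;
    it is positive by the choice of \<open>\<eta>\<close>\<close>
  define c where "c = MR\<^sup>2 + \<mu>R - (\<mu>R - \<sigma>) / 2 - (1 + \<eta>) * MRt\<^sup>2"
  have c: "0 < c" using \<sigma> \<eta> by (simp add: c_def field_simps)
  have descent: "(norm (\<theta> (Suc j) - \<theta>d))\<^sup>2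
      \<le> (norm (\<theta> j - \<theta>d))\<^sup>2 - c * (norm (G (\<theta> j) - y))\<^sup>2 + Cpri * (\<epsilon> j)\<^sup>2"
    if le: "(norm (\<theta> j - \<theta>d))\<^sup>2 \<le> R\<^sup>2" for j
  proof -
    have nle: "norm (\<theta> j - \<theta>d) \<le> R" using power2_le_imp_le[OF le] R by simp
    then have x: "\<theta> j \<in> cball \<theta>d R" by (simp add: dist_norm norm_minus_commute)
    let ?u = "u j (\<kappa> j)"
    have Sx: "S (\<theta> j) \<in> cball ud r" and ux: "?u \<in> cball ud r" using in_balls[OF x] by auto
    define \<rho> where "\<rho> = blinfun_apply L (emb ?u) - y"
    define v where "v = adjoint (blinfun_apply L) \<rho>"
    have v: "norm v \<le> norm L * norm \<rho>" unfolding v_def by (rule norm_adjoint_le)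
    have v_inner: "v \<bullet> w = \<rho> \<bullet> blinfun_apply L w" for w
      unfolding v_def using inner_adjoint[OF blinfun.bounded_linear_right, of L w \<rho>]
      by (simp add: inner_commute)
    obtain p where p: "approx_adjoint T evUs evU emb dt tr Cfu A (f\<theta>t (\<theta> j) ?u) (fu (\<theta> j) ?u) v p"
      and step: "\<theta> (Suc j) = \<theta> j - p"
      using upper[of j] unfolding v_def \<rho>_def by blast
    have error: "\<bar>p \<bullet> k - v \<bullet> emb (S' (\<theta> j) k)\<bar> \<le> Cnab * \<epsilon> j * (norm v * norm k)" for k
    proof -
      let ?N = "norm (f\<theta> (\<theta> j) (S (\<theta> j)) - f\<theta> (\<theta> j) ?u) + norm (fu (\<theta> j) (S (\<theta> j)) - fu (\<theta> j) ?u)"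
      let ?a = "onorm (inv blinfun_inner_right :: ('x \<Rightarrow>\<^sub>L real) \<Rightarrow> 'x)"
        and ?b = "onorm (blinfun_inner_right :: 'u \<Rightarrow> 'u \<Rightarrow>\<^sub>L real)"
      have N: "?N \<le> Lf * \<epsilon> j"
        using A3[OF x x Sx ux] by (simp add: \<epsilon>_def norm_minus_commute)
      have F: "(norm (f\<theta> (\<theta> j) (S (\<theta> j))) + norm A) * Cfu + 1 \<le> LRr * Cfu + 1 + norm A * Cfu"
        using mult_right_mono[OF f\<theta>_bound[OF x Sx], of Cfu] consts_pos by (simp add: distrib_right)
      have "\<bar>p \<bullet> k - v \<bullet> emb (S' (\<theta> j) k)\<bar>
          \<le> ?N * Cfu * ((norm (f\<theta> (\<theta> j) (S (\<theta> j))) + norm A) * Cfu + 1) * (norm v * norm k)"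
        by (rule approx_adjoint_error[OF S_der f_deriv[OF x Sx] _ _ A2[OF x Sx] _ p f\<theta>_slices[OF x ux]])
          (use S_solves consts_pos in auto)
      also have "\<dots> \<le> (Lf * \<epsilon> j) * Cfu * (LRr * Cfu + 1 + norm A * Cfu) * ((?b * norm v) * (?a * norm k))"
        using N F consts_pos \<epsilon>_nn LRr_nn onorms norm_le_onorm_riesz[of v] norm_le_onorm_inv_riesz[of k]
        by (intro mult_mono mult_nonneg_nonneg add_nonneg_nonneg) auto
      also have "\<dots> = Cnab * \<epsilon> j * (norm v * norm k)" by (simp add: Cnab_def mult_ac)
      finally show ?thesis .
    qed
    \<comment> \<open>the error bound in direction \<open>p\<close> itself controls the length of the step\<close>
    have p_norm: "norm p \<le> MRt * norm \<rho>"
    proof -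
      have S'p: "norm (emb (S' (\<theta> j) p)) \<le> MS * norm p"
      proof -
        have "norm (emb (S' (\<theta> j) p)) \<le> onorm (\<lambda>h. emb (S' (\<theta> j) h)) * norm p"
          by (rule onorm[OF bounded_linear_compose[OF bounded_linear_emb_dt(1) has_derivative_bounded_linear[OF S_der]]])
        also have "\<dots> \<le> MS * norm p" using A1[OF x] by (intro mult_right_mono) (auto simp: S'_def)
        finally show ?thesis .
      qed
      have "norm p * norm p = p \<bullet> p" by (simp add: power2_norm_eq_inner[symmetric] power2_eq_square)
      also have "\<dots> \<le> v \<bullet> emb (S' (\<theta> j) p) + Cnab * \<epsilon> j * (norm v * norm p)"
        using error[of p] by linarith
      also have "\<dots> \<le> norm v * (MS * norm p) + Cnab * \<epsilon>bar * (norm v * norm p)"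
        using norm_cauchy_schwarz[of v "emb (S' (\<theta> j) p)"] mult_left_mono[OF S'p, of "norm v"] \<epsilon>bar[of j] Cnab_nn
        by (intro add_mono mult_right_mono mult_left_mono) auto
      also have "\<dots> = (MS + Cnab * \<epsilon>bar) * norm v * norm p" by (simp add: algebra_simps)
      also have "\<dots> \<le> (MS + Cnab * \<epsilon>bar) * (norm L * norm \<rho>) * norm p"
        using v consts_pos Cnab_nn \<epsilon>bar[of j] \<epsilon>_nn[of j]
        by (intro mult_right_mono mult_left_mono add_nonneg_nonneg mult_nonneg_nonneg) auto
      finally have "norm p * norm p \<le> (MRt * norm \<rho>) * norm p" by (simp add: MRt_def mult_ac)
      moreover have "0 \<le> MRt * norm \<rho>"
        unfolding MRt_def using consts_pos Cnab_nn \<epsilon>bar[of j] \<epsilon>_nn[of j]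
        by (intro mult_nonneg_nonneg add_nonneg_nonneg) auto
      ultimately show ?thesis by (cases "p = 0") auto
    qed
    define \<delta> where "\<delta> = blinfun_apply L (emb ?u - emb (S (\<theta> j)))"
    have \<rho>: "\<rho> = (G (\<theta> j) - y) + \<delta>" by (simp add: \<rho>_def \<delta>_def G_def blinfun.diff_right)
    have \<delta>: "norm \<delta> \<le> norm L * \<epsilon> j" unfolding \<delta>_def \<epsilon>_def by (rule norm_blinfun)
    let ?g = "frechet_derivative G (at (\<theta> j)) (\<theta> j - \<theta>d)"
    have pe: "p \<bullet> (\<theta> j - \<theta>d) \<ge> \<rho> \<bullet> ?g - Cnab * \<epsilon> j * (norm L * norm \<rho>) * norm (\<theta> j - \<theta>d)"
    proof -
      have "Cnab * \<epsilon> j * (norm v * norm (\<theta> j - \<theta>d)) \<le> Cnab * \<epsilon> j * ((norm L * norm \<rho>) * norm (\<theta> j - \<theta>d))"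
        using v Cnab_nn \<epsilon>_nn[of j] by (intro mult_left_mono mult_right_mono) auto
      with error[of "\<theta> j - \<theta>d"] show ?thesis by (simp add: v_inner G'_eq mult.assoc)
    qed
    have "(norm ((\<theta> j - \<theta>d) - p))\<^sup>2 \<le> (norm (\<theta> j - \<theta>d))\<^sup>2
        - (MR\<^sup>2 + \<mu>R - (\<mu>R - \<sigma>) / 2 - (1 + \<eta>) * MRt\<^sup>2) * (norm (G (\<theta> j) - y))\<^sup>2
        + (norm L)\<^sup>2 * (2 * (KR + Cnab * R)\<^sup>2 / (\<mu>R - \<sigma>) + (1 + 1 / \<eta>) * MRt\<^sup>2 + 2 * Cnab * R) * (\<epsilon> j)\<^sup>2"
      by (rule inexact_landweber_step[OF pe[unfolded \<rho>] p_norm[unfolded \<rho>] \<delta> _ _ nle])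
        (use A7[OF x \<theta>d_in] Cnab_nn \<epsilon>_nn[of j] \<sigma> \<eta> R in \<open>auto simp: y_def\<close>)
    moreover have "\<theta> (Suc j) - \<theta>d = (\<theta> j - \<theta>d) - p" by (simp add: step)
    ultimately show ?thesis by (simp only: c_def Cpri_def)
  qed
  have Cpri_nn: "0 \<le> Cpri"
    unfolding Cpri_def using \<sigma> \<eta> Cnab_nn R by (intro mult_nonneg_nonneg add_nonneg_nonneg) auto
  note limits = perturbed_descent[where a = "\<lambda>j. (norm (\<theta> j - \<theta>d))\<^sup>2" and b = "\<lambda>j. (norm (G (\<theta> j) - y))\<^sup>2"
      and s = "\<lambda>j. (\<epsilon> j)\<^sup>2", OF descent power_mono[OF init_upper(1) norm_ge_zero]
        zero_le_power2 zero_le_power2 zero_le_power2 c Cpri_nn stopping]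
  have ball: "\<theta> j \<in> cball \<theta>d R" for j
    using power2_le_imp_le[OF limits(1)] R by (simp add: dist_norm norm_minus_commute)
  have "(\<lambda>j. sqrt ((norm (G (\<theta> j) - y))\<^sup>2)) \<longlonglongrightarrow> sqrt 0"
    by (intro tendsto_real_sqrt limits(2))
  then have conv: "(\<lambda>j. G (\<theta> j)) \<longlonglongrightarrow> y"
    by (simp add: tendsto_norm_zero_iff LIM_zero_iff)
  have "norm (\<theta> j) \<le> R + norm \<theta>d" for j
    using ball[of j] norm_triangle_sub[of "\<theta> j" \<theta>d] by (simp add: dist_norm norm_minus_commute)
  then obtain s \<theta>bar where s: "strict_mono s" and weak: "weakly_converges (\<theta> \<circ> s) \<theta>bar"
    using bounded_sequence_weakly_compact by blast
  have bar: "\<theta>bar \<in> cball \<theta>d R" by (rule weakly_converges_cball[OF weak]) (simp add: ball del: mem_cball)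
  have "(\<lambda>n. (G \<theta>bar - G (\<theta> (s n))) \<bullet> frechet_derivative G (at \<theta>bar) (\<theta>bar - \<theta> (s n))) \<longlonglongrightarrow> 0"
  proof (rule tendsto_inner_strong_weak[where T = "frechet_derivative G (at \<theta>bar)"])
    show "bounded_linear (frechet_derivative G (at \<theta>bar))"
      unfolding G'_eq by (rule has_derivative_bounded_linear[OF G_der])
    show convs: "(\<lambda>n. G \<theta>bar - G (\<theta> (s n))) \<longlonglongrightarrow> G \<theta>bar - y"
      using LIMSEQ_subseq_LIMSEQ[OF conv s] by (intro tendsto_diff tendsto_const) (simp add: o_def)
    have "(\<lambda>n. \<theta>bar \<bullet> \<xi> - \<theta> (s n) \<bullet> \<xi>) \<longlonglongrightarrow> \<theta>bar \<bullet> \<xi> - \<theta>bar \<bullet> \<xi>" for \<xi>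
      using weak by (intro tendsto_diff tendsto_const) (simp add: weakly_converges_def)
    then show "weakly_converges (\<lambda>n. \<theta>bar - \<theta> (s n)) 0"
      by (simp add: weakly_converges_def inner_diff_left)
    show "norm (\<theta>bar - \<theta> (s n)) \<le> R + R" for n
      using bar ball[of "s n"] dist_triangle2[of \<theta>bar "\<theta> (s n)" \<theta>d] by (simp add: dist_norm norm_minus_commute[of \<theta>d])
  qed
  then have product_lim: "(\<lambda>n. 2 * ((G \<theta>bar - G (\<theta> (s n))) \<bullet> frechet_derivative G (at \<theta>bar) (\<theta>bar - \<theta> (s n)))) \<longlonglongrightarrow> 2 * 0"
    by (rule tendsto_mult_left)
  \<comment> \<open>the monotonicity condition at \<open>\<theta>bar\<close> compares this sequence with the previous one\<close>
  have residual_lim: "(\<lambda>n. (MR\<^sup>2 + \<mu>R) * (norm (G \<theta>bar - G (\<theta> (s n))))\<^sup>2) \<longlonglongrightarrow> (MR\<^sup>2 + \<mu>R) * (norm (G \<theta>bar - y))\<^sup>2"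
    using LIMSEQ_subseq_LIMSEQ[OF conv s] by (intro tendsto_intros) (simp add: o_def)
  have "(MR\<^sup>2 + \<mu>R) * (norm (G \<theta>bar - y))\<^sup>2 \<le> 2 * 0"
    by (rule LIMSEQ_le[OF residual_lim product_lim]) (use A7[OF bar ball] in blast)
  moreover have "0 < MR\<^sup>2 + \<mu>R" using consts_pos by (simp add: add_pos_pos)
  ultimately have "G \<theta>bar = y" by (simp add: mult_le_0_iff)
  with ball s weak conv show ?thesis by blast
qed

end
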